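(* Let $P$ be a closed polyhedral surface embedded in $\mathbb{R}^3$ all of whose faces are planar triangles and such that no two faces sharing an edge are coplanar. Let $\mathbf{v}$ be a vertex of $P$ and let $\xi\in S^2$ be general for $\mathbf{v}$. Then $$i(\mathbf{v},\xi)=w(g(\mathbf{v}),\xi)+w(g(\mathbf{v}),-\xi).$$
   Context: $P$ is oriented and $\mathbf{n}_f\in S^2$ is the outer unit normal of the face $f$. The star of $\mathbf{v}$ is the set of faces incident to $\mathbf{v}$. A vector $\xi\in S^2$ is general for $\mathbf{v}$ if $\langle \xi,\mathbf{v}\rangle\ne\langle\xi,\mathbf{v}'\rangle$ for every vertex $\mathbf{v}'$ joined to $\mathbf{v}$ by an edge. Critical point index: for an edge or face $s$ of $P$ incident to $\mathbf{v}$ put $A(s,\mathbf{v},\xi)=1$ if $\langle\xi,\mathbf{v}\rangle\ge\langle\xi,\mathbf{v}'\rangle$ for all vertices $\mathbf{v}'$ of $s$, and $A(s,\mathbf{v},\xi)=0$ otherwise; if $s$ is not incident to $\mathbf{v}$, $A(s,\mathbf{v},\xi)=0$. Then $i(\mathbf{v},\xi):=1-\sum_{e}A(e,\mathbf{v},\xi)+\sum_f A(f,\mathbf{v},\xi)$, the sums running over all edges $e$ and all faces $f$ of $P$. Gauss image: let $f_1,\dots,f_n$ be the faces of the star of $\mathbf{v}$ in counterclockwise order (with respect to the orientation of $P$). $g(\mathbf{v})$ is the closed oriented spherical polygon with vertices $\mathbf{n}_{f_1},\dots,\mathbf{n}_{f_n}$ in this order, consecutive normals being joined by the shorter great circle arc.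 Winding number: for $\xi\in S^2$ not on $g(\mathbf{v})$, $w(g(\mathbf{v}),\xi)$ is the value of the unique integer-valued function (defined for all embedded vertex stars) with the following properties. (1) $w(g(\mathbf{v}),\cdot)$ is constant on each connected component of $S^2\setminus g(\mathbf{v})$. (2) If $\xi$ crosses $g(\mathbf{v})$ from left to right, the winding number decreases by $1$. (3) Under continuous deformations of $P$ (through embedded polyhedral surfaces), $w(g(\mathbf{v}),\xi)$ does not change as long as $\xi$ never lies on $g(\mathbf{v})$. (4) If $\mathbf{v}$ is a convex corner (its star determines the boundary of a convex polyhedral cone), then $w(g(\mathbf{v}),\xi)=1$ if $\xi$ lies in the component of the complement of $g(\mathbf{v})$ of area less than $2\pi$, and $w(g(\mathbf{v}),\xi)=0$ if $\xi$ lies in the component of area larger than $2\pi$. *)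

theory Defs
  imports "HOL-Analysis.Analysis"
begin

section \<open>Closed polyhedral surfaces with triangular faces\<close>

text \<open>A triangle in space is represented by the set of its three vertices, and a polyhedral
  surface by the finite set of its triangles.\<close>

definition embedded_triangles :: "(real^3) set set \<Rightarrow> bool" where
  "embedded_triangles F \<longleftrightarrow>
     finite F \<and>
     (\<forall>f\<in>F. card f = 3 \<and> \<not> affine_dependent f) \<and>
     (\<forall>f\<in>F. \<forall>g\<in>F. convex hull f \<inter> convex hull g = convex hull (f \<inter> g))"

definition surface_points :: "(real^3) set set \<Rightarrow> (real^3) set" where
  "surface_points F = (\<Union>f\<in>F. convex hull f)"

definition surface_vertices :: "(real^3) set set \<Rightarrow> (real^3) set" where
  "surface_vertices F = \<Union>F"

definition surface_edges :: "(real^3) set set \<Rightarrow> (real^3) set set" where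
  "surface_edges F = {e. card e = 2 \<and> (\<exists>f\<in>F. e \<subseteq> f)}"

definition star :: "(real^3) set set \<Rightarrow> real^3 \<Rightarrow> (real^3) set set" where
  "star F v = {f\<in>F. v \<in> f}"

text \<open>A list \<open>ps\<close> of \<open>n\<close> points is always read cyclically: the \<open>i\<close>-th triangle of the cyclic star
  \<open>(v, ps)\<close> is spanned by \<open>v\<close>, \<open>ps ! i\<close> and the cyclic successor of \<open>ps ! i\<close>.\<close>

definition cyc_next :: "'a list \<Rightarrow> nat \<Rightarrow> 'a" where
  "cyc_next xs i = xs ! (Suc i mod length xs)"

definition star_face :: "real^3 \<Rightarrow> (real^3) list \<Rightarrow> nat \<Rightarrow> (real^3) set" where
  "star_face v ps i = {v, ps ! i, cyc_next ps i}"

definition star_faces :: "real^3 \<Rightarrow> (real^3) list \<Rightarrow> (real^3) set set" where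
  "star_faces v ps = star_face v ps ` {..<length ps}"

text \<open>In the following definition the third condition says that the surface is a 2-manifold
  without boundary: the faces around each vertex form a single cycle.\<close>

definition closed_polyhedral_surface :: "(real^3) set set \<Rightarrow> bool" where
  "closed_polyhedral_surface F \<longleftrightarrow>
     F \<noteq> {} \<and>
     embedded_triangles F \<and>
     (\<forall>v\<in>surface_vertices F. \<exists>ps. 3 \<le> length ps \<and> distinct ps \<and> star F v = star_faces v ps) \<and>
     connected (surface_points F)"

definition no_coplanar_neighbours :: "(real^3) set set \<Rightarrow> bool" where
  "no_coplanar_neighbours F \<longleftrightarrow>
     (\<forall>f\<in>F. \<forall>g\<in>F. f \<noteq> g \<and> f \<inter> g \<in> surface_edges F \<longrightarrow> \<not> coplanar (f \<union> g))"

text \<open>The outer side is the unbounded component of the complement of the surface; the surface is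
  oriented so that faces are positively oriented when seen from there.\<close>

definition outer_unit_normal :: "(real^3) set set \<Rightarrow> (real^3) set \<Rightarrow> real^3 \<Rightarrow> bool" where
  "outer_unit_normal F f u \<longleftrightarrow>
     norm u = 1 \<and>
     (\<forall>x\<in>f. \<forall>y\<in>f. u \<bullet> (x - y) = 0) \<and>
     (\<forall>x\<in>rel_interior (convex hull f).
        \<forall>\<^sub>F t in at_right (0::real). x + t *\<^sub>R u \<in> outside (surface_points F))"


section \<open>General directions and the critical point index\<close>

definition general_for :: "(real^3) set set \<Rightarrow> real^3 \<Rightarrow> real^3 \<Rightarrow> bool" where
  "general_for F v \<xi> \<longleftrightarrow>
     \<xi> \<in> sphere 0 1 \<and> (\<forall>v'. {v, v'} \<in> surface_edges F \<longrightarrow> \<xi> \<bullet> v \<noteq> \<xi> \<bullet> v')"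

definition top_indicator :: "(real^3) set \<Rightarrow> real^3 \<Rightarrow> real^3 \<Rightarrow> int" where
  "top_indicator s v \<xi> = (if v \<in> s \<and> (\<forall>v'\<in>s. \<xi> \<bullet> v \<ge> \<xi> \<bullet> v') then 1 else 0)"

definition critical_index :: "(real^3) set set \<Rightarrow> real^3 \<Rightarrow> real^3 \<Rightarrow> int" where
  "critical_index F v \<xi> =
     1 - (\<Sum>e\<in>surface_edges F. top_indicator e v \<xi>) + (\<Sum>f\<in>F. top_indicator f v \<xi>)"


section \<open>Vertex stars and their Gauss images\<close>

text \<open>An embedded vertex star is oriented by the cyclic order of its list. Adjacent coplanar faces
  are allowed here, because deformations have to pass through such stars.\<close>

definition embedded_star :: "real^3 \<Rightarrow> (real^3) list \<Rightarrow> bool" where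
  "embedded_star v ps \<longleftrightarrow>
     3 \<le> length ps \<and> distinct ps \<and> embedded_triangles (star_faces v ps)"

text \<open>The unit normal of the \<open>i\<close>-th face on the side from which the list runs counterclockwise.\<close>

definition star_normal :: "real^3 \<Rightarrow> (real^3) list \<Rightarrow> nat \<Rightarrow> real^3" where
  "star_normal v ps i = sgn (cross3 (ps ! i - v) (cyc_next ps i - v))"

definition ccw_star :: "(real^3) set set \<Rightarrow> real^3 \<Rightarrow> (real^3) list \<Rightarrow> bool" where
  "ccw_star F v ps \<longleftrightarrow>
     3 \<le> length ps \<and> distinct ps \<and> star F v = star_faces v ps \<and>
     (\<forall>i<length ps. outer_unit_normal F (star_face v ps i) (star_normal v ps i))"

text \<open>For unit vectors \<open>a \<noteq> - b\<close> this is the shorter great circle arc, with and without its end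
  points; it is a single point if \<open>a = b\<close>.\<close>

definition great_arc :: "real^3 \<Rightarrow> real^3 \<Rightarrow> (real^3) set" where
  "great_arc a b = {x \<in> sphere 0 1. \<exists>s\<ge>0. \<exists>t\<ge>0. x = s *\<^sub>R a + t *\<^sub>R b}"

definition open_great_arc :: "real^3 \<Rightarrow> real^3 \<Rightarrow> (real^3) set" where
  "open_great_arc a b = {x \<in> sphere 0 1. \<exists>s>0. \<exists>t>0. x = s *\<^sub>R a + t *\<^sub>R b}"

definition gauss_arc :: "real^3 \<Rightarrow> (real^3) list \<Rightarrow> nat \<Rightarrow> (real^3) set" where
  "gauss_arc v ps i = great_arc (star_normal v ps i) (star_normal v ps (Suc i mod length ps))"

definition gauss_image :: "real^3 \<Rightarrow> (real^3) list \<Rightarrow> (real^3) set" where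
  "gauss_image v ps = (\<Union>i<length ps. gauss_arc v ps i)"


section \<open>The spherical winding number\<close>

text \<open>The point \<open>x\<close> is passed exactly once by the Gauss image, namely in the interior of the arc with
  pole \<open>cross3 a b\<close>. Seen from outside the sphere, the pole lies to the left of the oriented arc.\<close>

definition simple_gauss_point :: "real^3 \<Rightarrow> (real^3) list \<Rightarrow> nat \<Rightarrow> real^3 \<Rightarrow> bool" where
  "simple_gauss_point v ps i x \<longleftrightarrow>
     i < length ps \<and>
     star_normal v ps i \<noteq> star_normal v ps (Suc i mod length ps) \<and>
     x \<in> open_great_arc (star_normal v ps i) (star_normal v ps (Suc i mod length ps)) \<and>
     (\<forall>j<length ps. j \<noteq> i \<longrightarrow> x \<notin> gauss_arc v ps j)"

definition gauss_pole :: "real^3 \<Rightarrow> (real^3) list \<Rightarrow> nat \<Rightarrow> real^3" where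
  "gauss_pole v ps i = cross3 (star_normal v ps i) (star_normal v ps (Suc i mod length ps))"

text \<open>The area of a subset of the unit sphere is three times the volume of the cone over it with
  apex in the centre.\<close>

definition spherical_area :: "(real^3) set \<Rightarrow> real" where
  "spherical_area A = 3 * measure lebesgue {r *\<^sub>R x | r x. 0 \<le> r \<and> r \<le> 1 \<and> x \<in> A}"

definition convex_corner :: "real^3 \<Rightarrow> (real^3) list \<Rightarrow> bool" where
  "convex_corner v ps \<longleftrightarrow>
     embedded_star v ps \<and>
     (\<exists>C. convex_cone C \<and> polyhedron C \<and>
          frontier C = conic hull ((\<lambda>x. x - v) ` surface_points (star_faces v ps)))"

text \<open>A deformation keeps the combinatorial type fixed and moves the vertices continuously.\<close>

definition star_deformation :: "(real \<Rightarrow> real^3) \<Rightarrow> (real \<Rightarrow> (real^3) list) \<Rightarrow> bool" where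
  "star_deformation V Q \<longleftrightarrow>
     continuous_on {0..1} V \<and>
     (\<forall>t\<in>{0..1}. length (Q t) = length (Q 0)) \<and>
     (\<forall>i<length (Q 0). continuous_on {0..1} (\<lambda>t. Q t ! i)) \<and>
     (\<forall>t\<in>{0..1}. embedded_star (V t) (Q t))"

type_synonym star_function = "real^3 \<Rightarrow> (real^3) list \<Rightarrow> real^3 \<Rightarrow> int"

definition constant_on_components :: "star_function \<Rightarrow> bool" where
  "constant_on_components w \<longleftrightarrow>
     (\<forall>v ps \<xi> \<eta>. embedded_star v ps \<and>
        connected_component (sphere 0 1 - gauss_image v ps) \<xi> \<eta> \<longrightarrow> w v ps \<xi> = w v ps \<eta>)"

definition decreases_left_to_right :: "star_function \<Rightarrow> bool" where
  "decreases_left_to_right w \<longleftrightarrow>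
     (\<forall>v ps i x. embedded_star v ps \<and> simple_gauss_point v ps i x \<longrightarrow>
        (\<exists>\<epsilon>>0. \<forall>\<xi>\<in>sphere 0 1 \<inter> ball x \<epsilon>. \<forall>\<eta>\<in>sphere 0 1 \<inter> ball x \<epsilon>.
           gauss_pole v ps i \<bullet> \<xi> > 0 \<and> gauss_pole v ps i \<bullet> \<eta> < 0 \<longrightarrow>
           w v ps \<eta> = w v ps \<xi> - 1))"

definition deformation_invariant :: "star_function \<Rightarrow> bool" where
  "deformation_invariant w \<longleftrightarrow>
     (\<forall>V Q \<xi>. star_deformation V Q \<and> \<xi> \<in> sphere 0 1 \<and>
        (\<forall>t\<in>{0..1}. \<xi> \<notin> gauss_image (V t) (Q t)) \<longrightarrow>
        w (V 0) (Q 0) \<xi> = w (V 1) (Q 1) \<xi>)"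

definition normalized_at_convex_corners :: "star_function \<Rightarrow> bool" where
  "normalized_at_convex_corners w \<longleftrightarrow>
     (\<forall>v ps. convex_corner v ps \<longrightarrow>
        (\<forall>\<xi>\<in>sphere 0 1 - gauss_image v ps.
           let A = spherical_area (connected_component_set (sphere 0 1 - gauss_image v ps) \<xi>)
           in (A < 2 * pi \<longrightarrow> w v ps \<xi> = 1) \<and> (A > 2 * pi \<longrightarrow> w v ps \<xi> = 0)))"

text \<open>The winding number of Gauss images is characterised by these four properties. They only
  constrain \<open>w v ps \<xi>\<close> for embedded stars \<open>(v, ps)\<close> and for \<open>\<xi>\<close> on the sphere off the Gauss image;
  there, they determine it.\<close>

definition gauss_winding_number :: "star_function \<Rightarrow> bool" where
  "gauss_winding_number w \<longleftrightarrow>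
     constant_on_components w \<and> decreases_left_to_right w \<and>
     deformation_invariant w \<and> normalized_at_convex_corners w"

end

theory Submission
  imports Defs
begin

text \<open>Translating \<open>v\<close> to the origin, a vertex star is the cone over a simple spherical polygon. For such
  a star and a direction \<open>\<xi>\<close> orthogonal to no edge, the index at \<open>v\<close> is \<open>1\<close> minus the number of edges
  of the spherical polygon that cross \<open>\<xi>\<^sup>\<bottom>\<close> upwards. Let the excess be the index minus
  \<open>w(\<xi>) + w(-\<xi>)\<close>. When \<open>\<xi>\<close> crosses the plane orthogonal to an edge, the index jumps exactly if the two
  neighbouring edges lie on the same side of \<open>\<xi>\<^sup>\<bottom>\<close>, and this is also the condition under which \<open>\<xi>\<close>
  or \<open>-\<xi>\<close> crosses the corresponding arc of the Gauss image; so the excess does not depend on \<open>\<xi>\<close>, and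
  then it is invariant under deformations of the star. It remains to deform every star, with a fixed
  number of edges, into a flat one; there the Gauss image is a point, both winding numbers vanish by the
  normalization at convex corners, and the index is \<open>0\<close>. The deformation exists because a simple
  spherical polygon with at least four vertices in general position has an ear: an ear can be
  flattened, its vertex deleted, and the deformation of the smaller polygon lifted back by keeping the
  deleted vertex on the edge that replaced the ear.\<close>

section \<open>Triple products and points in general position\<close>

text \<open>The hypotheses on \<open>w\<close> only compare stars with the same number of vertices,
  so the deformation must keep this number; hence deleted vertices are reinserted on edges. The
  obstacle is the ear: a simple spherical polygon need not lie in a hemisphere, and a maximal set of
  noncrossing arcs shorter than a half circle need not cut the whole sphere into triangles, so the
  planar argument of triangulating one side of the polygon does not carry over directly. Both sides
  are treated at once, and counting germs takes the place of Euler's formula. The duality behind the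
  wall crossing is that the normals of two consecutive faces are both orthogonal to their common
  edge: the arc joining them lies in the plane orthogonal to this edge and has a multiple of the
  edge vector as its pole. Points of the sphere are handled as nonzero vectors up to positive
  scaling, so that incidences become signs of coefficients, and segments and convex cones replace
  arcs and regions.\<close>

definition det3 :: "real^3 \<Rightarrow> real^3 \<Rightarrow> real^3 \<Rightarrow> real" where
  "det3 u v w = u \<bullet> cross3 v w"

lemma det3_lin [simp]:
  "det3 (a + b) v w = det3 a v w + det3 b v w"
  "det3 u (a + b) w = det3 u a w + det3 u b w"
  "det3 u v (a + b) = det3 u v a + det3 u v b"
  "det3 (r *\<^sub>R a) v w = r * det3 a v w"
  "det3 u (r *\<^sub>R a) w = r * det3 u a w"
  "det3 u v (r *\<^sub>R a) = r * det3 u v a"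
  "det3 (- a) v w = - det3 a v w"
  "det3 u (- a) w = - det3 u a w"
  "det3 u v (- a) = - det3 u v a"
  "det3 0 v w = 0" "det3 u 0 w = 0" "det3 u v 0 = 0"
  "det3 u u w = 0" "det3 u v u = 0" "det3 u w w = 0"
  by (simp_all add: det3_def cross3_simps inner_add_left inner_add_right)

lemma det3_swap: "det3 v u w = - det3 u v w" "det3 w v u = - det3 u v w" "det3 u w v = - det3 u v w"
  by (simp_all add: det3_def cross3_simps)

text \<open>Four vectors in three dimensions are dependent; this is Cramer's rule cleared of its
  denominator.\<close>

lemma det3_expand:
  "det3 x y r *\<^sub>R k = det3 k y r *\<^sub>R x + det3 x k r *\<^sub>R y + det3 x y k *\<^sub>R r"
  by (simp add: det3_def cross3_simps vec_eq_iff forall_3)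

lemma det3_basis:
  assumes "det3 x y r \<noteq> 0"
  obtains a b c where "k = a *\<^sub>R x + b *\<^sub>R y + c *\<^sub>R r"
proof
  have "k = inverse (det3 x y r) *\<^sub>R (det3 x y r *\<^sub>R k)" using assms by simp
  also have "\<dots> = (inverse (det3 x y r) * det3 k y r) *\<^sub>R x + (inverse (det3 x y r) * det3 x k r) *\<^sub>R y
     + (inverse (det3 x y r) * det3 x y k) *\<^sub>R r"
    by (subst det3_expand) (simp add: scaleR_right_distrib)
  finally show "k = \<dots>" .
qed

lemma det3_unique:
  assumes "det3 x y r \<noteq> 0" "a *\<^sub>R x + b *\<^sub>R y + c *\<^sub>R r = a' *\<^sub>R x + b' *\<^sub>R y + c' *\<^sub>R r"
  shows "a = a'" "b = b'" "c = c'"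
proof -
  from arg_cong[OF assms(2), of "\<lambda>u. det3 u y r"] assms(1) show "a = a'" by simp
  from arg_cong[OF assms(2), of "\<lambda>u. det3 x u r"] assms(1) show "b = b'" by simp
  from arg_cong[OF assms(2), of "\<lambda>u. det3 x y u"] assms(1) show "c = c'" by simp
qed

definition in_cone :: "real^3 \<Rightarrow> real^3 \<Rightarrow> real^3 \<Rightarrow> real^3 \<Rightarrow> bool" where
  "in_cone k x y r \<longleftrightarrow> (\<exists>a\<ge>0. \<exists>b\<ge>0. \<exists>c\<ge>0. k = a *\<^sub>R x + b *\<^sub>R y + c *\<^sub>R r)"

text \<open>The coefficient of \<open>v\<close> is unrestricted, so \<open>k\<close> is seen only
  through its direction at \<open>v\<close>: on the sphere, the way from \<open>v\<close> to
  \<open>k\<close> starts strictly between those to \<open>x\<close> and \<open>y\<close>, whatever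
  the distance.\<close>

definition in_sector :: "real^3 \<Rightarrow> real^3 \<Rightarrow> real^3 \<Rightarrow> real^3 \<Rightarrow> bool" where
  "in_sector v x y k \<longleftrightarrow> (\<exists>a. \<exists>b>0. \<exists>c>0. k = a *\<^sub>R v + b *\<^sub>R x + c *\<^sub>R y)"

lemma in_sectorI: "0 < b \<Longrightarrow> 0 < c \<Longrightarrow> in_sector v x y (a *\<^sub>R v + b *\<^sub>R x + c *\<^sub>R y)"
  unfolding in_sector_def by blast

lemma in_coneI: "0 \<le> a \<Longrightarrow> 0 \<le> b \<Longrightarrow> 0 \<le> c \<Longrightarrow> in_cone (a *\<^sub>R x + b *\<^sub>R y + c *\<^sub>R r) x y r"
  unfolding in_cone_def by blast

lemma in_sector_trans:
  assumes "in_sector v x t u" "in_sector v x y t"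
  shows "in_sector v x y u"
proof -
  from assms obtain a b c a' b' c' where
    h: "0 < b" "0 < c" "u = a *\<^sub>R v + b *\<^sub>R x + c *\<^sub>R t"
    "0 < b'" "0 < c'" "t = a' *\<^sub>R v + b' *\<^sub>R x + c' *\<^sub>R y"
    unfolding in_sector_def by blast
  have "u = (a + c * a') *\<^sub>R v + (b + c * b') *\<^sub>R x + (c * c') *\<^sub>R y"
    unfolding h(3) h(6) by (simp add: algebra_simps)
  moreover have "0 < b + c * b'" "0 < c * c'" using h by (simp_all add: add_pos_pos)
  ultimately show ?thesis using in_sectorI by metis
qed

text \<open>Lying inside the sector from \<open>x\<close> to another vector is transitive, and the
  nonzero triple products make it irreflexive on \<open>N\<close>. A minimal element is the first
  vector met when turning from \<open>x\<close>.\<close>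

lemma ex_first_in_sector:
  assumes fin: "finite N" "N \<noteq> {}" and det: "\<And>u. u \<in> N \<Longrightarrow> det3 v x (p u) \<noteq> 0"
  obtains u where "u \<in> N" "\<And>t. t \<in> N \<Longrightarrow> \<not> in_sector v x (p u) (p t)"
proof -
  let ?R = "\<lambda>t u. in_sector v x (p u) (p t)"
  have irr: "\<not> ?R u u" if "u \<in> N" for u
  proof
    assume "?R u u"
    then obtain a b c where bc: "0 < b" "p u = a *\<^sub>R v + b *\<^sub>R x + c *\<^sub>R p u"
      unfolding in_sector_def by blast
    have "det3 v (p u) (p u) = b * det3 v x (p u)" by (subst bc(2)) simp
    with det[OF that] bc show False by simp
  qed
  have "asymp_on N ?R" by (intro asymp_onI) (use irr in_sector_trans in blast)
  moreover have "transp_on N ?R" by (intro transp_onI) (use in_sector_trans in blast)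
  ultimately show thesis using Finite_Set.bex_min_element[OF fin(1) _ _ fin(2)] irr that by metis
qed

text \<open>A point of the octant whose second coordinate does not decrease can leave only through
  the first or the third wall. The witness is the earliest time at which a decreasing coordinate
  reaches zero.\<close>

lemma cone_exit:
  fixes z1 z2 z3 k1 k2 k3 :: real
  assumes "0 \<le> z1" "0 \<le> z2" "0 \<le> z3" "0 \<le> k2" "k1 < 0 \<or> k3 < 0"
  obtains s where "0 \<le> s" "0 \<le> z1 + s * k1" "0 \<le> z2 + s * k2" "0 \<le> z3 + s * k3"
    "z1 + s * k1 = 0 \<or> z3 + s * k3 = 0"
proof (cases "k1 < 0 \<and> (k3 < 0 \<longrightarrow> z1 * (- k3) \<le> z3 * (- k1))")
  case True
  show thesis
  proof (rule that[of "z1 / (- k1)"])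
    show "0 \<le> z1 / (- k1)" using True assms by (auto intro: divide_nonneg_pos simp del: divide_minus_right)
    then show "0 \<le> z2 + z1 / (- k1) * k2" using assms by (intro add_nonneg_nonneg mult_nonneg_nonneg)
    show "0 \<le> z1 + z1 / (- k1) * k1" "z1 + z1 / (- k1) * k1 = 0 \<or> z3 + z1 / (- k1) * k3 = 0"
      using True by auto
    show "0 \<le> z3 + z1 / (- k1) * k3"
    proof (cases "k3 < 0")
      case True2: True
      then show ?thesis using True by (simp add: field_simps)
    next
      case False
      then show ?thesis using \<open>0 \<le> z1 / (- k1)\<close> assms by (intro add_nonneg_nonneg mult_nonneg_nonneg) auto
    qed
  qed
next
  case False
  then have k3: "k3 < 0" using assms(5) by blast
  show thesis
  proof (rule that[of "z3 / (- k3)"])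
    show s: "0 \<le> z3 / (- k3)" using k3 assms by (auto intro: divide_nonneg_pos simp del: divide_minus_right)
    then show "0 \<le> z2 + z3 / (- k3) * k2" using assms by (intro add_nonneg_nonneg mult_nonneg_nonneg)
    show "0 \<le> z3 + z3 / (- k3) * k3" "z1 + z3 / (- k3) * k1 = 0 \<or> z3 + z3 / (- k3) * k3 = 0"
      using k3 by auto
    show "0 \<le> z1 + z3 / (- k3) * k1"
    proof (cases "k1 < 0")
      case True
      then have "z3 * (- k1) < z1 * (- k3)" using False k3 by auto
      then show ?thesis using k3 by (simp add: field_simps)
    next
      case False
      then show ?thesis using s assms by (intro add_nonneg_nonneg mult_nonneg_nonneg) auto
    qed
  qed
qed

section \<open>Noncrossing arcs between points in general position\<close>

locale generic_points =
  fixes n :: nat and p :: "nat \<Rightarrow> real^3"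
  assumes three: "3 \<le> n"
    and gen: "\<And>i j k. \<lbrakk>i < n; j < n; k < n; i \<noteq> j; i \<noteq> k; j \<noteq> k\<rbrakk> \<Longrightarrow> det3 (p i) (p j) (p k) \<noteq> 0"
begin

definition crossing :: "nat \<Rightarrow> nat \<Rightarrow> nat \<Rightarrow> nat \<Rightarrow> bool" where
  "crossing i j k l \<longleftrightarrow> {i, j} \<inter> {k, l} = {} \<and>
     (\<exists>a>0. \<exists>b>0. \<exists>c>0. \<exists>d>0. a *\<^sub>R p i + b *\<^sub>R p j = c *\<^sub>R p k + d *\<^sub>R p l)"

lemma crossing_sym: "crossing i j k l \<Longrightarrow> crossing k l i j"
  unfolding crossing_def
  apply (elim conjE exE)
  subgoal for a b c d
    by (intro conjI exI[of _ c] exI[of _ d] exI[of _ a] exI[of _ b]) auto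
  done

lemma crossing_commute: "crossing i j k l \<Longrightarrow> crossing j i k l"
  unfolding crossing_def
  apply (elim conjE exE)
  subgoal for a b c d
    by (intro conjI exI[of _ b] exI[of _ a] exI[of _ c] exI[of _ d]) (auto simp: add.commute)
  done

lemma not_dependent:
  assumes "i < n" "j < n" "k < n" "i \<noteq> j" "i \<noteq> k" "j \<noteq> k"
    and "a *\<^sub>R p i + b *\<^sub>R p j + c *\<^sub>R p k = 0"
  shows "a = 0" "b = 0" "c = 0"
  using det3_unique[OF gen[OF assms(1-6)], of a b c 0 0 0] assms(7) by auto

lemma pair_not_dependent:
  assumes "i < n" "j < n" "i \<noteq> j" "a *\<^sub>R p i + b *\<^sub>R p j = 0"
  shows "a = 0" "b = 0"
proof -
  have "\<exists>k<n. k \<noteq> i \<and> k \<noteq> j"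
  proof (rule ccontr)
    assume "\<not> ?thesis"
    then have "{..<n} \<subseteq> {i, j}" by auto
    from card_mono[OF _ this] have "n \<le> card {i, j}" by simp
    also have "\<dots> \<le> 2" by (simp add: card_insert_if)
    finally show False using three by simp
  qed
  then obtain k where k: "k < n" "k \<noteq> i" "k \<noteq> j" by blast
  show "a = 0" "b = 0"
    using not_dependent[OF assms(1,2) k(1) assms(3), of a b 0] k assms(4) by auto
qed

end

text \<open>Maximality is the means of producing arcs: an arc is shown to belong to \<open>G\<close>
  by refuting every crossing with an arc of \<open>G\<close>.\<close>

locale arc_triangulation = generic_points +
  fixes G :: "(nat \<times> nat) set"
  assumes G_bound: "(i, j) \<in> G \<Longrightarrow> i < n \<and> j < n \<and> i \<noteq> j"
    and G_noncrossing: "\<lbrakk>(i, j) \<in> G; (k, l) \<in> G\<rbrakk> \<Longrightarrow> \<not> crossing i j k l"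
    and G_maximal: "\<lbrakk>i < n; j < n; i \<noteq> j; \<And>k l. (k, l) \<in> G \<Longrightarrow> \<not> crossing i j k l\<rbrakk> \<Longrightarrow> (i, j) \<in> G"
begin

lemma G_sym: "(i, j) \<in> G \<Longrightarrow> (j, i) \<in> G"
  by (rule G_maximal) (use G_bound G_noncrossing crossing_commute in blast)+

text \<open>General position turns contact into crossing: a shared end, or contact at an end of the
  arc \<open>x y\<close>, would make three of the points dependent. So it suffices below to exhibit
  a common point with nonnegative coefficients.\<close>

lemma G_not_meeting:
  assumes "(k, l) \<in> G" "(x, y) \<in> G" "0 < c" "0 < d" "0 \<le> a" "0 \<le> b"
    and eq: "c *\<^sub>R p k + d *\<^sub>R p l = a *\<^sub>R p x + b *\<^sub>R p y"
    and k: "k \<noteq> x" "k \<noteq> y"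
  shows False
proof -
  note bd = G_bound[OF assms(1)] G_bound[OF assms(2)]
  have l: "l \<noteq> x"
  proof
    assume "l = x"
    then have "c *\<^sub>R p k + (d - a) *\<^sub>R p x + (- b) *\<^sub>R p y = 0"
      using eq by (simp add: algebra_simps)
    from not_dependent(1)[OF _ _ _ _ _ _ this] bd k \<open>0 < c\<close> show False by auto
  qed
  have l': "l \<noteq> y"
  proof
    assume "l = y"
    then have "c *\<^sub>R p k + (- a) *\<^sub>R p x + (d - b) *\<^sub>R p y = 0"
      using eq by (simp add: algebra_simps)
    from not_dependent(1)[OF _ _ _ _ _ _ this] bd k \<open>0 < c\<close> show False by auto
  qed
  have "a \<noteq> 0"
  proof
    assume "a = 0"
    then have "c *\<^sub>R p k + d *\<^sub>R p l + (- b) *\<^sub>R p y = 0"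
      using eq by (simp add: algebra_simps)
    from not_dependent(1)[OF _ _ _ _ _ _ this] bd k l' \<open>0 < c\<close> show False by auto
  qed
  have "b \<noteq> 0"
  proof
    assume "b = 0"
    then have "c *\<^sub>R p k + d *\<^sub>R p l + (- a) *\<^sub>R p x = 0"
      using eq by (simp add: algebra_simps)
    from not_dependent(1)[OF _ _ _ _ _ _ this] bd k l \<open>0 < c\<close> show False by auto
  qed
  have "crossing k l x y"
    unfolding crossing_def using k l l' assms(3-6) \<open>a \<noteq> 0\<close> \<open>b \<noteq> 0\<close> eq
    by (intro conjI exI[of _ c] exI[of _ d] exI[of _ a] exI[of _ b]) simp_all
  then show False using G_noncrossing assms(1,2) by blast
qed

end

context arc_triangulation
begin

text \<open>In the two lemmas below, \<open>u\<close> is the first arc met when turning around \<open>y\<close> from \<open>x\<close>, and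
  \<open>m\<close> is the first vertex in the triangle \<open>x y u\<close> met when turning around \<open>x\<close> from \<open>y\<close>.\<close>

lemma first_arc:
  assumes "(x, y) \<in> G" "(y, u0) \<in> G" "0 < \<sigma> * det3 (p x) (p y) (p u0)"
  obtains u where "(y, u) \<in> G" "0 < \<sigma> * det3 (p x) (p y) (p u)"
    "\<And>t. (y, t) \<in> G \<Longrightarrow> \<not> in_sector (p y) (p x) (p u) (p t)"
proof -
  define N where "N = {u. (y, u) \<in> G \<and> 0 < \<sigma> * det3 (p x) (p y) (p u)}"
  have "N \<subseteq> {..<n}" using G_bound by (auto simp: N_def)
  then have fin: "finite N" by (rule finite_subset) simp
  have "N \<noteq> {}" using assms by (auto simp: N_def)
  moreover have "det3 (p y) (p x) (p u) \<noteq> 0" if "u \<in> N" for u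
    using that det3_swap(1)[of "p y" "p x" "p u"] by (auto simp: N_def)
  ultimately obtain u where u: "u \<in> N" and min: "\<And>t. t \<in> N \<Longrightarrow> \<not> in_sector (p y) (p x) (p u) (p t)"
    using ex_first_in_sector[OF fin] by metis
  show thesis
  proof
    show "(y, u) \<in> G" "0 < \<sigma> * det3 (p x) (p y) (p u)" using u by (auto simp: N_def)
    show "\<not> in_sector (p y) (p x) (p u) (p t)" if "(y, t) \<in> G" for t
    proof
      assume R: "in_sector (p y) (p x) (p u) (p t)"
      then obtain a b c where bc: "0 < c" "p t = a *\<^sub>R p y + b *\<^sub>R p x + c *\<^sub>R p u"
        unfolding in_sector_def by blast
      have "det3 (p x) (p y) (p t) = c * det3 (p x) (p y) (p u)"
        by (subst bc(2)) simp
      then have "\<sigma> * det3 (p x) (p y) (p t) = c * (\<sigma> * det3 (p x) (p y) (p u))" by simp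
      also have "0 < \<dots>" using bc(1) u by (simp add: N_def)
      finally have "t \<in> N" using that by (simp add: N_def)
      with R min show False by blast
    qed
  qed
qed

lemma first_vertex:
  assumes "x < n" "y < n" "u < n" "x \<noteq> y" "x \<noteq> u" "y \<noteq> u"
  obtains m where "m < n" "m \<noteq> x" "m \<noteq> y" "in_cone (p m) (p x) (p y) (p u)"
    "\<And>k. \<lbrakk>k < n; k \<noteq> x; k \<noteq> y; in_cone (p k) (p x) (p y) (p u)\<rbrakk> \<Longrightarrow> \<not> in_sector (p x) (p y) (p m) (p k)"
proof -
  define N where "N = {k. k < n \<and> k \<noteq> x \<and> k \<noteq> y \<and> in_cone (p k) (p x) (p y) (p u)}"
  have "in_cone (0 *\<^sub>R p x + 0 *\<^sub>R p y + 1 *\<^sub>R p u) (p x) (p y) (p u)" by (rule in_coneI) simp_all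
  then have "u \<in> N" using assms by (simp add: N_def)
  moreover have "det3 (p x) (p y) (p m) \<noteq> 0" if "m \<in> N" for m
    using that gen[of x y m] assms by (auto simp: N_def)
  moreover have "finite N" by (simp add: N_def)
  ultimately obtain m where "m \<in> N" "\<And>k. k \<in> N \<Longrightarrow> \<not> in_sector (p x) (p y) (p m) (p k)"
    using ex_first_in_sector[of N "p x" "p y" p] by blast
  then show thesis using that[of m] unfolding N_def by blast
qed

definition empty_triangle :: "nat \<Rightarrow> nat \<Rightarrow> nat \<Rightarrow> bool" where
  "empty_triangle x y m \<longleftrightarrow> (\<forall>k<n. k \<notin> {x, y, m} \<longrightarrow> \<not> in_cone (p k) (p x) (p y) (p m))"

text \<open>Take the triangle cut off by \<open>x y\<close> and the first arc \<open>y u\<close>,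
  and let \<open>m\<close> be the first vertex in it when turning around \<open>x\<close> from
  \<open>y\<close>. An arc obstructing \<open>x m\<close> or \<open>y m\<close> would have to end
  where the choice of \<open>m\<close> or \<open>u\<close> forbids it, or leave through an arc of
  \<open>G\<close>. The factor \<open>\<sigma>\<close> selects the side of
  \<open>x y\<close>.\<close>

lemma next_triangle:
  assumes xy: "(x, y) \<in> G" and "(y, u0) \<in> G" "0 < \<sigma> * det3 (p x) (p y) (p u0)"
  obtains m where "m < n" "m \<noteq> x" "m \<noteq> y" "0 < \<sigma> * det3 (p x) (p y) (p m)"
    "(x, m) \<in> G" "(y, m) \<in> G" "empty_triangle x y m"
proof -
  from first_arc[OF assms] obtain u where yu: "(y, u) \<in> G"
    and su: "0 < \<sigma> * det3 (p x) (p y) (p u)"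
    and minu: "\<And>u'. (y, u') \<in> G \<Longrightarrow> \<not> in_sector (p y) (p x) (p u) (p u')" by blast
  define X Y U where "X = p x" and "Y = p y" and "U = p u"
  note XYU = X_def Y_def U_def
  have bx: "x < n" "y < n" "u < n" "x \<noteq> y" "y \<noteq> u" using G_bound xy yu by blast+
  have xu: "x \<noteq> u" using su by auto
  from first_vertex[OF bx(1-4) xu bx(5)] obtain m where m: "m < n" "m \<noteq> x" "m \<noteq> y"
    and conem: "in_cone (p m) X Y U"
    and minm: "\<And>k. \<lbrakk>k < n; k \<noteq> x; k \<noteq> y; in_cone (p k) X Y U\<rbrakk> \<Longrightarrow> \<not> in_sector X Y (p m) (p k)"
    unfolding XYU by blast
  define P where "P = p m"
  from conem obtain a0 b0 c0 where nn: "0 \<le> a0" "0 \<le> b0" "0 \<le> c0"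
    and P: "P = a0 *\<^sub>R X + b0 *\<^sub>R Y + c0 *\<^sub>R U"
    unfolding in_cone_def P_def by blast
  have dXYU: "det3 X Y U \<noteq> 0" using su by (auto simp: XYU)
  have dXYP: "det3 X Y P \<noteq> 0" unfolding XYU P_def using gen[of x y m] bx m by auto
  have c0: "0 < c0"
  proof (rule ccontr)
    assume "\<not> 0 < c0"
    then have "c0 = 0" using nn by simp
    then have "det3 X Y P = 0" by (simp add: P)
    then show False using dXYP by blast
  qed
  have sm: "0 < \<sigma> * det3 (p x) (p y) (p m)"
  proof -
    have "det3 X Y P = c0 * det3 X Y U" unfolding P by simp
    then have "\<sigma> * det3 X Y P = c0 * (\<sigma> * det3 X Y U)" by simp
    also have "0 < \<dots>" using c0 su by (simp add: XYU)
    finally show ?thesis by (simp add: XYU P_def)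
  qed
  \<comment> \<open>A vertex of the big triangle in the angle at \<open>x\<close> between
    \<open>y\<close> and \<open>m\<close> would come before \<open>m\<close>. General position
    excludes the boundary of this angle.\<close>
  have blocked: False
    if k: "k < n" "k \<noteq> x" "k \<noteq> y" "k \<noteq> m" and K: "p k = \<alpha> *\<^sub>R X + \<beta> *\<^sub>R Y + \<gamma> *\<^sub>R P"
      and coef: "0 \<le> \<beta>" "0 \<le> \<gamma>" and cone: "in_cone (p k) X Y U" for k \<alpha> \<beta> \<gamma>
  proof -
    have "\<beta> \<noteq> 0"
    proof
      assume "\<beta> = 0"
      then have "det3 (p x) (p m) (p k) = 0" unfolding K XYU P_def by simp
      then show False using gen[of x m k] k m bx by auto
    qed
    moreover have "\<gamma> \<noteq> 0"
    proof
      assume "\<gamma> = 0"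
      then have "det3 (p x) (p y) (p k) = 0" unfolding K XYU P_def by simp
      then show False using gen[of x y k] k m bx by auto
    qed
    ultimately have "in_sector X Y P (p k)"
      unfolding K using coef by (intro in_sectorI) auto
    then show False using minm[OF k(1-3) cone] by (simp add: P_def)
  qed
  have empty: "empty_triangle x y m"
    unfolding empty_triangle_def
  proof (intro allI impI notI)
    fix k assume k: "k < n" "k \<notin> {x, y, m}" and "in_cone (p k) (p x) (p y) (p m)"
    then obtain a b c where abc: "0 \<le> a" "0 \<le> b" "0 \<le> c" "p k = a *\<^sub>R X + b *\<^sub>R Y + c *\<^sub>R P"
      unfolding in_cone_def XYU P_def by blast
    have "p k = (a + c * a0) *\<^sub>R X + (b + c * b0) *\<^sub>R Y + (c * c0) *\<^sub>R U"
      unfolding abc(4) P by (simp add: algebra_simps)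
    moreover have "0 \<le> a + c * a0" "0 \<le> b + c * b0" "0 \<le> c * c0" using abc nn by simp_all
    ultimately have "in_cone (p k) X Y U" unfolding in_cone_def by blast
    with blocked[OF _ _ _ _ abc(4,2,3)] k show False by auto
  qed
  \<comment> \<open>Walk along the obstructing arc from its intersection with \<open>x m\<close> to
    the end \<open>k\<close> on the side of \<open>y\<close>. The vector \<open>R\<close> is the
    point where the ray from \<open>x\<close> through \<open>m\<close> reaches \<open>y u\<close>;
    inside the triangle \<open>x y R\<close> the walk either ends or leaves through
    \<open>x y\<close> or \<open>y u\<close>.\<close>
  have xm_half: False
    if kl: "(k, l) \<in> G" and disj: "k \<noteq> x" "k \<noteq> m" "l \<noteq> x"
      and pos: "0 < a" "0 < b" "0 < c" "0 < d" and eq: "a *\<^sub>R X + b *\<^sub>R P = c *\<^sub>R p k + d *\<^sub>R p l"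
      and side: "p k = \<alpha> *\<^sub>R X + \<beta> *\<^sub>R Y + \<gamma> *\<^sub>R (b0 *\<^sub>R Y + c0 *\<^sub>R U)" "0 < \<beta>"
    for k l a b c d \<alpha> \<beta> \<gamma>
  proof -
    define R where "R = b0 *\<^sub>R Y + c0 *\<^sub>R U"
    define A where "A = a + b * a0"
    have A: "0 < A" using pos nn by (simp add: A_def add_pos_nonneg)
    have z: "c *\<^sub>R p k + d *\<^sub>R p l = A *\<^sub>R X + b *\<^sub>R R"
      unfolding eq[symmetric] P A_def R_def by (simp add: algebra_simps)
    have move: "(c + s) *\<^sub>R p k + d *\<^sub>R p l
        = (A + s * \<alpha>) *\<^sub>R X + (s * \<beta>) *\<^sub>R Y + (b + s * \<gamma>) *\<^sub>R R" for s
    proof -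
      have "(c + s) *\<^sub>R p k + d *\<^sub>R p l = (c *\<^sub>R p k + d *\<^sub>R p l) + s *\<^sub>R p k"
        by (simp add: algebra_simps)
      also have "\<dots> = A *\<^sub>R X + b *\<^sub>R R + s *\<^sub>R (\<alpha> *\<^sub>R X + \<beta> *\<^sub>R Y + \<gamma> *\<^sub>R R)"
        by (simp only: z) (simp only: side(1) R_def)
      finally show ?thesis by (simp add: algebra_simps)
    qed
    show False
    proof (cases "k = y")
      \<comment> \<open>An obstructing arc that ends at \<open>y\<close> starts there into the angle
        between \<open>x\<close> and \<open>u\<close>, which by the choice of \<open>u\<close>
        contains no arc of \<open>G\<close>.\<close>
      case True
      have "d *\<^sub>R p l = A *\<^sub>R X + b *\<^sub>R R - c *\<^sub>R Y" using z True by (simp add: XYU algebra_simps)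
      then have "(1 / d) *\<^sub>R (d *\<^sub>R p l) = (1 / d) *\<^sub>R (A *\<^sub>R X + b *\<^sub>R R - c *\<^sub>R Y)" by simp
      then have "p l = ((b * b0 - c) / d) *\<^sub>R Y + (A / d) *\<^sub>R X + (b * c0 / d) *\<^sub>R U"
        using pos unfolding R_def by (simp add: algebra_simps diff_divide_distrib)
      moreover have "0 < A / d" "0 < b * c0 / d" using A c0 pos by simp_all
      ultimately have "in_sector Y X U (p l)" unfolding in_sector_def by blast
      then show False using minu[of l] kl True by (simp add: XYU)
    next
      case ky: False
      have kn: "k < n" using G_bound kl by blast
      have ku: "k \<noteq> u"
      proof
        assume "k = u"
        then have "0 *\<^sub>R X + 0 *\<^sub>R Y + 1 *\<^sub>R U = \<alpha> *\<^sub>R X + (\<beta> + \<gamma> * b0) *\<^sub>R Y + (\<gamma> * c0) *\<^sub>R U"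
          using side(1) by (simp add: XYU algebra_simps)
        from det3_unique[OF dXYU this] have e: "0 = \<beta> + \<gamma> * b0" "1 = \<gamma> * c0" by simp_all
        have "0 < \<gamma>" using e(2) c0 by (metis zero_less_mult_pos2 zero_less_one)
        then have "0 \<le> \<gamma> * b0" using nn by simp
        then show False using e(1) side(2) by simp
      qed
      show False
      proof (cases "0 \<le> \<alpha> \<and> 0 \<le> \<gamma>")
        case True
        have e1: "p k = (\<alpha> - \<gamma> * a0) *\<^sub>R X + \<beta> *\<^sub>R Y + \<gamma> *\<^sub>R P"
          unfolding side(1) P by (simp add: algebra_simps)
        have "p k = \<alpha> *\<^sub>R X + (\<beta> + \<gamma> * b0) *\<^sub>R Y + (\<gamma> * c0) *\<^sub>R U"
          unfolding side(1) by (simp add: algebra_simps)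
        then have e2: "in_cone (p k) X Y U"
          using True side(2) nn by (simp only:) (intro in_coneI, simp_all)
        show False
          by (rule blocked[OF kn disj(1) ky disj(2) e1 _ _ e2]) (use True side(2) in simp_all)
      next
        case False
        then have neg: "\<alpha> < 0 \<or> \<gamma> < 0" by auto
        have nn0: "0 \<le> A" "0 \<le> (0::real)" "0 \<le> b" "0 \<le> \<beta>" using A pos side(2) by simp_all
        obtain s where s: "0 \<le> s" "0 \<le> A + s * \<alpha>" "0 \<le> 0 + s * \<beta>" "0 \<le> b + s * \<gamma>"
          "A + s * \<alpha> = 0 \<or> b + s * \<gamma> = 0" by (rule cone_exit[OF nn0 neg])
        have cs: "0 < c + s" using pos s by simp
        from s(5) show False
        proof
          assume "b + s * \<gamma> = 0"
          then have e: "(c + s) *\<^sub>R p k + d *\<^sub>R p l = (A + s * \<alpha>) *\<^sub>R p x + (s * \<beta>) *\<^sub>R p y"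
            using move[of s] by (simp add: XYU)
          show False using G_not_meeting[OF kl xy cs pos(4) s(2) _ e disj(1) ky] s(3) by simp
        next
          assume "A + s * \<alpha> = 0"
          then have e: "(c + s) *\<^sub>R p k + d *\<^sub>R p l
             = (s * \<beta> + (b + s * \<gamma>) * b0) *\<^sub>R p y + ((b + s * \<gamma>) * c0) *\<^sub>R p u"
            using move[of s] by (simp add: XYU R_def algebra_simps)
          have "0 \<le> s * \<beta> + (b + s * \<gamma>) * b0" "0 \<le> (b + s * \<gamma>) * c0"
            using s nn by (simp_all add: add_nonneg_nonneg mult_nonneg_nonneg)
          from G_not_meeting[OF kl yu cs pos(4) this e ky ku] show False .
        qed
      qed
    qed
  qed
  have xm: "(x, m) \<in> G"
  proof (rule G_maximal)
    show "x < n" "m < n" "x \<noteq> m" using bx m by auto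
    fix k l assume kl: "(k, l) \<in> G"
    show "\<not> crossing x m k l"
    proof
      assume "crossing x m k l"
      then obtain a b c d where disj: "k \<noteq> x" "k \<noteq> m" "l \<noteq> x" "l \<noteq> m"
        and pos: "0 < a" "0 < b" "0 < c" "0 < d" and eq: "a *\<^sub>R X + b *\<^sub>R P = c *\<^sub>R p k + d *\<^sub>R p l"
        unfolding crossing_def XYU P_def by auto
      define R where "R = b0 *\<^sub>R Y + c0 *\<^sub>R U"
      have dXYR: "det3 X Y R \<noteq> 0" using dXYU c0 by (simp add: R_def)
      obtain \<alpha> \<beta> \<gamma> where K: "p k = \<alpha> *\<^sub>R X + \<beta> *\<^sub>R Y + \<gamma> *\<^sub>R R" using det3_basis[OF dXYR] by blast
      obtain \<alpha>' \<beta>' \<gamma>' where L: "p l = \<alpha>' *\<^sub>R X + \<beta>' *\<^sub>R Y + \<gamma>' *\<^sub>R R" using det3_basis[OF dXYR] by blast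
      have "(a + b * a0) *\<^sub>R X + 0 *\<^sub>R Y + b *\<^sub>R R
         = (c * \<alpha> + d * \<alpha>') *\<^sub>R X + (c * \<beta> + d * \<beta>') *\<^sub>R Y + (c * \<gamma> + d * \<gamma>') *\<^sub>R R"
        using eq unfolding K L P by (simp add: algebra_simps R_def)
      from det3_unique(2)[OF dXYR this] have sum: "c * \<beta> + d * \<beta>' = 0" by simp
      have "\<beta> \<noteq> 0"
      proof
        assume "\<beta> = 0"
        then have "p k = (\<alpha> - \<gamma> * a0) *\<^sub>R X + \<gamma> *\<^sub>R P"
          unfolding K R_def P by (simp add: algebra_simps)
        then have "p k = (\<alpha> - \<gamma> * a0) *\<^sub>R p x + \<gamma> *\<^sub>R p m"
          by (simp only: X_def P_def)
        then have "det3 (p x) (p m) (p k) = 0" by simp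
        then show False using gen[of x m k] bx m disj G_bound[OF kl] by auto
      qed
      then consider "0 < \<beta>" | "0 < \<beta>'" using sum pos
        by (metis add_neg_nonpos linorder_cases linorder_not_less mult_pos_neg mult_le_0_iff less_imp_le order_less_irrefl)
      then show False
      proof cases
        case 1
        from xm_half[OF kl disj(1,2,3) pos eq K[unfolded R_def] 1] show False .
      next
        case 2
        have "a *\<^sub>R X + b *\<^sub>R P = d *\<^sub>R p l + c *\<^sub>R p k" using eq by (simp add: add.commute)
        from xm_half[OF G_sym[OF kl] disj(3,4,1) pos(1,2,4,3) this L[unfolded R_def] 2] show False .
      qed
    qed
  qed
  \<comment> \<open>The same walk in the triangle \<open>x y m\<close>, whose side
    \<open>x m\<close> is now in \<open>G\<close> and which contains no further vertex. If the arc
    starts at \<open>x\<close>, its other end is beyond \<open>y m\<close>: inside the big triangle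
    this contradicts the choice of \<open>m\<close>, and outside it the arc meets
    \<open>y u\<close>.\<close>
  have ym_half: False
    if kl: "(k, l) \<in> G" and disj: "k \<noteq> y" "k \<noteq> m" "l \<noteq> y" "l \<noteq> m"
      and pos: "0 < a" "0 < b" "0 < c" "0 < d" and eq: "a *\<^sub>R Y + b *\<^sub>R P = c *\<^sub>R p k + d *\<^sub>R p l"
      and side: "p k = \<alpha> *\<^sub>R X + \<beta> *\<^sub>R Y + \<gamma> *\<^sub>R P" "0 < \<alpha>"
    for k l a b c d \<alpha> \<beta> \<gamma>
  proof -
    have move: "(c + s) *\<^sub>R p k + d *\<^sub>R p l
        = (s * \<alpha>) *\<^sub>R X + (a + s * \<beta>) *\<^sub>R Y + (b + s * \<gamma>) *\<^sub>R P" for s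
    proof -
      have "(c + s) *\<^sub>R p k + d *\<^sub>R p l = (c *\<^sub>R p k + d *\<^sub>R p l) + s *\<^sub>R p k"
        by (simp add: algebra_simps)
      also have "\<dots> = a *\<^sub>R Y + b *\<^sub>R P + s *\<^sub>R (\<alpha> *\<^sub>R X + \<beta> *\<^sub>R Y + \<gamma> *\<^sub>R P)"
        by (simp only: eq[symmetric]) (simp only: side(1))
      finally show ?thesis by (simp add: algebra_simps)
    qed
    have kn: "k < n" "l < n" "k \<noteq> l" using G_bound kl by blast+
    show False
    proof (cases "k = x")
      case True
      have "d *\<^sub>R p l = a *\<^sub>R Y + b *\<^sub>R P - c *\<^sub>R X" using eq True by (simp add: XYU algebra_simps)
      then have "(1 / d) *\<^sub>R (d *\<^sub>R p l) = (1 / d) *\<^sub>R (a *\<^sub>R Y + b *\<^sub>R P - c *\<^sub>R X)" by simp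
      then have l1: "p l = (- c / d) *\<^sub>R X + (a / d) *\<^sub>R Y + (b / d) *\<^sub>R P"
        using pos by (simp add: algebra_simps)
      have l2: "p l = ((b * a0 - c) / d) *\<^sub>R X + ((a + b * b0) / d) *\<^sub>R Y + (b * c0 / d) *\<^sub>R U"
        unfolding l1 P using pos by (simp add: algebra_simps diff_divide_distrib add_divide_distrib)
      show False
      proof (cases "0 \<le> b * a0 - c")
        case True2: True
        then have "in_cone (p l) X Y U"
          unfolding l2 using pos nn by (intro in_coneI) simp_all
        with blocked[OF _ _ _ _ l1] kn disj True pos show False by simp
      next
        case False
        have "(c - b * a0) *\<^sub>R p x + d *\<^sub>R p l = (a + b * b0) *\<^sub>R p y + (b * c0) *\<^sub>R p u"
          using eq unfolding P True by (simp add: XYU algebra_simps)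
        from G_not_meeting[OF _ yu _ _ _ _ this] kl True False pos nn bx xu show False by auto
      qed
    next
      case kx: False
      have "\<beta> < 0 \<or> \<gamma> < 0"
      proof (rule ccontr)
        assume "\<not> ?thesis"
        then have "in_cone (p k) (p x) (p y) (p m)"
          unfolding side(1) XYU P_def using side(2) by (intro in_coneI) auto
        then show False using empty kn kx disj unfolding empty_triangle_def by auto
      qed
      then have neg: "\<beta> < 0 \<or> \<gamma> < 0" .
      have nn0: "0 \<le> a" "0 \<le> (0::real)" "0 \<le> b" "0 \<le> \<alpha>" using pos side(2) by simp_all
      obtain s where s: "0 \<le> s" "0 \<le> a + s * \<beta>" "0 \<le> 0 + s * \<alpha>" "0 \<le> b + s * \<gamma>"
        "a + s * \<beta> = 0 \<or> b + s * \<gamma> = 0" by (rule cone_exit[OF nn0 neg])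
      have cs: "0 < c + s" using pos s by simp
      from s(5) show False
      proof
        assume "a + s * \<beta> = 0"
        then have e: "(c + s) *\<^sub>R p k + d *\<^sub>R p l = (s * \<alpha>) *\<^sub>R p x + (b + s * \<gamma>) *\<^sub>R p m"
          using move[of s] by (simp add: XYU P_def)
        show False using G_not_meeting[OF kl xm cs pos(4) _ s(4) e kx disj(2)] s(3) by simp
      next
        assume "b + s * \<gamma> = 0"
        then have e: "(c + s) *\<^sub>R p k + d *\<^sub>R p l = (s * \<alpha>) *\<^sub>R p x + (a + s * \<beta>) *\<^sub>R p y"
          using move[of s] by (simp add: XYU)
        show False using G_not_meeting[OF kl xy cs pos(4) _ s(2) e kx disj(1)] s(3) by simp
      qed
    qed
  qed
  have ym: "(y, m) \<in> G"
  proof (rule G_maximal)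
    show "y < n" "m < n" "y \<noteq> m" using bx m by auto
    fix k l assume kl: "(k, l) \<in> G"
    show "\<not> crossing y m k l"
    proof
      assume "crossing y m k l"
      then obtain a b c d where disj: "k \<noteq> y" "k \<noteq> m" "l \<noteq> y" "l \<noteq> m"
        and pos: "0 < a" "0 < b" "0 < c" "0 < d" and eq: "a *\<^sub>R Y + b *\<^sub>R P = c *\<^sub>R p k + d *\<^sub>R p l"
        unfolding crossing_def XYU P_def by auto
      obtain \<alpha> \<beta> \<gamma> where K: "p k = \<alpha> *\<^sub>R X + \<beta> *\<^sub>R Y + \<gamma> *\<^sub>R P" using det3_basis[OF dXYP] by blast
      obtain \<alpha>' \<beta>' \<gamma>' where L: "p l = \<alpha>' *\<^sub>R X + \<beta>' *\<^sub>R Y + \<gamma>' *\<^sub>R P" using det3_basis[OF dXYP] by blast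
      have "0 *\<^sub>R X + a *\<^sub>R Y + b *\<^sub>R P
         = (c * \<alpha> + d * \<alpha>') *\<^sub>R X + (c * \<beta> + d * \<beta>') *\<^sub>R Y + (c * \<gamma> + d * \<gamma>') *\<^sub>R P"
        using eq unfolding K L by (simp add: algebra_simps)
      from det3_unique(1)[OF dXYP this] have sum: "c * \<alpha> + d * \<alpha>' = 0" by simp
      have "\<alpha> \<noteq> 0"
      proof
        assume "\<alpha> = 0"
        then have "det3 (p y) (p m) (p k) = 0"
          using K P_def by (simp add: XYU)
        then show False using gen[of y m k] bx m disj G_bound[OF kl] by auto
      qed
      then consider "0 < \<alpha>" | "0 < \<alpha>'" using sum pos
        by (metis add_neg_nonpos linorder_cases linorder_not_less mult_pos_neg mult_le_0_iff less_imp_le order_less_irrefl)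
      then show False
      proof cases
        case 1
        from ym_half[OF kl disj pos eq K 1] show False .
      next
        case 2
        have "a *\<^sub>R Y + b *\<^sub>R P = d *\<^sub>R p l + c *\<^sub>R p k" using eq by (simp add: add.commute)
        from ym_half[OF G_sym[OF kl] disj(3,4,1,2) pos(1,2,4,3) this L 2] show False .
      qed
    qed
  qed
  from that[OF m sm xm ym empty] show thesis .
qed

end

section \<open>Generic directions and cyclic successors\<close>

lemma det3_cyclic: "det3 v w u = det3 u v w" "det3 w u v = det3 u v w"
  by (simp_all add: det3_def cross3_simps)

lemma continuous_on_det3 [continuous_intros]:
  fixes f :: "'a::t2_space \<Rightarrow> real^3"
  assumes "continuous_on S f" "continuous_on S g" "continuous_on S h"
  shows "continuous_on S (\<lambda>x. det3 (f x) (g x) (h x))"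
  unfolding det3_def by (intro continuous_on_inner continuous_on_cross assms)

text \<open>Removing a hyperplane from a nonempty open set leaves a nonempty open set, so the
  hyperplanes can be removed one at a time.\<close>

lemma avoid_hyperplanes:
  fixes Z :: "'a::euclidean_space set"
  assumes "finite Z" "0 \<notin> Z" "open U" "U \<noteq> {}"
  shows "\<exists>x\<in>U. \<forall>z\<in>Z. z \<bullet> x \<noteq> 0"
  using assms
proof (induction Z arbitrary: U rule: finite_induct)
  case empty
  then show ?case by blast
next
  case (insert z Z)
  have op: "open (U \<inter> {x. z \<bullet> x \<noteq> 0})"
    using insert.prems by (intro open_Int open_Collect_neq continuous_intros)
  obtain u where u: "u \<in> U" using insert.prems by blast
  obtain e where e: "0 < e" "ball u e \<subseteq> U" using insert.prems u open_contains_ball by blast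
  have "U \<inter> {x. z \<bullet> x \<noteq> 0} \<noteq> {}"
  proof (cases "z \<bullet> u = 0")
    case True
    have z: "z \<noteq> 0" using insert.prems by auto
    let ?x = "u + (e / (2 * norm z)) *\<^sub>R z"
    have "?x \<in> ball u e" using e z by (simp add: dist_norm)
    moreover have "z \<bullet> ?x \<noteq> 0" using True e z by (simp add: inner_add_right)
    ultimately show ?thesis using e by blast
  qed (use u in blast)
  from insert.IH[OF _ op this] insert.prems show ?case by auto
qed

definition nx :: "nat \<Rightarrow> nat \<Rightarrow> nat" where
  "nx n i = Suc i mod n"

lemma nx_less [simp]: "i < n \<Longrightarrow> nx n i < n"
  by (simp add: nx_def)

lemma nx_inj: "i < n \<Longrightarrow> j < n \<Longrightarrow> nx n i = nx n j \<longleftrightarrow> i = j"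
  by (auto simp: nx_def mod_Suc split: if_splits)

lemma nx_neq [simp]: "i < n \<Longrightarrow> 2 \<le> n \<Longrightarrow> nx n i \<noteq> i" "i < n \<Longrightarrow> 2 \<le> n \<Longrightarrow> i \<noteq> nx n i"
  by (auto simp: nx_def mod_Suc split: if_splits)

lemma nx_nx_neq [simp]: "i < n \<Longrightarrow> 3 \<le> n \<Longrightarrow> nx n (nx n i) \<noteq> i" "i < n \<Longrightarrow> 3 \<le> n \<Longrightarrow> i \<noteq> nx n (nx n i)"
  by (auto simp: nx_def mod_Suc split: if_splits)

lemma nx_surj: "k < n \<Longrightarrow> \<exists>i<n. nx n i = k"
  by (cases k) (auto simp: nx_def intro: exI[of _ "n - 1"] exI[of _ "k - 1"])

lemma in_cone_swap: "in_cone k x y r \<longleftrightarrow> in_cone k y x r" "in_cone k x y r \<longleftrightarrow> in_cone k x r y"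
proof -
  have "in_cone k y x r" if "in_cone k x y r" for x y
  proof -
    from that obtain a b c where "0 \<le> a" "0 \<le> b" "0 \<le> c" and "k = a *\<^sub>R x + b *\<^sub>R y + c *\<^sub>R r"
      unfolding in_cone_def by blast
    then have "k = b *\<^sub>R y + a *\<^sub>R x + c *\<^sub>R r" by simp
    then show ?thesis using in_coneI[OF \<open>0 \<le> b\<close> \<open>0 \<le> a\<close> \<open>0 \<le> c\<close>] by simp
  qed
  then show "in_cone k x y r \<longleftrightarrow> in_cone k y x r" by blast
  have "in_cone k x r y" if "in_cone k x y r" for y r
  proof -
    from that obtain a b c where "0 \<le> a" "0 \<le> b" "0 \<le> c" and "k = a *\<^sub>R x + b *\<^sub>R y + c *\<^sub>R r"
      unfolding in_cone_def by blast
    then have "k = a *\<^sub>R x + c *\<^sub>R r + b *\<^sub>R y" by simp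
    then show ?thesis using in_coneI[OF \<open>0 \<le> a\<close> \<open>0 \<le> c\<close> \<open>0 \<le> b\<close>] by simp
  qed
  then show "in_cone k x y r \<longleftrightarrow> in_cone k x r y" by blast
qed

lemma in_cone_perm:
  "in_cone k x r y \<longleftrightarrow> in_cone k x y r" "in_cone k y x r \<longleftrightarrow> in_cone k x y r"
  "in_cone k y r x \<longleftrightarrow> in_cone k x y r" "in_cone k r x y \<longleftrightarrow> in_cone k x y r"
  "in_cone k r y x \<longleftrightarrow> in_cone k x y r"
proof -
  show a: "in_cone k x r y \<longleftrightarrow> in_cone k x y r" by (rule in_cone_swap(2)[symmetric])
  show b: "in_cone k y x r \<longleftrightarrow> in_cone k x y r" by (rule in_cone_swap(1)[symmetric])
  show "in_cone k y r x \<longleftrightarrow> in_cone k x y r" unfolding b[symmetric] by (rule in_cone_swap(2)[symmetric])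
  show c: "in_cone k r x y \<longleftrightarrow> in_cone k x y r" unfolding a[symmetric] by (rule in_cone_swap(1)[symmetric])
  show "in_cone k r y x \<longleftrightarrow> in_cone k x y r" unfolding c[symmetric] by (rule in_cone_swap(2)[symmetric])
qed

section \<open>Empty triangles around a vertex\<close>

context arc_triangulation
begin

lemma empty_triangle_cong:
  assumes "empty_triangle x y m" "{x, y, m} = {x', y', m'}" "x' \<noteq> y'" "x' \<noteq> m'" "y' \<noteq> m'"
  shows "empty_triangle x' y' m'"
proof -
  have mem: "x' \<in> {x, y, m}" "y' \<in> {x, y, m}" "m' \<in> {x, y, m}" using assms(2) by blast+
  have "in_cone k (p x') (p y') (p m') \<longleftrightarrow> in_cone k (p x) (p y) (p m)" for k
  proof -
    have "(x' = x \<and> y' = y \<and> m' = m) \<or> (x' = x \<and> y' = m \<and> m' = y) \<or> (x' = y \<and> y' = x \<and> m' = m)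
      \<or> (x' = y \<and> y' = m \<and> m' = x) \<or> (x' = m \<and> y' = x \<and> m' = y) \<or> (x' = m \<and> y' = y \<and> m' = x)"
      using mem assms(3-5) by auto
    then show ?thesis
      by (elim disjE conjE) (simp_all only: in_cone_perm[where k=k and x="p x" and y="p y" and r="p m"])
  qed
  then show ?thesis using assms(1) unfolding empty_triangle_def assms(2) by simp
qed

text \<open>An arc leaving \<open>v\<close> into an empty triangle cannot end inside it, so it would
  run beyond the opposite side and cross an arc of \<open>G\<close>. The sign of \<open>q\<close>
  distinguishes the two cases.\<close>

lemma no_arc_in_sector:
  assumes "(a, b) \<in> G" "(v, c) \<in> G" "v \<noteq> a" "v \<noteq> b" "empty_triangle v a b"
  shows "\<not> in_sector (p v) (p a) (p b) (p c)"
proof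
  assume "in_sector (p v) (p a) (p b) (p c)"
  then obtain q e f where ef: "0 < e" "0 < f" and c: "p c = q *\<^sub>R p v + e *\<^sub>R p a + f *\<^sub>R p b"
    unfolding in_sector_def by blast
  have bd: "a < n" "b < n" "a \<noteq> b" "v < n" "c < n" "v \<noteq> c" using G_bound assms by blast+
  have "c \<noteq> a"
  proof
    assume "c = a"
    then have "q *\<^sub>R p v + (e - 1) *\<^sub>R p a + f *\<^sub>R p b = 0" using c by (simp add: algebra_simps)
    from not_dependent(3)[OF _ _ _ _ _ _ this] bd assms(3,4) ef show False by auto
  qed
  moreover have "c \<noteq> b"
  proof
    assume "c = b"
    then have "q *\<^sub>R p v + e *\<^sub>R p a + (f - 1) *\<^sub>R p b = 0" using c by (simp add: algebra_simps)
    from not_dependent(2)[OF _ _ _ _ _ _ this] bd assms(3,4) ef show False by auto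
  qed
  ultimately have ni: "\<not> in_cone (p c) (p v) (p a) (p b)"
    using assms(5) bd unfolding empty_triangle_def by auto
  have "q < 0"
  proof (rule ccontr)
    assume "\<not> q < 0"
    then have "in_cone (p c) (p v) (p a) (p b)" unfolding c using ef by (intro in_coneI) auto
    with ni show False by blast
  qed
  have "(- q) *\<^sub>R p v + 1 *\<^sub>R p c = e *\<^sub>R p a + f *\<^sub>R p b" unfolding c by simp
  from G_not_meeting[OF assms(2,1) _ _ _ _ this assms(3,4)] \<open>q < 0\<close> ef show False by simp
qed

text \<open>Read \<open>(e, f)\<close> and \<open>(g, h)\<close> as the coordinates of
  \<open>a'\<close> and \<open>b'\<close> modulo \<open>p v\<close>. Neither is strictly inside the
  sector of \<open>a\<close> and \<open>b\<close>, but the sectors overlap; so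
  \<open>e \<le> 0\<close> puts \<open>a'\<close> at or beyond \<open>b\<close> and
  \<open>b'\<close> at or beyond \<open>a\<close>. If one of them were strictly beyond,
  \<open>a\<close> or \<open>b\<close> would lie strictly inside the sector of \<open>a'\<close> and
  \<open>b'\<close>.\<close>

lemma sector_triangle_unique_aux:
  assumes ab: "(v, a) \<in> G" "(v, b) \<in> G" "(a, b) \<in> G" "empty_triangle v a b"
    and ab': "(v, a') \<in> G" "(v, b') \<in> G" "(a', b') \<in> G" "empty_triangle v a' b'"
    and A: "p a' = q1 *\<^sub>R p v + e *\<^sub>R p a + f *\<^sub>R p b"
    and B: "p b' = q2 *\<^sub>R p v + g *\<^sub>R p a + h *\<^sub>R p b"
    and pos: "0 < \<beta>" "0 < \<gamma>" "0 < \<beta> * e + \<gamma> * g" "0 < \<beta> * f + \<gamma> * h"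
    and e: "e \<le> 0"
  shows "a = b' \<and> b = a'"
proof -
  have bd: "a < n" "b < n" "a \<noteq> b" "v < n" "v \<noteq> a" "v \<noteq> b" "a' < n" "b' < n" "a' \<noteq> b'" "v \<noteq> a'" "v \<noteq> b'"
    using G_bound ab ab' by blast+
  have "\<beta> * e \<le> 0" using e pos by (simp add: mult_nonneg_nonpos)
  then have "0 < \<gamma> * g" using pos by linarith
  then have g: "0 < g" using pos by (simp add: zero_less_mult_iff)
  have h: "h \<le> 0"
  proof (rule ccontr)
    assume "\<not> h \<le> 0"
    then have "in_sector (p v) (p a) (p b) (p b')" unfolding B using g by (intro in_sectorI) auto
    with no_arc_in_sector[OF ab(3) ab'(2) bd(5,6) ab(4)] show False by blast
  qed
  have "\<gamma> * h \<le> 0" using h pos by (simp add: mult_nonneg_nonpos)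
  then have "0 < \<beta> * f" using pos by linarith
  then have f: "0 < f" using pos by (simp add: zero_less_mult_iff)
  \<comment> \<open>Multiplying the two positivity conditions shows that passing from
    \<open>a\<close>, \<open>b\<close> to \<open>a'\<close>, \<open>b'\<close> reverses orientation.
    This fixes the signs when the system is solved for \<open>p a\<close> and
    \<open>p b\<close>.\<close>
  have det: "e * h < f * g"
  proof -
    have "\<beta> * (- e) < \<gamma> * g" "\<gamma> * (- h) < \<beta> * f" using pos by simp_all
    then have "(\<beta> * (- e)) * (\<gamma> * (- h)) < (\<gamma> * g) * (\<beta> * f)"
      by (rule mult_strict_mono') (use e h pos in \<open>auto simp: mult_le_0_iff\<close>)
    then have "(\<beta> * \<gamma>) * (e * h) < (\<beta> * \<gamma>) * (f * g)" by (simp add: algebra_simps)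
    then show ?thesis using pos by (simp add: mult_less_cancel_left_pos)
  qed
  define d where "d = f * g - e * h"
  have d: "0 < d" using det by (simp add: d_def)
  have h0: "h = 0"
  proof (rule ccontr)
    assume "h \<noteq> 0"
    then have "0 < - h / d" "0 < f / d" using h f d by (intro divide_pos_pos; simp)+
    have "d *\<^sub>R p a = (q1 * h - f * q2) *\<^sub>R p v + (- h) *\<^sub>R p a' + f *\<^sub>R p b'"
      unfolding A B d_def by (simp add: algebra_simps)
    then have "(1 / d) *\<^sub>R d *\<^sub>R p a = (1 / d) *\<^sub>R ((q1 * h - f * q2) *\<^sub>R p v + (- h) *\<^sub>R p a' + f *\<^sub>R p b')"
      by simp
    then have "p a = ((q1 * h - f * q2) / d) *\<^sub>R p v + (- h / d) *\<^sub>R p a' + (f / d) *\<^sub>R p b'"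
      using d by (simp add: scaleR_right_distrib scaleR_diff_right)
    then have "in_sector (p v) (p a') (p b') (p a)"
      using in_sectorI[OF \<open>0 < - h / d\<close> \<open>0 < f / d\<close>] by metis
    with no_arc_in_sector[OF ab'(3) ab(1) bd(10,11) ab'(4)] show False by blast
  qed
  have e0: "e = 0"
  proof (rule ccontr)
    assume "e \<noteq> 0"
    then have "0 < - e / d" "0 < g / d" using e g d by (intro divide_pos_pos; simp)+
    have "d *\<^sub>R p b = (e * q2 - g * q1) *\<^sub>R p v + g *\<^sub>R p a' + (- e) *\<^sub>R p b'"
      unfolding A B d_def by (simp add: algebra_simps)
    then have "(1 / d) *\<^sub>R d *\<^sub>R p b = (1 / d) *\<^sub>R ((e * q2 - g * q1) *\<^sub>R p v + g *\<^sub>R p a' + (- e) *\<^sub>R p b')"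
      by simp
    then have "p b = ((e * q2 - g * q1) / d) *\<^sub>R p v + (g / d) *\<^sub>R p a' + (- e / d) *\<^sub>R p b'"
      using d by (simp add: scaleR_right_distrib scaleR_diff_right)
    then have "in_sector (p v) (p a') (p b') (p b)"
      using in_sectorI[OF \<open>0 < g / d\<close> \<open>0 < - e / d\<close>] by metis
    with no_arc_in_sector[OF ab'(3) ab(2) bd(10,11) ab'(4)] show False by blast
  qed
  have "b = a'"
  proof (rule ccontr)
    assume "b \<noteq> a'"
    have "(- q1) *\<^sub>R p v + 1 *\<^sub>R p a' + (- f) *\<^sub>R p b = 0" unfolding A e0 by simp
    from not_dependent(3)[OF _ _ _ _ _ _ this] bd \<open>b \<noteq> a'\<close> f show False by auto
  qed
  moreover have "a = b'"
  proof (rule ccontr)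
    assume "a \<noteq> b'"
    have "(- q2) *\<^sub>R p v + 1 *\<^sub>R p b' + (- g) *\<^sub>R p a = 0" unfolding B h0 by simp
    from not_dependent(3)[OF _ _ _ _ _ _ this] bd \<open>a \<noteq> b'\<close> g show False by auto
  qed
  ultimately show ?thesis by blast
qed

lemma sector_triangle_unique:
  assumes ab: "(v, a) \<in> G" "(v, b) \<in> G" "(a, b) \<in> G" "empty_triangle v a b"
    and ab': "(v, a') \<in> G" "(v, b') \<in> G" "(a', b') \<in> G" "empty_triangle v a' b'"
    and z: "in_sector (p v) (p a) (p b) z" "in_sector (p v) (p a') (p b') z"
  shows "{a, b} = {a', b'}"
proof -
  have bd: "a < n" "b < n" "a \<noteq> b" "v < n" "v \<noteq> a" "v \<noteq> b" "a' < n" "b' < n" "a' \<noteq> b'" "v \<noteq> a'" "v \<noteq> b'"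
    using G_bound ab ab' by blast+
  have dv: "det3 (p v) (p a) (p b) \<noteq> 0" using gen[of v a b] bd by auto
  obtain q1 e f where A: "p a' = q1 *\<^sub>R p v + e *\<^sub>R p a + f *\<^sub>R p b" using det3_basis[OF dv] by blast
  obtain q2 g h where B: "p b' = q2 *\<^sub>R p v + g *\<^sub>R p a + h *\<^sub>R p b" using det3_basis[OF dv] by blast
  from z(1) obtain \<delta> \<beta> \<gamma> where bc: "0 < \<beta>" "0 < \<gamma>" "z = \<delta> *\<^sub>R p v + \<beta> *\<^sub>R p a + \<gamma> *\<^sub>R p b"
    unfolding in_sector_def by blast
  from z(2) obtain \<delta>' \<beta>' \<gamma>' where bc': "0 < \<beta>'" "0 < \<gamma>'" "z = \<delta>' *\<^sub>R p v + \<beta>' *\<^sub>R p a' + \<gamma>' *\<^sub>R p b'"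
    unfolding in_sector_def by blast
  have "\<delta> *\<^sub>R p v + \<beta> *\<^sub>R p a + \<gamma> *\<^sub>R p b = (\<delta>' + \<beta>' * q1 + \<gamma>' * q2) *\<^sub>R p v
      + (\<beta>' * e + \<gamma>' * g) *\<^sub>R p a + (\<beta>' * f + \<gamma>' * h) *\<^sub>R p b"
    using bc(3) unfolding bc'(3) A B by (simp add: algebra_simps)
  from det3_unique[OF dv this] bc have pos: "0 < \<beta>' * e + \<gamma>' * g" "0 < \<beta>' * f + \<gamma>' * h" by simp_all
  show ?thesis
  proof (cases "e \<le> 0")
    case True
    from sector_triangle_unique_aux[OF ab ab' A B bc'(1,2) pos True] show ?thesis by blast
  next
    \<comment> \<open>Since \<open>a'\<close> is not strictly inside the sector, one of its
      coordinates is at most zero; exchanging \<open>a\<close> and \<open>b\<close> reduces this to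
      the other case.\<close>
    case False
    have "f \<le> 0"
    proof (rule ccontr)
      assume "\<not> f \<le> 0"
      then have "in_sector (p v) (p a) (p b) (p a')" unfolding A using False by (intro in_sectorI) auto
      with no_arc_in_sector[OF ab(3) ab'(1) bd(5,6) ab(4)] show False by blast
    qed
    have A': "p a' = q1 *\<^sub>R p v + f *\<^sub>R p b + e *\<^sub>R p a" and B': "p b' = q2 *\<^sub>R p v + h *\<^sub>R p b + g *\<^sub>R p a"
      using A B by simp_all
    have "empty_triangle v b a" using empty_triangle_cong[OF ab(4), of v b a] bd by auto
    from sector_triangle_unique_aux[OF ab(2,1) G_sym[OF ab(3)] this ab' A' B' bc'(1,2) pos(2,1) \<open>f \<le> 0\<close>]
    show ?thesis by blast
  qed
qed

end

section \<open>Existence of an ear\<close>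

locale generic_polygon = generic_points +
  assumes four: "4 \<le> n"
    and edges_noncrossing: "\<lbrakk>i < n; j < n\<rbrakk> \<Longrightarrow> \<not> crossing i (nx n i) j (nx n j)"
begin

lemma ex_arc_triangulation:
  "\<exists>G. arc_triangulation n p G \<and> (\<forall>i<n. (i, nx n i) \<in> G)"
proof -
  define V where "V = {(i, j). i < n \<and> j < n \<and> i \<noteq> j}"
  define E where "E = (\<lambda>i. (i, nx n i)) ` {..<n}"
  define nc where "nc H \<longleftrightarrow> (\<forall>i j k l. (i, j) \<in> H \<longrightarrow> (k, l) \<in> H \<longrightarrow> \<not> crossing i j k l)" for H
  define fam where "fam = {H. E \<subseteq> H \<and> H \<subseteq> V \<and> nc H}"
  have "V \<subseteq> {..<n} \<times> {..<n}" by (auto simp: V_def)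
  then have "finite V" by (rule finite_subset) simp
  then have fin: "finite fam" unfolding fam_def by (rule finite_subset[rotated, OF finite_Pow_iff[THEN iffD2]]) blast
  have "E \<subseteq> V" unfolding E_def V_def using three by (simp add: image_subset_iff)
  moreover have "nc E"
    unfolding nc_def
  proof (intro allI impI)
    fix i j k l assume "(i, j) \<in> E" "(k, l) \<in> E"
    then have "i < n" "j = nx n i" "k < n" "l = nx n k" unfolding E_def by blast+
    then show "\<not> crossing i j k l" using edges_noncrossing by blast
  qed
  ultimately have "E \<in> fam" unfolding fam_def by simp
  from finite_has_maximal2[OF fin this] obtain G where G: "G \<in> fam" "E \<subseteq> G"
    and max': "\<forall>H\<in>fam. G \<subseteq> H \<longrightarrow> G = H" by (elim bexE conjE)
  note max = max'[rule_format]
  have GV: "G \<subseteq> V" and ncG: "nc G" using G unfolding fam_def by simp_all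
  have "arc_triangulation n p G"
  proof unfold_locales
    show "i < n \<and> j < n \<and> i \<noteq> j" if "(i, j) \<in> G" for i j
      using subsetD[OF GV that] by (simp add: V_def)
    show "\<not> crossing i j k l" if "(i, j) \<in> G" "(k, l) \<in> G" for i j k l
      using that ncG unfolding nc_def by blast
    show "(i, j) \<in> G" if ij: "i < n" "j < n" "i \<noteq> j" and n: "\<And>k l. (k, l) \<in> G \<Longrightarrow> \<not> crossing i j k l" for i j
    proof -
      have self: "\<not> crossing i j i j" by (simp add: crossing_def)
      have n': "\<not> crossing k l i j" if "(k, l) \<in> G" for k l using n[OF that] crossing_sym by blast
      have "nc (insert (i, j) G)"
        unfolding nc_def
      proof (intro allI impI)
        fix a b c d assume "(a, b) \<in> insert (i, j) G" "(c, d) \<in> insert (i, j) G"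
        then consider "a = i" "b = j" "c = i" "d = j" | "a = i" "b = j" "(c, d) \<in> G"
          | "(a, b) \<in> G" "c = i" "d = j" | "(a, b) \<in> G" "(c, d) \<in> G" by blast
        then show "\<not> crossing a b c d"
          by cases (use self n n' ncG in \<open>simp_all add: nc_def\<close>)
      qed
      moreover have "insert (i, j) G \<subseteq> V" using GV ij by (simp add: V_def)
      ultimately have "insert (i, j) G \<in> fam" using G unfolding fam_def by blast
      with max show ?thesis by blast
    qed
  qed
  then show ?thesis using G(2) unfolding E_def by blast
qed

end

text \<open>A direction \<open>\<xi>\<close> equips every vertex with the two germs \<open>\<plusminus> \<xi>\<close>. Every triangle of the sphere
  contains at least one of the germs at its vertices, and it contains three of them if \<open>\<xi>\<close> lies in
  its interior. There are \<open>2 n\<close> germs and \<open>2 n\<close> sides of polygon edges, so two of the triangles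
  adjacent to these sides coincide.\<close>

context arc_triangulation
begin

text \<open>The triangle is on the left of the arc from \<open>x\<close> to \<open>y\<close>;
  reversing the arc therefore addresses the triangle on its other side.\<close>

definition face :: "nat \<Rightarrow> nat \<Rightarrow> nat \<Rightarrow> bool" where
  "face x y m \<longleftrightarrow> 0 < det3 (p x) (p y) (p m) \<and> (x, m) \<in> G \<and> (y, m) \<in> G \<and> empty_triangle x y m"

text \<open>\<open>next_triangle\<close> expects the witness arc at the second end. If it is
  attached to \<open>x\<close>, the arc \<open>x y\<close> is reversed, and
  \<open>\<sigma> = - 1\<close> compensates the sign of the triple product.\<close>

lemma face_exists:
  assumes "(x, y) \<in> G" "(x, u) \<in> G \<or> (y, u) \<in> G" "0 < det3 (p x) (p y) (p u)"
  shows "\<exists>m. face x y m"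
  using assms(2)
proof
  assume "(y, u) \<in> G"
  have "0 < 1 * det3 (p x) (p y) (p u)" using assms(3) by simp
  from next_triangle[OF assms(1) \<open>(y, u) \<in> G\<close> this]
  obtain m where "0 < 1 * det3 (p x) (p y) (p m)" "(x, m) \<in> G" "(y, m) \<in> G" "empty_triangle x y m" .
  then show ?thesis unfolding face_def by auto
next
  assume xu: "(x, u) \<in> G"
  have neg: "- 1 * det3 (p y) (p x) w = det3 (p x) (p y) w" for w
    by (simp add: det3_def cross3_simps)
  have "0 < - 1 * det3 (p y) (p x) (p u)" unfolding neg by (rule assms(3))
  from next_triangle[OF G_sym[OF assms(1)] xu this]
  obtain m where m: "m < n" "m \<noteq> y" "m \<noteq> x" "0 < - 1 * det3 (p y) (p x) (p m)"
    "(y, m) \<in> G" "(x, m) \<in> G" "empty_triangle y x m" .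
  have "x \<noteq> y" using G_bound assms(1) by blast
  then have "empty_triangle x y m" using empty_triangle_cong[OF m(7), of x y m] m by auto
  with m show ?thesis unfolding face_def neg by blast
qed

text \<open>The corners enter as a set, because the same triangle is reached from several of its
  sides with its corners in a different order.\<close>

definition germ_in :: "real^3 \<Rightarrow> nat \<Rightarrow> nat \<Rightarrow> nat \<Rightarrow> nat \<times> bool \<Rightarrow> bool" where
  "germ_in \<xi> x y m w \<longleftrightarrow> (\<exists>a b. {fst w, a, b} = {x, y, m} \<and> fst w \<noteq> a \<and> fst w \<noteq> b \<and> a \<noteq> b \<and>
     in_sector (p (fst w)) (p a) (p b) ((if snd w then 1 else -1) *\<^sub>R \<xi>))"

text \<open>Modulo \<open>p x\<close> only the other two coefficients remain; if their signs agree,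
  \<open>\<xi>\<close> or \<open>- \<xi>\<close> points into the angle at \<open>x\<close>.\<close>

lemma germ_inI:
  assumes "x \<noteq> y" "x \<noteq> m" "y \<noteq> m"
    and \<xi>: "\<xi> = a *\<^sub>R p x + b *\<^sub>R p y + c *\<^sub>R p m" and bc: "b \<noteq> 0" "c \<noteq> 0" "0 < b \<longleftrightarrow> 0 < c"
  shows "germ_in \<xi> x y m (x, 0 < b)"
proof -
  let ?s = "if 0 < b then 1 else -1 :: real"
  have "?s *\<^sub>R \<xi> = (?s * a) *\<^sub>R p x + \<bar>b\<bar> *\<^sub>R p y + \<bar>c\<bar> *\<^sub>R p m"
    unfolding \<xi> using bc by (auto simp: scaleR_right_distrib)
  then have "in_sector (p x) (p y) (p m) (?s *\<^sub>R \<xi>)"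
    using in_sectorI[of "\<bar>b\<bar>" "\<bar>c\<bar>"] bc by simp
  then show ?thesis unfolding germ_in_def using assms(1-3) by (intro exI[of _ y] exI[of _ m]) simp
qed

lemma germ_in_perm: "germ_in \<xi> y m x w \<longleftrightarrow> germ_in \<xi> x y m w"
  by (simp add: germ_in_def insert_commute)

text \<open>Of three nonzero signs two agree, and the remaining corner carries the germ.\<close>

lemma germ_in_exists:
  assumes d: "x \<noteq> y" "x \<noteq> m" "y \<noteq> m"
    and \<xi>: "\<xi> = a *\<^sub>R p x + b *\<^sub>R p y + c *\<^sub>R p m" and abc: "a \<noteq> 0" "b \<noteq> 0" "c \<noteq> 0"
  shows "\<exists>v\<in>{x, y, m}. \<exists>s. germ_in \<xi> x y m (v, s)"
proof -
  have y: "\<xi> = b *\<^sub>R p y + c *\<^sub>R p m + a *\<^sub>R p x" and m: "\<xi> = c *\<^sub>R p m + a *\<^sub>R p x + b *\<^sub>R p y"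
    using \<xi> by simp_all
  consider "0 < b \<longleftrightarrow> 0 < c" | "0 < c \<longleftrightarrow> 0 < a" | "0 < a \<longleftrightarrow> 0 < b" by blast
  then show ?thesis
  proof cases
    case 1
    from germ_inI[OF d \<xi> abc(2,3) 1] show ?thesis by blast
  next
    case 2
    from germ_inI[OF d(3) d(1)[symmetric] d(2)[symmetric] y abc(3,1) 2] show ?thesis
      using germ_in_perm[of \<xi> y m x] by blast
  next
    case 3
    from germ_inI[OF d(2)[symmetric] d(3)[symmetric] d(1) m abc(1,2) 3] show ?thesis
      using germ_in_perm[of \<xi> y m x] germ_in_perm[of \<xi> m x y] by blast
  qed
qed

lemma face_germ_unique:
  assumes "(x, y) \<in> G" "face x y m" "(x', y') \<in> G" "face x' y' m'"
    and "germ_in \<xi> x y m w" "germ_in \<xi> x' y' m' w"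
  shows "{x, y, m} = {x', y', m'}"
proof -
  obtain v s where w: "w = (v, s)" by (cases w)
  have arcs: "(a, b) \<in> G" if "(x, y) \<in> G" "face x y m" "a \<in> {x, y, m}" "b \<in> {x, y, m}" "a \<noteq> b" for x y m a b
    using that G_sym[of x y] G_sym[of x m] G_sym[of y m] unfolding face_def by auto
  from assms(5) obtain a b where ab: "{v, a, b} = {x, y, m}" "v \<noteq> a" "v \<noteq> b" "a \<noteq> b"
    "in_sector (p v) (p a) (p b) ((if s then 1 else -1) *\<^sub>R \<xi>)"
    unfolding germ_in_def w by auto
  from assms(6) obtain a' b' where ab': "{v, a', b'} = {x', y', m'}" "v \<noteq> a'" "v \<noteq> b'" "a' \<noteq> b'"
    "in_sector (p v) (p a') (p b') ((if s then 1 else -1) *\<^sub>R \<xi>)"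
    unfolding germ_in_def w by auto
  have e: "empty_triangle v a b"
    by (rule empty_triangle_cong[OF _ ab(1)[symmetric] ab(2-4)]) (use assms(2) in \<open>simp add: face_def\<close>)
  have e': "empty_triangle v a' b'"
    by (rule empty_triangle_cong[OF _ ab'(1)[symmetric] ab'(2-4)]) (use assms(4) in \<open>simp add: face_def\<close>)
  have g: "(v, a) \<in> G" "(v, b) \<in> G" "(a, b) \<in> G"
    using arcs[OF assms(1,2)] unfolding ab(1)[symmetric] using ab(2-4) by simp_all
  have g': "(v, a') \<in> G" "(v, b') \<in> G" "(a', b') \<in> G"
    using arcs[OF assms(3,4)] unfolding ab'(1)[symmetric] using ab'(2-4) by simp_all
  from sector_triangle_unique[OF g e g' e' ab(5) ab'(5)]
  have "insert v {a, b} = insert v {a', b'}" by simp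
  then show ?thesis using ab(1) ab'(1) by simp
qed

end

context generic_polygon
begin

theorem ex_ear:
  "\<exists>i<n. \<forall>k<n. k \<notin> {i, nx n i, nx n (nx n i)} \<longrightarrow> \<not> in_cone (p k) (p i) (p (nx n i)) (p (nx n (nx n i)))"
proof (rule ccontr)
  assume noear: "\<not> ?thesis"
  obtain G where "arc_triangulation n p G" and edge: "\<And>i. i < n \<Longrightarrow> (i, nx n i) \<in> G"
    using ex_arc_triangulation by blast
  interpret arc_triangulation n p G by fact
  have noear: "\<not> empty_triangle i (nx n i) (nx n (nx n i))" if "i < n" for i
    using noear that unfolding empty_triangle_def by blast
  \<comment> \<open>The pair \<open>(i, True)\<close> stands for the left side of the edge from
    \<open>i\<close> to its successor, and \<open>(i, False)\<close> for its right side, which is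
    the left side of the reversed edge. The set \<open>W\<close> serves both as the set of sides and
    as the set of germs.\<close>
  define src tgt where "src e = (if snd e then fst e else nx n (fst e))"
    and "tgt e = (if snd e then nx n (fst e) else fst e)" for e :: "nat \<times> bool"
  define W where "W = {..<n} \<times> (UNIV :: bool set)"
  have finW: "finite W" by (simp add: W_def)
  have st: "(src e, tgt e) \<in> G" "src e < n" "tgt e < n" "src e \<noteq> tgt e" if "e \<in> W" for e
  proof -
    show "(src e, tgt e) \<in> G" using that edge[of "fst e"] G_sym[of "fst e"] by (auto simp: W_def src_def tgt_def)
    then show "src e < n" "tgt e < n" "src e \<noteq> tgt e" using G_bound by blast+
  qed
  define M where "M e = (SOME m. face (src e) (tgt e) m)" for e
  \<comment> \<open>A side may have no triangle, because all arcs at its ends may lie on the other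
    side; this happens for instance if all points lie in an open hemisphere and the edge bounds
    their convex hull.\<close>
  define cov where "cov e \<longleftrightarrow> (\<exists>m. face (src e) (tgt e) m)" for e
  have M: "face (src e) (tgt e) (M e)" if "cov e" for e
    using that unfolding cov_def M_def by (rule someI_ex)
  have Mb: "M e < n" "src e \<noteq> M e" "tgt e \<noteq> M e" if "cov e" for e
    using M[OF that] G_bound unfolding face_def by blast+
  \<comment> \<open>The end of the second edge lies on one of the two sides of the first edge, and
    the second edge is the witness arc there.\<close>
  have "\<exists>e0\<in>W. cov e0"
  proof -
    have 0: "0 < n" "nx n 0 < n" "nx n (nx n 0) < n" using four by simp_all
    have "det3 (p 0) (p (nx n 0)) (p (nx n (nx n 0))) \<noteq> 0"
      using gen[OF 0] 0 three by simp
    then consider "0 < det3 (p 0) (p (nx n 0)) (p (nx n (nx n 0)))"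
      | "0 < det3 (p (nx n 0)) (p 0) (p (nx n (nx n 0)))"
      using det3_swap(1)[of "p (nx n 0)" "p 0"] by fastforce
    then show ?thesis
    proof cases
      case 1
      have "cov (0, True)" unfolding cov_def src_def tgt_def
        using face_exists[OF edge[OF 0(1)] _ 1] edge[OF 0(2)] by simp
      then show ?thesis using 0 by (auto simp: W_def)
    next
      case 2
      have "cov (0, False)" unfolding cov_def src_def tgt_def
        using face_exists[OF G_sym[OF edge[OF 0(1)]] _ 2] edge[OF 0(2)] by simp
      then show ?thesis using 0 by (auto simp: W_def)
    qed
  qed
  then obtain e0 where e0: "e0 \<in> W" "cov e0" by blast
  define X Y Z where "X = p (src e0)" and "Y = p (tgt e0)" and "Z = p (M e0)"
  have dXYZ: "0 < det3 X Y Z" using M[OF e0(2)] unfolding face_def X_def Y_def Z_def by blast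
  \<comment> \<open>Directions strictly inside the triangle at \<open>e0\<close>, so that it
    contains the germ of \<open>\<xi>\<close> at each corner. Avoiding the planes through pairs of
    vertices makes all coefficients of \<open>\<xi>\<close> below nonzero.\<close>
  define U where "U = {\<xi>. 0 < det3 \<xi> Y Z} \<inter> {\<xi>. 0 < det3 X \<xi> Z} \<inter> {\<xi>. 0 < det3 X Y \<xi>}"
  have "open U" unfolding U_def by (intro open_Int open_Collect_less continuous_intros)
  moreover have "X + Y + Z \<in> U" unfolding U_def using dXYZ by simp
  ultimately obtain \<xi> where \<xi>U: "\<xi> \<in> U"
    and nz: "\<forall>z\<in>(\<lambda>(i, j). cross3 (p i) (p j)) ` {(i, j). i < n \<and> j < n \<and> i \<noteq> j}. z \<bullet> \<xi> \<noteq> 0"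
  proof -
    have fin: "finite {(i, j). i < n \<and> j < n \<and> i \<noteq> j}"
      by (rule finite_subset[of _ "{..<n} \<times> {..<n}"]) auto
    have nz: "0 \<notin> (\<lambda>(i, j). cross3 (p i) (p j)) ` {(i, j). i < n \<and> j < n \<and> i \<noteq> j}"
    proof
      assume "0 \<in> (\<lambda>(i, j). cross3 (p i) (p j)) ` {(i, j). i < n \<and> j < n \<and> i \<noteq> j}"
      then obtain i j where ij: "i < n" "j < n" "i \<noteq> j" "cross3 (p i) (p j) = 0" by auto
      have "\<not> {..<n} \<subseteq> {i, j}"
      proof
        assume "{..<n} \<subseteq> {i, j}"
        from card_mono[OF _ this] have "n \<le> 2" by (simp add: card_insert_if split: if_splits)
        then show False using three by simp
      qed
      then obtain k where "k < n" "k \<noteq> i" "k \<noteq> j" by auto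
      with gen[of k i j] ij show False by (simp add: det3_def)
    qed
    from avoid_hyperplanes[OF finite_imageI[OF fin] nz \<open>open U\<close>] \<open>X + Y + Z \<in> U\<close> that show thesis by blast
  qed
  have \<xi>: "det3 (p i) (p j) \<xi> \<noteq> 0" if "i < n" "j < n" "i \<noteq> j" for i j
  proof -
    have "cross3 (p i) (p j) \<bullet> \<xi> = det3 (p i) (p j) \<xi>"
      by (simp add: det3_def cross3_simps)
    then show ?thesis using nz that by auto
  qed
  \<comment> \<open>A side with a triangle may be charged to any germ in this triangle. A side
    without one is charged to the germ at \<open>fst e\<close> that points to it; the two sides of
    an edge use the same vertex, so they would be charged to opposite germs.\<close>
  define rel where "rel e w \<longleftrightarrow> (if cov e then germ_in \<xi> (src e) (tgt e) (M e) w
     else fst w = fst e \<and> 0 < (if snd w then 1 else -1) * det3 (p (src e)) (p (tgt e)) \<xi>)" for e w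
  have ex: "\<exists>w\<in>W. rel e w" if e: "e \<in> W" for e
  proof (cases "cov e")
    case True
    let ?x = "src e" and ?y = "tgt e" and ?m = "M e"
    note b = st[OF e] Mb[OF True]
    have d: "det3 (p ?x) (p ?y) (p ?m) \<noteq> 0" using gen b by simp
    obtain a c f where abc: "\<xi> = a *\<^sub>R p ?x + c *\<^sub>R p ?y + f *\<^sub>R p ?m" using det3_basis[OF d] by blast
    have "a \<noteq> 0" "c \<noteq> 0" "f \<noteq> 0"
      using \<xi>[of ?y ?m] \<xi>[of ?x ?m] \<xi>[of ?x ?y] b unfolding abc by auto
    from germ_in_exists[OF b(4,6,7) abc this] obtain v s where
      "v \<in> {?x, ?y, ?m}" "germ_in \<xi> ?x ?y ?m (v, s)" by blast
    with b True show ?thesis by (intro bexI[of _ "(v, s)"]) (auto simp: rel_def W_def)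
  next
    case False
    have "det3 (p (src e)) (p (tgt e)) \<xi> \<noteq> 0" using \<xi> st[OF e] by blast
    then have "rel e (fst e, 0 < det3 (p (src e)) (p (tgt e)) \<xi>)" using False by (auto simp: rel_def)
    then show ?thesis
      by (rule bexI) (use e in \<open>auto simp: W_def\<close>)
  qed
  \<comment> \<open>At the ends of an uncovered side all arcs of \<open>G\<close> point weakly to
    the other side. So do the triangles of \<open>G\<close> there, and none of their germs can point
    to the uncovered side.\<close>
  have unc: False if "e \<in> W" "\<not> cov e" "e' \<in> W" "cov e'" "rel e w" "rel e' w" for e e' w
  proof -
    let ?s = "if snd w then 1 else -1 :: real"
    have w: "fst w = fst e" and pos: "0 < ?s * det3 (p (src e)) (p (tgt e)) \<xi>"
      using that by (simp_all add: rel_def)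
    have v: "fst w \<in> {src e, tgt e}" by (auto simp: w src_def tgt_def)
    from that obtain a b where ab: "{fst w, a, b} = {src e', tgt e', M e'}" "fst w \<noteq> a" "fst w \<noteq> b" "a \<noteq> b"
      and sec: "in_sector (p (fst w)) (p a) (p b) (?s *\<^sub>R \<xi>)"
      by (auto simp: rel_def germ_in_def)
    have arcs: "(c, d) \<in> G" if "c \<in> {src e', tgt e', M e'}" "d \<in> {src e', tgt e', M e'}" "c \<noteq> d" for c d
      using that M[OF \<open>cov e'\<close>] st(1)[OF \<open>e' \<in> W\<close>] G_sym[of "src e'" "tgt e'"] G_sym[of "src e'" "M e'"]
        G_sym[of "tgt e'" "M e'"] unfolding face_def by auto
    have "(fst w, a) \<in> G" "(fst w, b) \<in> G" using arcs unfolding ab(1)[symmetric] using ab(2-4) by simp_all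
    then have le: "det3 (p (src e)) (p (tgt e)) (p a) \<le> 0" "det3 (p (src e)) (p (tgt e)) (p b) \<le> 0"
      using face_exists[OF st(1)[OF that(1)], of a] face_exists[OF st(1)[OF that(1)], of b] v that(2)
      unfolding cov_def by (auto simp: not_less[symmetric])
    from sec obtain d \<beta> \<gamma> where bc: "0 < \<beta>" "0 < \<gamma>" "?s *\<^sub>R \<xi> = d *\<^sub>R p (fst w) + \<beta> *\<^sub>R p a + \<gamma> *\<^sub>R p b"
      unfolding in_sector_def by blast
    have "?s * det3 (p (src e)) (p (tgt e)) \<xi> = det3 (p (src e)) (p (tgt e)) (?s *\<^sub>R \<xi>)" by simp
    also have "\<dots> = \<beta> * det3 (p (src e)) (p (tgt e)) (p a) + \<gamma> * det3 (p (src e)) (p (tgt e)) (p b)"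
      unfolding bc(3) using v by auto
    also have "\<dots> \<le> 0" using le bc by (intro add_nonpos_nonpos mult_nonneg_nonpos) auto
    finally show False using pos by simp
  qed
  \<comment> \<open>Different covered sides with a common germ bound the same triangle. The two
    sides of one edge would give it opposite orientations; two different edges of one triangle share
    a vertex, so they are consecutive and make the triangle an ear.\<close>
  have inj: "e = e'" if e: "e \<in> W" "e' \<in> W" "rel e w" "rel e' w" for e e' w
  proof -
    obtain i b i' b' where ib: "e = (i, b)" "e' = (i', b')" by (cases e, cases e')
    have ii: "i < n" "i' < n" using e ib by (auto simp: W_def)
    consider (c) "cov e" "cov e'" | (u) "\<not> cov e" "\<not> cov e'" using unc e by blast
    then show ?thesis
    proof cases
      case u
      then have "i = i'" using e unfolding ib rel_def by simp
      moreover have "b = b'"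
      proof (rule ccontr)
        assume "b \<noteq> b'"
        then have "src e' = tgt e" "tgt e' = src e" using \<open>i = i'\<close> by (auto simp: ib src_def tgt_def)
        then have "det3 (p (src e')) (p (tgt e')) \<xi> = - det3 (p (src e)) (p (tgt e)) \<xi>"
          by (simp add: det3_swap(1)[of "p (tgt e)" "p (src e)" \<xi>])
        then show False using e u by (auto simp: rel_def zero_less_mult_iff split: if_splits)
      qed
      ultimately show ?thesis by (simp add: ib)
    next
      case c
      have S: "{src e, tgt e, M e} = {src e', tgt e', M e'}"
        using face_germ_unique[OF st(1)[OF e(1)] M[OF c(1)] st(1)[OF e(2)] M[OF c(2)]] e c
        by (simp add: rel_def)
      have "{i, nx n i} \<subseteq> {src e, tgt e, M e}" "{i', nx n i'} \<subseteq> {src e', tgt e', M e'}"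
        by (simp_all add: ib src_def tgt_def)
      note sub = this(1) this(2)[folded S]
      show ?thesis
      proof (cases "i = i'")
        case True
        show ?thesis
        proof (cases "b = b'")
          case False
          then have sw: "src e' = tgt e" "tgt e' = src e" using True by (auto simp: ib src_def tgt_def)
          have "M e \<in> {src e', tgt e', M e'}" unfolding S[symmetric] by simp
          then have "M e = M e'" using Mb[OF c(1)] by (simp add: sw)
          have "0 < det3 (p (tgt e)) (p (src e)) (p (M e))" "0 < det3 (p (src e)) (p (tgt e)) (p (M e))"
            using M[OF c(1)] M[OF c(2), unfolded sw] \<open>M e = M e'\<close> unfolding face_def by simp_all
          then show ?thesis using det3_swap(1)[of "p (tgt e)" "p (src e)" "p (M e)"] by simp
        qed (use True ib in simp)
      next
        case False
        have ear: False if "j < n" "{j, nx n j, nx n (nx n j)} \<subseteq> {src e, tgt e, M e}" for j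
        proof -
          have c3: "card {j, nx n j, nx n (nx n j)} = 3" using that(1) three by simp
          have "card {src e, tgt e, M e} \<le> 3" by (simp add: card_insert_if)
          then have "{j, nx n j, nx n (nx n j)} = {src e, tgt e, M e}"
            using card_seteq[OF _ that(2)] c3 by simp
          then have "empty_triangle j (nx n j) (nx n (nx n j))"
            using empty_triangle_cong[of "src e" "tgt e" "M e" j "nx n j" "nx n (nx n j)"] M[OF c(1)] that(1) three
            unfolding face_def by simp
          with noear that(1) show False by blast
        qed
        have "nx n i \<noteq> i'" using ear[OF ii(1)] sub by blast
        moreover have "nx n i' \<noteq> i" using ear[OF ii(2)] sub by blast
        moreover have "nx n i \<noteq> nx n i'" using False nx_inj ii by simp
        ultimately have "card {i, nx n i, i', nx n i'} = 4" using False ii three by (simp add: card_insert_if)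
        moreover have "card {i, nx n i, i', nx n i'} \<le> card {src e, tgt e, M e}"
          using sub by (intro card_mono) auto
        moreover have "card {src e, tgt e, M e} \<le> 3" by (simp add: card_insert_if)
        ultimately show ?thesis by simp
      qed
    qed
  qed
  \<comment> \<open>Choosing a germ for each side is an injection of \<open>W\<close> into itself,
    hence a bijection. But the germs of \<open>\<xi>\<close> at both ends of \<open>e0\<close> can
    be charged by \<open>e0\<close> only, and \<open>e0\<close> has chosen just one.\<close>
  obtain f where f: "\<And>e. e \<in> W \<Longrightarrow> f e \<in> W \<and> rel e (f e)" using ex by metis
  have "inj_on f W" using f inj by (metis inj_onI)
  then have surj: "f ` W = W" using f by (intro endo_inj_surj[OF finW]) auto
  note b0 = st[OF e0(1)] Mb[OF e0(2)]
  obtain a b c where abc: "\<xi> = a *\<^sub>R X + b *\<^sub>R Y + c *\<^sub>R Z" using det3_basis dXYZ by (metis less_irrefl)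
  have pos: "0 < a" "0 < b" "0 < c"
    using \<xi>U dXYZ unfolding U_def abc by (simp_all add: zero_less_mult_iff)
  have abc': "\<xi> = b *\<^sub>R Y + c *\<^sub>R Z + a *\<^sub>R X" unfolding abc by simp
  have r1: "rel e0 (src e0, True)" "rel e0 (tgt e0, True)"
    using germ_inI[OF b0(4,6,7) abc[unfolded X_def Y_def Z_def]] pos
      germ_inI[OF b0(7) b0(4)[symmetric] b0(6)[symmetric] abc'[unfolded X_def Y_def Z_def]] e0(2)
    by (simp_all add: rel_def germ_in_perm[of \<xi> "tgt e0" "M e0" "src e0"])
  have "(src e0, True) \<in> W" "(tgt e0, True) \<in> W" using b0 by (auto simp: W_def)
  then obtain e1 e2 where e: "e1 \<in> W" "f e1 = (src e0, True)" "e2 \<in> W" "f e2 = (tgt e0, True)"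
    using surj by (metis imageE)
  have "e1 = e0" "e2 = e0" using inj[OF e(1) e0(1) _ r1(1)] inj[OF e(3) e0(1) _ r1(2)] f e by metis+
  then show False using e b0(4) by simp
qed

end

section \<open>Embedded cone polygons\<close>

text \<open>The two cones may share only the ray of a common end: a coefficient can be nonzero only
  if its vector has an index common to both edges.\<close>

definition meets_properly :: "nat \<Rightarrow> (nat \<Rightarrow> real^3) \<Rightarrow> nat \<Rightarrow> nat \<Rightarrow> bool" where
  "meets_properly n p e f \<longleftrightarrow> (\<forall>a\<ge>0. \<forall>b\<ge>0. \<forall>c\<ge>0. \<forall>d\<ge>0.
     a *\<^sub>R p e + b *\<^sub>R p (nx n e) = c *\<^sub>R p f + d *\<^sub>R p (nx n f) \<longrightarrow>
     (a = 0 \<or> e = nx n f) \<and> (b = 0 \<or> f = nx n e) \<and> (c = 0 \<or> f = nx n e) \<and> (d = 0 \<or> e = nx n f))"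

text \<open>The cones spanned by consecutive vectors form an embedded cone over a polygon; equivalently,
  the directions of the vectors are the vertices of a simple spherical polygon whose edges are
  shorter than half a great circle.\<close>

definition cone_polygon :: "nat \<Rightarrow> (nat \<Rightarrow> real^3) \<Rightarrow> bool" where
  "cone_polygon n p \<longleftrightarrow> 3 \<le> n \<and> (\<forall>i<n. cross3 (p i) (p (nx n i)) \<noteq> 0) \<and>
     (\<forall>e<n. \<forall>f<n. e \<noteq> f \<longrightarrow> meets_properly n p e f)"

lemma meets_properlyD:
  assumes "meets_properly n p e f" "0 \<le> a" "0 \<le> b" "0 \<le> c" "0 \<le> d"
    "a *\<^sub>R p e + b *\<^sub>R p (nx n e) = c *\<^sub>R p f + d *\<^sub>R p (nx n f)"
  shows "a = 0 \<or> e = nx n f" "b = 0 \<or> f = nx n e" "c = 0 \<or> f = nx n e" "d = 0 \<or> e = nx n f"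
  using assms unfolding meets_properly_def by blast+

lemma meets_properly_sym: "meets_properly n p e f \<Longrightarrow> meets_properly n p f e"
  unfolding meets_properly_def by (metis (no_types))

lemma nx3_neq [simp]: "i < n \<Longrightarrow> 4 \<le> n \<Longrightarrow> nx n (nx n (nx n i)) \<noteq> i"
  by (auto simp: nx_def mod_Suc split: if_splits)

locale ear = generic_points +
  fixes i j k :: nat
  assumes polygon: "cone_polygon n p" and four: "4 \<le> n"
    and i: "i < n" and j: "j = nx n i" and k: "k = nx n j"
    and ear_empty: "\<And>m. m < n \<Longrightarrow> m \<notin> {i, j, k} \<Longrightarrow> \<not> in_cone (p m) (p i) (p j) (p k)"
begin

lemma index: "j < n" "k < n" "i \<noteq> j" "i \<noteq> k" "j \<noteq> k" "nx n k \<noteq> i" "nx n k \<noteq> j" "nx n k \<noteq> k"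
  using i j k four by simp_all

lemma proper: "e < n \<Longrightarrow> f < n \<Longrightarrow> e \<noteq> f \<Longrightarrow> meets_properly n p e f"
  using polygon unfolding cone_polygon_def by blast

lemma det_ear: "det3 (p i) (p j) (p k) \<noteq> 0"
  using gen i index by simp

text \<open>The end \<open>m\<close> is outside the triangle. If it were not beyond the side
  \<open>i k\<close>, the part of the edge leading to \<open>m\<close> would leave the triangle
  through \<open>i j\<close> or \<open>j k\<close>, which are polygon edges it cannot touch. The
  pair \<open>m\<close>, \<open>m'\<close> covers both directions of the edge
  \<open>e\<close>.\<close>

lemma edge_meets_ear_half:
  assumes m: "m < n" "m \<notin> {i, j, k}"
    and e: "e < n" "e \<notin> {i, j, k}" "nx n e \<notin> {i, j, k}" "{m, m'} = {e, nx n e}" "m \<noteq> m'"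
    and cd: "0 < c" "0 < d" and nn: "0 \<le> a1" "0 \<le> a2" "0 \<le> a3"
    and eq: "c *\<^sub>R p m + d *\<^sub>R p m' = a1 *\<^sub>R p i + a2 *\<^sub>R p j + a3 *\<^sub>R p k"
    and M: "p m = k1 *\<^sub>R p i + k2 *\<^sub>R p j + k3 *\<^sub>R p k"
  shows "k2 < 0"
proof (rule ccontr)
  assume "\<not> k2 < 0"
  then have k2: "0 \<le> k2" by simp
  have neg: "k1 < 0 \<or> k3 < 0"
  proof (rule ccontr)
    assume "\<not> ?thesis"
    then have "in_cone (p m) (p i) (p j) (p k)" unfolding M using k2 by (intro in_coneI) auto
    with ear_empty m show False by blast
  qed
  obtain s where s: "0 \<le> s" "0 \<le> a1 + s * k1" "0 \<le> a2 + s * k2" "0 \<le> a3 + s * k3"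
    "a1 + s * k1 = 0 \<or> a3 + s * k3 = 0" by (rule cone_exit[OF nn k2 neg])
  have "(c + s) *\<^sub>R p m + d *\<^sub>R p m' = (c *\<^sub>R p m + d *\<^sub>R p m') + s *\<^sub>R p m" by (simp add: algebra_simps)
  also have "\<dots> = a1 *\<^sub>R p i + a2 *\<^sub>R p j + a3 *\<^sub>R p k + s *\<^sub>R (k1 *\<^sub>R p i + k2 *\<^sub>R p j + k3 *\<^sub>R p k)"
    by (simp only: eq) (simp only: M)
  also have "\<dots> = (a1 + s * k1) *\<^sub>R p i + (a2 + s * k2) *\<^sub>R p j + (a3 + s * k3) *\<^sub>R p k"
    by (simp add: algebra_simps)
  finally have z: "(c + s) *\<^sub>R p m + d *\<^sub>R p m'
      = (a1 + s * k1) *\<^sub>R p i + (a2 + s * k2) *\<^sub>R p j + (a3 + s * k3) *\<^sub>R p k" .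
  obtain c' d' where c': "0 < c'" "0 < d'"
    "c' *\<^sub>R p e + d' *\<^sub>R p (nx n e) = (a1 + s * k1) *\<^sub>R p i + (a2 + s * k2) *\<^sub>R p j + (a3 + s * k3) *\<^sub>R p k"
  proof (cases "m = e")
    case True
    then have "m' = nx n e" using e by (auto simp: doubleton_eq_iff)
    then show thesis using that[of "c + s" d] z s cd True by auto
  next
    case False
    then have "m = nx n e" "m' = e" using e by (auto simp: doubleton_eq_iff)
    then show thesis using that[of d "c + s"] z s cd by (auto simp: add.commute)
  qed
  from s(5) show False
  proof
    assume "a1 + s * k1 = 0"
    with c'(3) have "c' *\<^sub>R p e + d' *\<^sub>R p (nx n e) = (a2 + s * k2) *\<^sub>R p j + (a3 + s * k3) *\<^sub>R p (nx n j)"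
      by (simp add: k)
    from meets_properlyD(1)[OF proper[OF e(1) index(1)] _ _ s(3,4) this] c' e show False by (auto simp: k)
  next
    assume "a3 + s * k3 = 0"
    with c'(3) have "c' *\<^sub>R p e + d' *\<^sub>R p (nx n e) = (a1 + s * k1) *\<^sub>R p i + (a2 + s * k2) *\<^sub>R p (nx n i)"
      by (simp add: j)
    from meets_properlyD(1)[OF proper[OF e(1) i] _ _ s(2,3) this] c' e show False by (auto simp: j)
  qed
qed

text \<open>For an edge apart from the corners, \<open>edge_meets_ear_half\<close> puts both ends
  beyond \<open>i k\<close>, so no point between them is in the triangle. Edges starting at
  \<open>k\<close> or ending at \<open>i\<close> are treated separately: entering the triangle from
  the corner they would leave it through a side of the ear or end inside it.\<close>

lemma edge_meets_ear:
  assumes m: "m < n" "m \<noteq> i" "m \<noteq> j" and cd: "0 \<le> c" "0 \<le> d" and nn: "0 \<le> a1" "0 \<le> a2" "0 \<le> a3"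
    and eq: "c *\<^sub>R p m + d *\<^sub>R p (nx n m) = a1 *\<^sub>R p i + a2 *\<^sub>R p j + a3 *\<^sub>R p k"
  shows "c = 0 \<or> m = k" "d = 0 \<or> nx n m = i" "c = 0 \<or> d = 0"
proof -
  have m': "nx n m < n" "nx n m \<noteq> j" "nx n m \<noteq> k" "nx n m \<noteq> m"
    using m nx_inj[OF m(1) i] nx_inj[OF m(1) index(1)] four unfolding j[symmetric] k[symmetric] by auto
  obtain k1 k2 k3 where M: "p m = k1 *\<^sub>R p i + k2 *\<^sub>R p j + k3 *\<^sub>R p k" using det3_basis[OF det_ear] by blast
  obtain l1 l2 l3 where L: "p (nx n m) = l1 *\<^sub>R p i + l2 *\<^sub>R p j + l3 *\<^sub>R p k" using det3_basis[OF det_ear] by blast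
  have "(c * k1 + d * l1) *\<^sub>R p i + (c * k2 + d * l2) *\<^sub>R p j + (c * k3 + d * l3) *\<^sub>R p k
      = a1 *\<^sub>R p i + a2 *\<^sub>R p j + a3 *\<^sub>R p k"
    using eq unfolding M L by (simp add: algebra_simps)
  from det3_unique[OF det_ear this]
  have co: "c * k1 + d * l1 = a1" "c * k2 + d * l2 = a2" "c * k3 + d * l3 = a3" by simp_all
  have ncL: "\<not> (0 \<le> l1 \<and> 0 \<le> l2 \<and> 0 \<le> l3)" if "nx n m \<noteq> i"
    using ear_empty[of "nx n m"] m' that in_coneI[of l1 l2 l3 "p i" "p j" "p k"] unfolding L[symmetric] by blast
  have ncM: "\<not> (0 \<le> k1 \<and> 0 \<le> k2 \<and> 0 \<le> k3)" if "m \<noteq> k"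
    using ear_empty[of m] m that in_coneI[of k1 k2 k3 "p i" "p j" "p k"] unfolding M[symmetric] by blast
  have "(c = 0 \<or> m = k) \<and> (d = 0 \<or> nx n m = i) \<and> (c = 0 \<or> d = 0)"
  proof (cases "m = k")
    case True
    then have mi: "nx n m \<noteq> i" using index by simp
    have "1 *\<^sub>R p k = k1 *\<^sub>R p i + k2 *\<^sub>R p j + k3 *\<^sub>R p k" using M True by simp
    then have "0 *\<^sub>R p i + 0 *\<^sub>R p j + 1 *\<^sub>R p k = k1 *\<^sub>R p i + k2 *\<^sub>R p j + k3 *\<^sub>R p k" by simp
    from det3_unique[OF det_ear this] have k0: "k1 = 0" "k2 = 0" by simp_all
    have "d = 0"
    proof (rule ccontr)
      assume "d \<noteq> 0"
      then have d: "0 < d" using cd by simp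
      have "0 \<le> l1" "0 \<le> l2" using co(1,2) nn d by (auto simp: k0 zero_le_mult_iff)
      then have l3: "l3 < 0" using ncL[OF mi] by auto
      have "(- d * l3) *\<^sub>R p m + d *\<^sub>R p (nx n m) = (d * l1) *\<^sub>R p i + (d * l2) *\<^sub>R p (nx n i)"
        by (subst L) (simp add: True j[symmetric] algebra_simps)
      from meets_properlyD(2)[OF proper[OF m(1) i m(2)] _ _ _ _ this]
      show False using d l3 \<open>0 \<le> l1\<close> \<open>0 \<le> l2\<close> mi by (auto simp: mult_nonneg_nonpos)
    qed
    then show ?thesis using True by simp
  next
    case mk: False
    show ?thesis
    proof (cases "nx n m = i")
      case True
      then have "0 *\<^sub>R p j + 0 *\<^sub>R p k + 1 *\<^sub>R p i = l1 *\<^sub>R p i + l2 *\<^sub>R p j + l3 *\<^sub>R p k" using L by simp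
      then have "1 *\<^sub>R p i + 0 *\<^sub>R p j + 0 *\<^sub>R p k = l1 *\<^sub>R p i + l2 *\<^sub>R p j + l3 *\<^sub>R p k" by simp
      from det3_unique[OF det_ear this] have l0: "l2 = 0" "l3 = 0" by simp_all
      have "c = 0"
      proof (rule ccontr)
        assume "c \<noteq> 0"
        then have c: "0 < c" using cd by simp
        have "0 \<le> k2" "0 \<le> k3" using co(2,3) nn c by (auto simp: l0 zero_le_mult_iff)
        then have k1: "k1 < 0" using ncM[OF mk] by auto
        have "c *\<^sub>R p m + (- c * k1) *\<^sub>R p (nx n m) = (c * k2) *\<^sub>R p j + (c * k3) *\<^sub>R p (nx n j)"
          by (subst M) (simp add: True k[symmetric] algebra_simps)
        from meets_properlyD(1)[OF proper[OF m(1) index(1) m(3)] _ _ _ _ this]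
        show False using c k1 \<open>0 \<le> k2\<close> \<open>0 \<le> k3\<close> mk k by (auto simp: mult_nonneg_nonpos)
      qed
      then show ?thesis using True by simp
    next
      case False
      have "c = 0 \<and> d = 0"
      proof (cases "0 < c \<and> 0 < d")
        case True
        have eq': "d *\<^sub>R p (nx n m) + c *\<^sub>R p m = a1 *\<^sub>R p i + a2 *\<^sub>R p j + a3 *\<^sub>R p k"
          using eq by (simp add: add.commute)
        have mm: "m \<notin> {i, j, k}" "nx n m \<notin> {i, j, k}" using m mk m' False by auto
        have "k2 < 0"
          by (rule edge_meets_ear_half[of m m "nx n m", OF m(1) mm(1) m(1) mm _ _ _ _ nn eq M])
            (use True m' in auto)
        moreover have "l2 < 0"
          by (rule edge_meets_ear_half[of "nx n m" m m, OF m'(1) mm(2) m(1) mm _ _ _ _ nn eq' L])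
            (use True m' in auto)
        ultimately have "c * k2 + d * l2 < 0" using True
          by (intro add_neg_neg mult_pos_neg) auto
        then show ?thesis using co(2) nn by simp
      next
        case c0: False
        show ?thesis
        proof (cases "c = 0")
          case True
          have "d = 0"
          proof (rule ccontr)
            assume "d \<noteq> 0"
            then have d: "0 < d" using cd by simp
            then have "0 \<le> l1" "0 \<le> l2" "0 \<le> l3" using co nn True by (auto simp: zero_le_mult_iff)
            with ncL[OF False] show False by blast
          qed
          with True show ?thesis by blast
        next
          case c: False
          then have "0 < c" "d = 0" using cd c0 by auto
          then have "0 \<le> k1" "0 \<le> k2" "0 \<le> k3" using co nn by (auto simp: zero_le_mult_iff)
          with ncM[OF mk] show ?thesis by blast
        qed
      qed
      then show ?thesis by simp
    qed
  qed
  then show "c = 0 \<or> m = k" "d = 0 \<or> nx n m = i" "c = 0 \<or> d = 0" by blast+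
qed

text \<open>No other edge enters the triangle of an ear, so its tip can be moved within it. The
  condition \<open>pos\<close> excludes the zero vector and the corners \<open>i\<close> and
  \<open>k\<close>, where an edge would degenerate; the open side \<open>i k\<close> is allowed, and
  there the ear is flat.\<close>

lemma cone_polygon_move:
  assumes nn: "0 \<le> \<alpha>" "0 \<le> \<beta>" "0 \<le> \<gamma>" and pos: "0 < \<beta> \<or> (0 < \<alpha> \<and> 0 < \<gamma>)"
    and q: "q = \<alpha> *\<^sub>R p i + \<beta> *\<^sub>R p j + \<gamma> *\<^sub>R p k"
  shows "cone_polygon n (p(j := q))"
proof -
  define r where "r = p(j := q)"
  note ix = i index
  have rj: "r j = q" by (simp add: r_def)
  have ro: "r m = p m" if "m \<noteq> j" for m using that by (simp add: r_def)
  have ri: "r i = p i" "r k = p k" using ix by (auto simp: r_def)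
  have nxj: "nx n m = j \<longleftrightarrow> m = i" if "m < n" for m using nx_inj[OF that i] j by simp
  have nxk: "nx n m = k \<longleftrightarrow> m = j" if "m < n" for m using nx_inj[OF that index(1)] k by simp
  have cross: "cross3 (r m) (r (nx n m)) \<noteq> 0" if "m < n" for m
  proof -
    consider "m = i" | "m = j" | "m \<noteq> i" "m \<noteq> j" by blast
    then show ?thesis
    proof cases
      case 1
      have "p j \<bullet> cross3 (p i) q = - \<gamma> * det3 (p i) (p j) (p k)"
        "p k \<bullet> cross3 (p i) q = \<beta> * det3 (p i) (p j) (p k)"
        unfolding det3_def[symmetric] q using det3_swap(1)[of "p j" "p i" "p k"] det3_cyclic(2)[of "p k" "p i" "p j"]
        by simp_all
      then have "cross3 (p i) q \<noteq> 0" using pos det_ear by auto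
      then show ?thesis using 1 by (simp add: j[symmetric] ri(1) rj)
    next
      case 2
      have "p i \<bullet> cross3 q (p k) = \<beta> * det3 (p i) (p j) (p k)"
        "p j \<bullet> cross3 q (p k) = - \<alpha> * det3 (p i) (p j) (p k)"
        unfolding det3_def[symmetric] q using det3_swap(1)[of "p j" "p i" "p k"] by simp_all
      then have "cross3 q (p k) \<noteq> 0" using pos det_ear by auto
      then show ?thesis using 2 by (simp add: k[symmetric] ri(2) rj)
    next
      case 3
      then show ?thesis using polygon that nxj[OF that] by (simp add: ro cone_polygon_def)
    qed
  qed
  have im: "meets_properly n r i m" if m: "m < n" "m \<noteq> i" "m \<noteq> j" for m
    unfolding meets_properly_def
  proof (intro allI impI)
    fix a b c d :: real assume abcd: "0 \<le> a" "0 \<le> b" "0 \<le> c" "0 \<le> d"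
      and "a *\<^sub>R r i + b *\<^sub>R r (nx n i) = c *\<^sub>R r m + d *\<^sub>R r (nx n m)"
    then have e0: "c *\<^sub>R p m + d *\<^sub>R p (nx n m) = a *\<^sub>R p i + b *\<^sub>R q"
      using m nxj[OF m(1)] by (simp add: ri rj ro j[symmetric])
    then have e: "c *\<^sub>R p m + d *\<^sub>R p (nx n m) = (a + b * \<alpha>) *\<^sub>R p i + (b * \<beta>) *\<^sub>R p j + (b * \<gamma>) *\<^sub>R p k"
      by (simp add: q algebra_simps)
    have nn': "0 \<le> a + b * \<alpha>" "0 \<le> b * \<beta>" "0 \<le> b * \<gamma>" using abcd nn by simp_all
    note X = edge_meets_ear[OF m abcd(3,4) nn' e]
    have c0: "c = 0"
    proof (rule ccontr)
      assume "c \<noteq> 0"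
      then have mk: "m = k" "d = 0" using X by auto
      then have "0 *\<^sub>R p i + 0 *\<^sub>R p j + c *\<^sub>R p k = (a + b * \<alpha>) *\<^sub>R p i + (b * \<beta>) *\<^sub>R p j + (b * \<gamma>) *\<^sub>R p k"
        using e by simp
      from det3_unique[OF det_ear this] have u: "a + b * \<alpha> = 0" "b * \<beta> = 0" "c = b * \<gamma>" by simp_all
      have "b \<noteq> 0" using u(3) \<open>c \<noteq> 0\<close> by auto
      moreover have "b * \<alpha> = 0" using u(1) abcd nn by (metis add_nonneg_eq_0_iff mult_nonneg_nonneg)
      ultimately show False using u(2) pos by auto
    qed
    have "d *\<^sub>R p i + 0 *\<^sub>R p j + 0 *\<^sub>R p k = (a + b * \<alpha>) *\<^sub>R p i + (b * \<beta>) *\<^sub>R p j + (b * \<gamma>) *\<^sub>R p k"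
      using e c0 X(2) by auto
    from det3_unique[OF det_ear this] have u: "d = a + b * \<alpha>" "b * \<beta> = 0" "b * \<gamma> = 0" by simp_all
    have b0: "b = 0" using u pos by auto
    show "(a = 0 \<or> i = nx n m) \<and> (b = 0 \<or> m = nx n i) \<and> (c = 0 \<or> m = nx n i) \<and> (d = 0 \<or> i = nx n m)"
      using b0 c0 u X(2) by auto
  qed
  have jm: "meets_properly n r j m" if m: "m < n" "m \<noteq> i" "m \<noteq> j" for m
    unfolding meets_properly_def
  proof (intro allI impI)
    fix a b c d :: real assume abcd: "0 \<le> a" "0 \<le> b" "0 \<le> c" "0 \<le> d"
      and "a *\<^sub>R r j + b *\<^sub>R r (nx n j) = c *\<^sub>R r m + d *\<^sub>R r (nx n m)"
    then have e0: "c *\<^sub>R p m + d *\<^sub>R p (nx n m) = a *\<^sub>R q + b *\<^sub>R p k"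
      using m nxj[OF m(1)] by (simp add: ri rj ro k[symmetric])
    then have e: "c *\<^sub>R p m + d *\<^sub>R p (nx n m) = (a * \<alpha>) *\<^sub>R p i + (a * \<beta>) *\<^sub>R p j + (a * \<gamma> + b) *\<^sub>R p k"
      by (simp add: q algebra_simps)
    have nn': "0 \<le> a * \<alpha>" "0 \<le> a * \<beta>" "0 \<le> a * \<gamma> + b" using abcd nn by simp_all
    note X = edge_meets_ear[OF m abcd(3,4) nn' e]
    have d0: "d = 0"
    proof (rule ccontr)
      assume "d \<noteq> 0"
      then have mk: "nx n m = i" "c = 0" using X by auto
      then have "d *\<^sub>R p i + 0 *\<^sub>R p j + 0 *\<^sub>R p k = (a * \<alpha>) *\<^sub>R p i + (a * \<beta>) *\<^sub>R p j + (a * \<gamma> + b) *\<^sub>R p k"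
        using e by simp
      from det3_unique[OF det_ear this] have u: "d = a * \<alpha>" "a * \<beta> = 0" "a * \<gamma> + b = 0" by simp_all
      have "a \<noteq> 0" using u(1) \<open>d \<noteq> 0\<close> by auto
      moreover have "a * \<gamma> = 0" using u(3) abcd nn by (metis add_nonneg_eq_0_iff mult_nonneg_nonneg)
      ultimately show False using u(2) pos by auto
    qed
    have "0 *\<^sub>R p i + 0 *\<^sub>R p j + c *\<^sub>R p k = (a * \<alpha>) *\<^sub>R p i + (a * \<beta>) *\<^sub>R p j + (a * \<gamma> + b) *\<^sub>R p k"
      using e d0 X(1) by auto
    from det3_unique[OF det_ear this] have u: "a * \<alpha> = 0" "a * \<beta> = 0" "c = a * \<gamma> + b" by simp_all
    have a0: "a = 0" using u pos by auto
    show "(a = 0 \<or> j = nx n m) \<and> (b = 0 \<or> m = nx n j) \<and> (c = 0 \<or> m = nx n j) \<and> (d = 0 \<or> j = nx n m)"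
      using a0 d0 u X(1) by (auto simp: k)
  qed
  have ij: "meets_properly n r i j"
    unfolding meets_properly_def
  proof (intro allI impI)
    fix a b c d :: real assume abcd: "0 \<le> a" "0 \<le> b" "0 \<le> c" "0 \<le> d"
      and "a *\<^sub>R r i + b *\<^sub>R r (nx n i) = c *\<^sub>R r j + d *\<^sub>R r (nx n j)"
    then have e0: "a *\<^sub>R p i + b *\<^sub>R q = c *\<^sub>R q + d *\<^sub>R p k"
      by (simp add: ri rj j[symmetric] k[symmetric])
    then have e: "(a + b * \<alpha>) *\<^sub>R p i + (b * \<beta>) *\<^sub>R p j + (b * \<gamma>) *\<^sub>R p k
       = (c * \<alpha>) *\<^sub>R p i + (c * \<beta>) *\<^sub>R p j + (c * \<gamma> + d) *\<^sub>R p k"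
      by (simp add: q algebra_simps)
    from det3_unique[OF det_ear e]
    have u: "a + b * \<alpha> = c * \<alpha>" "b * \<beta> = c * \<beta>" "b * \<gamma> = c * \<gamma> + d" by simp_all
    have "b = c"
    proof (cases "0 < \<beta>")
      case False
      then have ag: "0 < \<alpha>" "0 < \<gamma>" using pos by auto
      have "b * \<alpha> \<le> c * \<alpha>" "c * \<gamma> \<le> b * \<gamma>" using u abcd by linarith+
      then show ?thesis using ag by (simp add: mult_le_cancel_right)
    qed (use u in auto)
    then show "(a = 0 \<or> i = nx n j) \<and> (b = 0 \<or> j = nx n i) \<and> (c = 0 \<or> j = nx n i) \<and> (d = 0 \<or> i = nx n j)"
      using u by (auto simp: j)
  qed
  have "meets_properly n r e f" if ef: "e < n" "f < n" "e \<noteq> f" for e f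
  proof -
    consider "e = i" "f = j" | "e = j" "f = i" | "e = i" "f \<noteq> i" "f \<noteq> j" | "e = j" "f \<noteq> i" "f \<noteq> j"
      | "f = i" "e \<noteq> i" "e \<noteq> j" | "f = j" "e \<noteq> i" "e \<noteq> j" | "e \<noteq> i" "e \<noteq> j" "f \<noteq> i" "f \<noteq> j"
      using ef by blast
    then show ?thesis
    proof cases
      case 1 then show ?thesis using ij by simp
    next
      case 2 then show ?thesis using meets_properly_sym[OF ij] by simp
    next
      case 3 then show ?thesis using im ef by simp
    next
      case 4 then show ?thesis using jm ef by simp
    next
      case 5 then show ?thesis using meets_properly_sym[OF im] ef by simp
    next
      case 6 then show ?thesis using meets_properly_sym[OF jm] ef by simp
    next
      case 7
      have "r e = p e" "r f = p f" "r (nx n e) = p (nx n e)" "r (nx n f) = p (nx n f)"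
        using 7 nxj ef by (auto simp: ro)
      then show ?thesis using proper[OF ef] unfolding meets_properly_def by simp
    qed
  qed
  then show ?thesis unfolding cone_polygon_def r_def[symmetric] using cross four by auto
qed

end

section \<open>Openness of the embedding condition\<close>

lemma cross3_eq_0_scaleR:
  assumes "cross3 x f = 0" "f \<noteq> 0"
  obtains l where "x = l *\<^sub>R f"
proof -
  have "(f \<bullet> f) *\<^sub>R x = (f \<bullet> x) *\<^sub>R f" using Lagrange[of f x f] assms(1) by simp
  then have "x = ((f \<bullet> x) / (f \<bullet> f)) *\<^sub>R f"
    using assms(2) by (metis (no_types, lifting) divide_inverse_commute inner_eq_zero_iff right_inverse scaleR_one scaleR_scaleR mult.commute)
  then show thesis using that by blast
qed

text \<open>Adjacent sectors overlap exactly if one is folded back onto the other, that is, if their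
  normals are opposite. By the equality case of Cauchy-Schwarz this is the vanishing of the
  right-hand expression, so proper meeting becomes an open condition.\<close>

lemma meets_properly_adjacent_iff:
  assumes e: "e < n" "3 \<le> n" and f: "f = nx n e"
    and u: "u = cross3 (p e) (p f)" "u \<noteq> 0" and v: "v = cross3 (p f) (p (nx n f))" "v \<noteq> 0"
  shows "meets_properly n p e f \<longleftrightarrow> 0 < norm u * norm v + u \<bullet> v"
proof
  assume "0 < norm u * norm v + u \<bullet> v"
  show "meets_properly n p e f"
    unfolding meets_properly_def
  proof (intro allI impI)
    fix a b c d :: real assume abcd: "0 \<le> a" "0 \<le> b" "0 \<le> c" "0 \<le> d"
      and "a *\<^sub>R p e + b *\<^sub>R p (nx n e) = c *\<^sub>R p f + d *\<^sub>R p (nx n f)"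
    then have "cross3 (a *\<^sub>R p e + b *\<^sub>R p f) (p f) = cross3 (c *\<^sub>R p f + d *\<^sub>R p (nx n f)) (p f)"
      by (simp add: f)
    then have "a *\<^sub>R u = d *\<^sub>R cross3 (p (nx n f)) (p f)"
      by (simp add: cross_add_left cross_mult_left u)
    then have uv: "a *\<^sub>R u = - (d *\<^sub>R v)" by (subst (asm) cross_skew) (simp add: v)
    have "a = 0"
    proof (rule ccontr)
      assume "a \<noteq> 0"
      then have a: "0 < a" using abcd by simp
      have n: "a * norm u = d * norm v" using arg_cong[OF uv, of norm] abcd by simp
      have i: "a * (u \<bullet> v) = - (d * (norm v * norm v))" using arg_cong[OF uv, of "\<lambda>x. x \<bullet> v"]
        by (simp add: power2_norm_eq_inner[symmetric] power2_eq_square)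
      have "a * (norm u * norm v + u \<bullet> v) = (a * norm u) * norm v + a * (u \<bullet> v)" by (simp add: algebra_simps)
      also have "\<dots> = 0" unfolding n i by simp
      finally show False using a \<open>0 < norm u * norm v + u \<bullet> v\<close> by simp
    qed
    moreover have "d = 0" using uv \<open>a = 0\<close> v by simp
    ultimately show "(a = 0 \<or> e = nx n f) \<and> (b = 0 \<or> f = nx n e) \<and> (c = 0 \<or> f = nx n e) \<and> (d = 0 \<or> e = nx n f)"
      using f by simp
  qed
next
  assume m: "meets_properly n p e f"
  have "\<bar>u \<bullet> v\<bar> \<le> norm u * norm v" by (rule Cauchy_Schwarz_ineq2)
  moreover have "norm u * norm v + u \<bullet> v \<noteq> 0"
  proof
    assume "norm u * norm v + u \<bullet> v = 0"
    then have "u \<bullet> (- v) = norm u * norm (- v)" by simp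
    then have "norm u *\<^sub>R (- v) = norm v *\<^sub>R u" unfolding norm_cauchy_schwarz_eq by simp
    then have "norm v *\<^sub>R u + norm u *\<^sub>R v = - (norm u *\<^sub>R v) + norm u *\<^sub>R v" by simp
    then have "norm v *\<^sub>R u + norm u *\<^sub>R v = 0" by simp
    moreover have "v = - cross3 (p (nx n f)) (p f)" unfolding v by (rule cross_skew)
    ultimately have "cross3 (norm v *\<^sub>R p e - norm u *\<^sub>R p (nx n f)) (p f) = 0"
      by (simp add: u(1) Cross3.left_diff_distrib cross_mult_left)
    moreover have "p f \<noteq> 0" using u by auto
    ultimately obtain l where l: "norm v *\<^sub>R p e - norm u *\<^sub>R p (nx n f) = l *\<^sub>R p f"
      by (rule cross3_eq_0_scaleR)
    \<comment> \<open>The two \<open>max\<close> terms place the multiple of \<open>p f\<close> on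
      the side of the equation where its coefficient is nonnegative.\<close>
    have eq: "norm v *\<^sub>R p e + max 0 (- l) *\<^sub>R p (nx n e) = max 0 l *\<^sub>R p f + norm u *\<^sub>R p (nx n f)"
      using l unfolding f[symmetric] by (cases "0 \<le> l") (auto simp: algebra_simps)
    from meets_properlyD(1)[OF m _ _ _ _ eq] v e f show False by simp
  qed
  ultimately show "0 < norm u * norm v + u \<bullet> v" by linarith
qed

lemma in_convex_hull_4:
  fixes p :: "'a::real_vector"
  assumes "x \<in> convex hull {p, q, r, s}"
  obtains a b c d where "0 \<le> a" "0 \<le> b" "0 \<le> c" "0 \<le> d" "a + b + c + d = 1"
    "x = a *\<^sub>R p + b *\<^sub>R q + c *\<^sub>R r + d *\<^sub>R s"
proof -
  from assms obtain u v y where uv: "0 \<le> u" "0 \<le> v" "u + v = 1" "x = u *\<^sub>R p + v *\<^sub>R y"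
    and y: "y \<in> convex hull {q, r, s}" by (subst (asm) convex_hull_insert) auto
  from y obtain b c d where "0 \<le> b" "0 \<le> c" "0 \<le> d" "b + c + d = 1" "y = b *\<^sub>R q + c *\<^sub>R r + d *\<^sub>R s"
    unfolding convex_hull_3 by blast
  moreover from this have "u + v * b + v * c + v * d = 1" using uv(3) by (metis add.assoc distrib_left mult.right_neutral)
  ultimately show thesis using uv by (intro that[of u "v * b" "v * c" "v * d"]) (auto simp: algebra_simps)
qed

text \<open>Proper meeting says that \<open>0\<close> is not in the convex hull of the four vectors
  with those of \<open>f\<close> negated. A hyperplane separating \<open>0\<close> from this compact
  set strictly separates the two cones, again an open condition.\<close>

lemma meets_properly_apart_iff:
  assumes ef: "e \<noteq> nx n f" "f \<noteq> nx n e"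
  shows "meets_properly n p e f \<longleftrightarrow>
    (\<exists>y. 0 < y \<bullet> p e \<and> 0 < y \<bullet> p (nx n e) \<and> y \<bullet> p f < 0 \<and> y \<bullet> p (nx n f) < 0)"
proof
  assume m: "meets_properly n p e f"
  let ?K = "convex hull {p e, p (nx n e), - p f, - p (nx n f)}"
  have "0 \<notin> ?K"
  proof
    assume "0 \<in> ?K"
    then obtain a b c d where abcd: "0 \<le> a" "0 \<le> b" "0 \<le> c" "0 \<le> d" "a + b + c + d = 1"
      "0 = a *\<^sub>R p e + b *\<^sub>R p (nx n e) + c *\<^sub>R (- p f) + d *\<^sub>R (- p (nx n f))"
      by (rule in_convex_hull_4)
    then have "a *\<^sub>R p e + b *\<^sub>R p (nx n e) = c *\<^sub>R p f + d *\<^sub>R p (nx n f)" by (simp add: algebra_simps)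
    from meets_properlyD[OF m abcd(1-4) this] ef abcd(5) show False by simp
  qed
  moreover have "closed ?K" by (intro compact_imp_closed finite_imp_compact_convex_hull) simp
  ultimately obtain y b where y: "0 < b" "\<forall>x\<in>?K. b < y \<bullet> x"
    using separating_hyperplane_closed_0[OF convex_convex_hull] by blast
  have "p e \<in> ?K" "p (nx n e) \<in> ?K" "- p f \<in> ?K" "- p (nx n f) \<in> ?K" by (simp_all add: hull_inc)
  with y have "b < y \<bullet> p e" "b < y \<bullet> p (nx n e)" "b < y \<bullet> (- p f)" "b < y \<bullet> (- p (nx n f))" by blast+
  with y(1) show "\<exists>y. 0 < y \<bullet> p e \<and> 0 < y \<bullet> p (nx n e) \<and> y \<bullet> p f < 0 \<and> y \<bullet> p (nx n f) < 0"
    by (intro exI[of _ y]) auto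
next
  assume "\<exists>y. 0 < y \<bullet> p e \<and> 0 < y \<bullet> p (nx n e) \<and> y \<bullet> p f < 0 \<and> y \<bullet> p (nx n f) < 0"
  then obtain y where y: "0 < y \<bullet> p e" "0 < y \<bullet> p (nx n e)" "y \<bullet> p f < 0" "y \<bullet> p (nx n f) < 0"
    by (elim exE conjE)
  show "meets_properly n p e f"
    unfolding meets_properly_def
  proof (intro allI impI)
    fix a b c d :: real assume abcd: "0 \<le> a" "0 \<le> b" "0 \<le> c" "0 \<le> d"
      and z: "a *\<^sub>R p e + b *\<^sub>R p (nx n e) = c *\<^sub>R p f + d *\<^sub>R p (nx n f)"
    have eq: "a * (y \<bullet> p e) + b * (y \<bullet> p (nx n e)) = c * (y \<bullet> p f) + d * (y \<bullet> p (nx n f))"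
      using arg_cong[OF z, of "\<lambda>x. y \<bullet> x"] by (simp only: inner_add_right inner_scaleR_right)
    have "0 \<le> a * (y \<bullet> p e)" "0 \<le> b * (y \<bullet> p (nx n e))" "c * (y \<bullet> p f) \<le> 0" "d * (y \<bullet> p (nx n f)) \<le> 0"
      using abcd y by (auto intro: mult_nonneg_nonneg mult_nonneg_nonpos)
    with eq have "a * (y \<bullet> p e) = 0" "b * (y \<bullet> p (nx n e)) = 0" "c * (y \<bullet> p f) = 0" "d * (y \<bullet> p (nx n f)) = 0"
      by linarith+
    with y show "(a = 0 \<or> e = nx n f) \<and> (b = 0 \<or> f = nx n e) \<and> (c = 0 \<or> f = nx n e) \<and> (d = 0 \<or> e = nx n f)"
      by auto
  qed
qed

lemma tendsto_cross3:
  assumes "(f \<longlongrightarrow> a) F" "(g \<longlongrightarrow> b) F"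
  shows "((\<lambda>x. cross3 (f x) (g x)) \<longlongrightarrow> cross3 a b) F"
proof -
  have "isCont (\<lambda>x :: (real^3) \<times> (real^3). cross3 (fst x) (snd x)) (a, b)"
    by (intro continuous_cross continuous_intros)
  from isCont_tendsto_compose[OF this tendsto_Pair[OF assms]] show ?thesis by simp
qed

text \<open>By the two criteria above, with the separating vectors of the limit kept fixed,
  embeddedness follows from finitely many strict inequalities between continuous
  expressions.\<close>

lemma cone_polygon_eventually:
  assumes "cone_polygon n p" and lim: "\<And>i. i < n \<Longrightarrow> ((\<lambda>s. P s i) \<longlongrightarrow> p i) F"
  shows "\<forall>\<^sub>F s in F. cone_polygon n (P s)"
proof -
  have n: "3 \<le> n" and cr: "\<And>i. i < n \<Longrightarrow> cross3 (p i) (p (nx n i)) \<noteq> 0"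
    and mp: "\<And>e f. e < n \<Longrightarrow> f < n \<Longrightarrow> e \<noteq> f \<Longrightarrow> meets_properly n p e f"
    using assms(1) unfolding cone_polygon_def by blast+
  have lx: "((\<lambda>s. cross3 (P s i) (P s (nx n i))) \<longlongrightarrow> cross3 (p i) (p (nx n i))) F" if "i < n" for i
    using that by (intro tendsto_cross3 lim) auto
  have E1: "\<forall>\<^sub>F s in F. \<forall>i\<in>{..<n}. cross3 (P s i) (P s (nx n i)) \<noteq> 0"
    by (rule eventually_ball_finite) (use tendsto_imp_eventually_ne[OF lx cr] in auto)
  have adj: "\<forall>\<^sub>F s in F. meets_properly n (P s) e (nx n e)" if e: "e < n" for e
  proof -
    let ?f = "nx n e"
    define U V where "U s = cross3 (P s e) (P s ?f)" and "V s = cross3 (P s ?f) (P s (nx n ?f))" for s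
    define u v where "u = cross3 (p e) (p ?f)" and "v = cross3 (p ?f) (p (nx n ?f))"
    have uv: "u \<noteq> 0" "v \<noteq> 0" using cr e by (auto simp: u_def v_def)
    have "0 < norm u * norm v + u \<bullet> v"
      using meets_properly_adjacent_iff[OF e n refl u_def uv(1) v_def uv(2)] mp[OF e _] e n by simp
    moreover have "((\<lambda>s. norm (U s) * norm (V s) + U s \<bullet> V s) \<longlongrightarrow> norm u * norm v + u \<bullet> v) F"
      unfolding U_def V_def u_def v_def using e by (intro tendsto_intros lx) auto
    ultimately have "\<forall>\<^sub>F s in F. 0 < norm (U s) * norm (V s) + U s \<bullet> V s"
      by (rule order_tendstoD(1)[rotated])
    with E1 show ?thesis
    proof eventually_elim
      case (elim s)
      have "U s \<noteq> 0" "V s \<noteq> 0" using elim(1) e by (auto simp: U_def V_def)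
      from meets_properly_adjacent_iff[OF e n refl U_def this(1) V_def this(2)] elim(2) show ?case by blast
    qed
  qed
  have "\<forall>\<^sub>F s in F. meets_properly n (P s) e f" if ef: "e < n" "f < n" "e \<noteq> f" for e f
  proof -
    consider "f = nx n e" | "e = nx n f" | "e \<noteq> nx n f" "f \<noteq> nx n e" by blast
    then show ?thesis
    proof cases
      case 1
      then show ?thesis using adj[OF ef(1)] by simp
    next
      case 2
      with adj[OF ef(2)] have "\<forall>\<^sub>F s in F. meets_properly n (P s) f e" by simp
      then show ?thesis by eventually_elim (rule meets_properly_sym)
    next
      case 3
      from mp[OF ef, unfolded meets_properly_apart_iff[OF 3]] obtain y where y: "0 < y \<bullet> p e" "0 < y \<bullet> p (nx n e)" "y \<bullet> p f < 0" "y \<bullet> p (nx n f) < 0"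
        by (elim exE conjE)
      have l: "((\<lambda>s. y \<bullet> P s i) \<longlongrightarrow> y \<bullet> p i) F" if "i < n" for i using that by (intro tendsto_intros lim)
      have "\<forall>\<^sub>F s in F. 0 < y \<bullet> P s e" "\<forall>\<^sub>F s in F. 0 < y \<bullet> P s (nx n e)"
        "\<forall>\<^sub>F s in F. y \<bullet> P s f < 0" "\<forall>\<^sub>F s in F. y \<bullet> P s (nx n f) < 0"
        using y ef by (auto intro!: order_tendstoD[OF l])
      then show ?thesis
        by eventually_elim (unfold meets_properly_apart_iff[OF 3], intro exI[of _ y] conjI)
    qed
  qed
  then have "\<forall>\<^sub>F s in F. \<forall>e\<in>{..<n}. \<forall>f\<in>{..<n}. e \<noteq> f \<longrightarrow> meets_properly n (P s) e f"
    by (intro eventually_ball_finite ballI) (auto intro: eventually_mono)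
  with E1 show ?thesis
    by eventually_elim (use n in \<open>auto simp: cone_polygon_def\<close>)
qed

section \<open>Isotopies of cone polygons\<close>

text \<open>Points of the moment curve; any three of them with different parameters are independent,
  by the Vandermonde determinant.\<close>

definition moment :: "nat \<Rightarrow> real^3" where
  "moment i = vector [1, real i, (real i)\<^sup>2]"

lemma det3_moment:
  "det3 (moment i) (moment j) (moment k) = (real j - real i) * (real k - real i) * (real k - real j)"
  by (simp add: det3_def cross3_def inner_vec_def sum_3 moment_def power2_eq_square algebra_simps)

text \<open>Each triple product is a polynomial of degree three in \<open>s\<close> with a
  Vandermonde determinant as leading coefficient, so it has finitely many zeros, however degenerate
  \<open>p\<close> is.\<close>

lemma eventually_generic_points:
  assumes "3 \<le> n"
  shows "\<forall>\<^sub>F s in at_right 0. generic_points n (\<lambda>i. p i + s *\<^sub>R moment i)"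
proof -
  have "\<forall>\<^sub>F s in at_right 0. det3 (p i + s *\<^sub>R moment i) (p j + s *\<^sub>R moment j) (p k + s *\<^sub>R moment k) \<noteq> 0"
    if "i \<noteq> j" "i \<noteq> k" "j \<noteq> k" for i j k
  proof -
    let ?m = "moment"
    define f where "f = [:det3 (p i) (p j) (p k),
      det3 (?m i) (p j) (p k) + det3 (p i) (?m j) (p k) + det3 (p i) (p j) (?m k),
      det3 (p i) (?m j) (?m k) + det3 (?m i) (p j) (?m k) + det3 (?m i) (?m j) (p k),
      det3 (?m i) (?m j) (?m k):]"
    have f: "poly f s = det3 (p i + s *\<^sub>R ?m i) (p j + s *\<^sub>R ?m j) (p k + s *\<^sub>R ?m k)" for s
      by (simp add: f_def algebra_simps)
    have "det3 (?m i) (?m j) (?m k) \<noteq> 0" using that by (simp add: det3_moment)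
    then have "f \<noteq> 0" by (simp add: f_def)
    then have "finite {s. poly f s = 0}" by (rule poly_roots_finite)
    then have "\<not> 0 islimpt {s. poly f s = 0}" by (rule islimpt_finite)
    then have "\<forall>\<^sub>F s in at 0. poly f s \<noteq> 0" unfolding islimpt_iff_eventually by simp
    then have "\<forall>\<^sub>F s in at_right 0. poly f s \<noteq> 0" by (rule filter_leD[OF at_le, rotated]) simp
    then show ?thesis unfolding f .
  qed
  then have "\<forall>\<^sub>F s in at_right 0. \<forall>i\<in>{..<n}. \<forall>j\<in>{..<n}. \<forall>k\<in>{..<n}. i \<noteq> j \<longrightarrow> i \<noteq> k \<longrightarrow> j \<noteq> k \<longrightarrow>
     det3 (p i + s *\<^sub>R moment i) (p j + s *\<^sub>R moment j) (p k + s *\<^sub>R moment k) \<noteq> 0"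
    by (intro eventually_ball_finite ballI finite_lessThan) (auto intro: eventually_mono)
  then show ?thesis
    by eventually_elim (use assms in \<open>auto simp: generic_points_def\<close>)
qed

text \<open>Paths run in the product topology on functions from \<open>nat\<close>; the values at
  indices from \<open>n\<close> on are unconstrained.\<close>

abbreviation isotopic :: "nat \<Rightarrow> (nat \<Rightarrow> real^3) \<Rightarrow> (nat \<Rightarrow> real^3) \<Rightarrow> bool" where
  "isotopic n \<equiv> path_component (Collect (cone_polygon n))"

lemma isotopicI:
  assumes "\<And>i. continuous_on {0..1} (\<lambda>t::real. P t i)" "\<And>t. 0 \<le> t \<Longrightarrow> t \<le> 1 \<Longrightarrow> cone_polygon n (P t)"
  shows "isotopic n (P 0) (P 1)"
  unfolding path_component_def
proof (intro exI conjI)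
  show "path P" unfolding path_def by (intro continuous_on_coordinatewise_then_product assms(1))
  show "path_image P \<subseteq> Collect (cone_polygon n)" using assms(2) by (auto simp: path_image_def)
qed (simp_all add: pathstart_def pathfinish_def)

lemma isotopic_image:
  assumes "isotopic n p q" "continuous_on UNIV h" "\<And>p. cone_polygon n p \<Longrightarrow> cone_polygon m (h p)"
  shows "isotopic m (h p) (h q)"
proof -
  from assms(1) obtain g where g: "path g" "path_image g \<subseteq> Collect (cone_polygon n)"
    "pathstart g = p" "pathfinish g = q" unfolding path_component_def by blast
  have "path (h \<circ> g)" using g(1) continuous_on_subset[OF assms(2)] by (intro path_continuous_image) auto
  moreover have "path_image (h \<circ> g) \<subseteq> Collect (cone_polygon m)"
    using g(2) assms(3) by (auto simp: path_image_compose)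
  moreover have "pathstart (h \<circ> g) = h p" "pathfinish (h \<circ> g) = h q"
    using g(3,4) by (simp_all add: pathstart_compose pathfinish_compose)
  ultimately show ?thesis unfolding path_component_def by blast
qed

lemma cone_polygon_cong:
  assumes "cone_polygon n p" "\<And>i. i < n \<Longrightarrow> p i = q i"
  shows "cone_polygon n q"
  using assms unfolding cone_polygon_def meets_properly_def by simp

lemma isotopic_cong:
  assumes "cone_polygon n p" "\<And>i. i < n \<Longrightarrow> p i = q i"
  shows "isotopic n p q"
proof -
  let ?P = "\<lambda>t i. (1 - t) *\<^sub>R p i + t *\<^sub>R q i"
  have "isotopic n (?P 0) (?P 1)"
  proof (rule isotopicI)
    show "continuous_on {0..1} (\<lambda>t::real. (1 - t) *\<^sub>R p i + t *\<^sub>R q i)" for i by (intro continuous_intros)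
    show "cone_polygon n (?P t)" for t
      by (rule cone_polygon_cong[OF assms(1)]) (simp add: assms(2) algebra_simps)
  qed
  then show ?thesis by simp
qed

text \<open>The set \<open>X\<close> collects directions whose sign at every vertex must survive the
  perturbation, so that the excess in these directions can be carried along.\<close>

lemma isotopic_generic:
  assumes "cone_polygon n p" and fin: "finite X" and X: "\<And>x i. x \<in> X \<Longrightarrow> i < n \<Longrightarrow> x \<bullet> p i \<noteq> 0"
  obtains P where "P 0 = p" "\<And>i. continuous_on {0..1} (\<lambda>t::real. P t i)"
    "\<And>t. 0 \<le> t \<Longrightarrow> t \<le> 1 \<Longrightarrow> cone_polygon n (P t)" "generic_points n (P 1)"
    "\<And>t x i. 0 \<le> t \<Longrightarrow> t \<le> 1 \<Longrightarrow> x \<in> X \<Longrightarrow> i < n \<Longrightarrow> 0 < (x \<bullet> P t i) * (x \<bullet> p i)"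
proof -
  let ?Q = "\<lambda>s i. p i + s *\<^sub>R moment i"
  have lim: "((\<lambda>s. ?Q s i) \<longlongrightarrow> p i) (at_right 0)" for i
    by (rule tendsto_eq_intros refl | simp)+
  have n: "3 \<le> n" using assms(1) by (simp add: cone_polygon_def)
  have "\<forall>\<^sub>F s in at_right 0. 0 < (x \<bullet> ?Q s i) * (x \<bullet> p i)" if "x \<in> X" "i < n" for x i
  proof (rule order_tendstoD(1))
    show "((\<lambda>s. (x \<bullet> ?Q s i) * (x \<bullet> p i)) \<longlongrightarrow> (x \<bullet> p i) * (x \<bullet> p i)) (at_right 0)"
      by (intro tendsto_intros lim)
    show "0 < (x \<bullet> p i) * (x \<bullet> p i)" using X[OF that] by (auto simp: zero_less_mult_iff linorder_neq_iff)
  qed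
  then have "\<forall>\<^sub>F s in at_right 0. \<forall>x\<in>X. \<forall>i\<in>{..<n}. 0 < (x \<bullet> ?Q s i) * (x \<bullet> p i)"
    by (intro eventually_ball_finite ballI fin finite_lessThan) auto
  moreover have "\<forall>\<^sub>F s in at_right 0. cone_polygon n (?Q s)"
    by (rule cone_polygon_eventually[OF assms(1) lim])
  moreover note eventually_generic_points[OF n, of p]
  ultimately have "\<forall>\<^sub>F s in at_right 0. (\<forall>x\<in>X. \<forall>i\<in>{..<n}. 0 < (x \<bullet> ?Q s i) * (x \<bullet> p i)) \<and>
     cone_polygon n (?Q s) \<and> generic_points n (?Q s)" by eventually_elim blast
  then obtain b where b: "0 < b" and Q: "\<And>s. 0 < s \<Longrightarrow> s < b \<Longrightarrow> (\<forall>x\<in>X. \<forall>i\<in>{..<n}. 0 < (x \<bullet> ?Q s i) * (x \<bullet> p i)) \<and>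
     cone_polygon n (?Q s) \<and> generic_points n (?Q s)"
    unfolding eventually_at_right_field by blast
  \<comment> \<open>Time \<open>0\<close> is the given polygon, and every positive time up to
    \<open>1\<close> is sent strictly between \<open>0\<close> and \<open>b\<close>, where all the
    conditions hold.\<close>
  define P where "P t = ?Q (t * (b / 2))" for t :: real
  have pos: "0 < t * (b / 2)" "t * (b / 2) < b" if "0 < t" "t \<le> 1" for t
  proof -
    show "0 < t * (b / 2)" using b that by simp
    have "t * (b / 2) \<le> 1 * (b / 2)" using b that by (intro mult_right_mono) auto
    then show "t * (b / 2) < b" using b by simp
  qed
  show thesis
  proof (rule that[of P])
    show P0: "P 0 = p" by (simp add: P_def)
    show "continuous_on {0..1} (\<lambda>t::real. P t i)" for i unfolding P_def by (intro continuous_intros)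
    show "generic_points n (P 1)" using Q[OF pos, of 1] unfolding P_def by simp
    show "cone_polygon n (P t)" if "0 \<le> t" "t \<le> 1" for t
    proof (cases "t = 0")
      case False
      then show ?thesis using Q[OF pos, of t] that unfolding P_def by simp
    qed (use P0 assms(1) in simp)
    show "0 < (x \<bullet> P t i) * (x \<bullet> p i)" if "0 \<le> t" "t \<le> 1" "x \<in> X" "i < n" for t x i
    proof (cases "t = 0")
      case False
      then show ?thesis using Q[OF pos, of t] that unfolding P_def by simp
    next
      case True
      then show ?thesis using P0 X[OF that(3,4)] by (auto simp: zero_less_mult_iff linorder_neq_iff)
    qed
  qed
qed

text \<open>In a flat polygon, the cones form one turn around the origin of the plane \<open>N\<^sup>\<bottom>\<close>.\<close>

definition flat_polygon :: "nat \<Rightarrow> (nat \<Rightarrow> real^3) \<Rightarrow> bool" where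
  "flat_polygon n p \<longleftrightarrow> cone_polygon n p \<and>
    (\<exists>N. N \<noteq> 0 \<and> (\<forall>i<n. \<exists>c>0. cross3 (p i) (p (nx n i)) = c *\<^sub>R N) \<and>
      (\<forall>x. N \<bullet> x = 0 \<longrightarrow> (\<exists>i<n. \<exists>a\<ge>0. \<exists>b\<ge>0. x = a *\<^sub>R p i + b *\<^sub>R p (nx n i)))) \<and>
    (\<forall>\<xi>. (\<forall>i<n. \<xi> \<bullet> p i \<noteq> 0) \<longrightarrow> card {i. i < n \<and> \<xi> \<bullet> p i < 0 \<and> 0 < \<xi> \<bullet> p (nx n i)} = 1)"

section \<open>Rotating the indices, and inserting or deleting a vertex on an edge\<close>

lemma nx_rotate: "0 < n \<Longrightarrow> nx n ((i + r) mod n) = (nx n i + r) mod n"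
  by (simp add: nx_def mod_simps)

lemma rotate_inj: "i < n \<Longrightarrow> j < n \<Longrightarrow> (i + r) mod n = (j + r) mod (n::nat) \<longleftrightarrow> i = j"
proof
  assume "i < n" "j < n" "(i + r) mod n = (j + r) mod n"
  \<comment> \<open>Adding \<open>(n - 1) * r\<close> completes the shift to a multiple of
    \<open>n\<close>.\<close>
  then have "(i + r + (n - 1) * r) mod n = (j + r + (n - 1) * r) mod n" by (metis mod_add_left_eq)
  moreover have "r + (n - 1) * r = n * r" using \<open>i < n\<close> by (cases n) simp_all
  ultimately show "i = j" using \<open>i < n\<close> \<open>j < n\<close> by (simp add: add.assoc)
qed auto

lemma rotate_surj: "k < n \<Longrightarrow> \<exists>i<n. (i + r) mod n = (k::nat)"
proof -
  assume "k < n"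
  have "(\<lambda>i. (i + r) mod n) ` {..<n} = {..<n}"
  proof (rule endo_inj_surj)
    show "(\<lambda>i. (i + r) mod n) ` {..<n} \<subseteq> {..<n}" using \<open>k < n\<close> by (simp add: image_subset_iff)
    show "inj_on (\<lambda>i. (i + r) mod n) {..<n}" by (intro inj_onI) (simp only: lessThan_iff rotate_inj)
  qed simp
  then have "k \<in> (\<lambda>i. (i + r) mod n) ` {..<n}" using \<open>k < n\<close> by simp
  then show ?thesis by (elim imageE) auto
qed

lemma cone_polygon_rotate:
  assumes "cone_polygon n p"
  shows "cone_polygon n (\<lambda>i. p ((i + r) mod n))"
proof -
  have n: "3 \<le> n" "0 < n" using assms by (auto simp: cone_polygon_def)
  have "meets_properly n (\<lambda>i. p ((i + r) mod n)) e f" if ef: "e < n" "f < n" "e \<noteq> f" for e f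
  proof -
    have "meets_properly n p ((e + r) mod n) ((f + r) mod n)"
      using assms ef n unfolding cone_polygon_def by (simp add: rotate_inj)
    then show ?thesis
      unfolding meets_properly_def nx_rotate[OF n(2)]
      using rotate_inj[of e n "nx n f"] rotate_inj[of f n "nx n e"] ef by simp
  qed
  moreover have "cross3 (p ((i + r) mod n)) (p ((nx n i + r) mod n)) \<noteq> 0" if "i < n" for i
    using assms n unfolding cone_polygon_def nx_rotate[OF n(2), symmetric] by simp
  ultimately show ?thesis using n by (simp add: cone_polygon_def)
qed

lemma isotopic_rotate:
  assumes "isotopic n p q"
  shows "isotopic n (\<lambda>i. p ((i + r) mod n)) (\<lambda>i. q ((i + r) mod n))"
  by (rule isotopic_image[OF assms _ cone_polygon_rotate])
    (intro continuous_on_coordinatewise_then_product continuous_on_product_coordinates)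

lemma flat_polygon_rotate:
  assumes "flat_polygon n p"
  shows "flat_polygon n (\<lambda>i. p ((i + r) mod n))"
proof -
  have cp: "cone_polygon n p" using assms by (simp add: flat_polygon_def)
  then have n: "0 < n" by (simp add: cone_polygon_def)
  from assms obtain N where N: "N \<noteq> 0" "\<And>i. i < n \<Longrightarrow> \<exists>c>0. cross3 (p i) (p (nx n i)) = c *\<^sub>R N"
    "\<And>x. N \<bullet> x = 0 \<Longrightarrow> \<exists>i<n. \<exists>a\<ge>0. \<exists>b\<ge>0. x = a *\<^sub>R p i + b *\<^sub>R p (nx n i)"
    unfolding flat_polygon_def by blast
  have "\<exists>i<n. \<exists>a\<ge>0. \<exists>b\<ge>0. x = a *\<^sub>R p ((i + r) mod n) + b *\<^sub>R p ((nx n i + r) mod n)" if x: "N \<bullet> x = 0" for x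
  proof -
    from N(3)[OF x] obtain k where k: "k < n" "\<exists>a\<ge>0. \<exists>b\<ge>0. x = a *\<^sub>R p k + b *\<^sub>R p (nx n k)" by blast
    obtain i where "i < n" "(i + r) mod n = k" using rotate_surj[OF k(1)] by blast
    then show ?thesis using k nx_rotate[OF n, of i r] by (intro exI[of _ i]) simp
  qed
  moreover have "\<exists>c>0. cross3 (p ((i + r) mod n)) (p ((nx n i + r) mod n)) = c *\<^sub>R N" for i
    using N(2)[of "(i + r) mod n"] n nx_rotate[OF n, of i r] by simp
  moreover have "card {i. i < n \<and> \<xi> \<bullet> p ((i + r) mod n) < 0 \<and> 0 < \<xi> \<bullet> p ((nx n i + r) mod n)} = 1"
    if \<xi>: "\<forall>i<n. \<xi> \<bullet> p ((i + r) mod n) \<noteq> 0" for \<xi>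
  proof -
    let ?A = "{i. i < n \<and> \<xi> \<bullet> p ((i + r) mod n) < 0 \<and> 0 < \<xi> \<bullet> p ((nx n i + r) mod n)}"
    let ?B = "{i. i < n \<and> \<xi> \<bullet> p i < 0 \<and> 0 < \<xi> \<bullet> p (nx n i)}"
    have "(\<lambda>i. (i + r) mod n) ` ?A = ?B"
    proof (intro set_eqI iffI)
      fix k assume "k \<in> (\<lambda>i. (i + r) mod n) ` ?A"
      then obtain i where "i \<in> ?A" "k = (i + r) mod n" by (elim imageE)
      then show "k \<in> ?B" using n by (simp add: nx_rotate[OF n])
    next
      fix k assume k: "k \<in> ?B"
      obtain i where "i < n" "(i + r) mod n = k" using rotate_surj[of k n r] k by blast
      then show "k \<in> (\<lambda>i. (i + r) mod n) ` ?A"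
        using k by (intro image_eqI[of _ _ i]) (simp_all add: nx_rotate[OF n, symmetric])
    qed
    moreover have "inj_on (\<lambda>i. (i + r) mod n) ?A"
      by (intro inj_onI) (simp only: mem_Collect_eq rotate_inj)
    ultimately have "card ?A = card ?B" using card_image[of "\<lambda>i. (i + r) mod n" ?A] by simp
    moreover have "\<xi> \<bullet> p i \<noteq> 0" if "i < n" for i
      using \<xi> rotate_surj[OF that, of r] by (elim exE conjE) auto
    ultimately show ?thesis using assms unfolding flat_polygon_def by simp
  qed
  ultimately show ?thesis
    unfolding flat_polygon_def using cone_polygon_rotate[OF cp] N(1) by blast
qed

text \<open>The new vertex lies inside the edge from the last vertex to the first. As a sum it
  depends continuously on the polygon, so an isotopy of the smaller polygon lifts to the larger
  one.\<close>

definition subdivide_last :: "nat \<Rightarrow> (nat \<Rightarrow> real^3) \<Rightarrow> nat \<Rightarrow> real^3" where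
  "subdivide_last N p = p(N := p (N - 1) + p 0)"

lemma cross3_nonzero_independent:
  assumes "cross3 x y \<noteq> 0" "a *\<^sub>R x + b *\<^sub>R y = c *\<^sub>R x + d *\<^sub>R y"
  shows "a = c" "b = d"
proof -
  from arg_cong[OF assms(2), of "\<lambda>v. cross3 v y"] have "a *\<^sub>R cross3 x y = c *\<^sub>R cross3 x y"
    by (simp add: cross_add_left cross_mult_left)
  then show "a = c" using assms(1) by simp
  from arg_cong[OF assms(2), of "\<lambda>v. cross3 x v"] have "b *\<^sub>R cross3 x y = d *\<^sub>R cross3 x y"
    by (simp add: cross_add_right cross_mult_right)
  then show "b = d" using assms(1) by simp
qed

text \<open>Regrouping coefficients, a point of either half is a point of the old edge, for which
  proper meeting is known. It remains to see that a half does not touch the neighbouring edge at the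
  far end of the old edge.\<close>

lemma cone_polygon_subdivide_last:
  assumes "cone_polygon N p"
  shows "cone_polygon (Suc N) (subdivide_last N p)"
proof -
  define L where "L = N - 1"
  define r where "r = subdivide_last N p"
  have N0: "3 \<le> N" and cr: "\<And>i. i < N \<Longrightarrow> cross3 (p i) (p (nx N i)) \<noteq> 0"
    and mp: "\<And>e f. e < N \<Longrightarrow> f < N \<Longrightarrow> e \<noteq> f \<Longrightarrow> meets_properly N p e f"
    using assms unfolding cone_polygon_def by blast+
  have N: "3 \<le> N" "L < N" "2 \<le> L" using N0 by (simp_all add: L_def)
  have lt [simp]: "e < N" "Suc e < N" if "e < L" for e using that L_def by linarith+
  define x y where "x = p L" and "y = p 0"
  have r: "r i = p i" if "i < N" for i using that by (simp add: r_def subdivide_last_def)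
  have rN: "r N = x + y" by (simp add: r_def subdivide_last_def x_def y_def L_def)
  have rxy: "r L = x" "r 0 = y" using N by (simp_all add: r x_def y_def)
  have nxs: "nx (Suc N) e = Suc e" "nx N e = Suc e" if "e < L" for e using that by (simp_all add: nx_def L_def)
  have nxl: "nx (Suc N) L = N" "nx (Suc N) N = 0" "nx N L = 0" using N by (simp_all add: nx_def L_def)
  have xy: "cross3 x y \<noteq> 0" using cr[of "L"] N by (simp add: nxl x_def y_def)
  have nz: "p i \<noteq> 0" if "i < N" for i using cr[OF that] by auto
  have cross: "cross3 (r i) (r (nx (Suc N) i)) \<noteq> 0" if "i < Suc N" for i
  proof -
    consider "i < L" | "i = L" | "i = N" using \<open>i < Suc N\<close> L_def by linarith
    then show ?thesis
    proof cases
      case 1 then show ?thesis using cr[of i] by (simp add: nxs r)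
    next
      case 2 then show ?thesis using xy by (simp add: nxl rxy rN cross_add_right)
    next
      case 3 then show ?thesis using xy by (simp add: nxl rxy rN cross_add_left)
    qed
  qed
  have eN1: "meets_properly (Suc N) r L f" if f: "f < L" for f
    unfolding meets_properly_def
  proof (intro allI impI)
    fix a b c d :: real assume abcd: "0 \<le> a" "0 \<le> b" "0 \<le> c" "0 \<le> d"
      and e0: "a *\<^sub>R r L + b *\<^sub>R r (nx (Suc N) L) = c *\<^sub>R r f + d *\<^sub>R r (nx (Suc N) f)"
    have e: "(a + b) *\<^sub>R p L + b *\<^sub>R p (nx N L) = c *\<^sub>R p f + d *\<^sub>R p (nx N f)"
      using e0 f by (simp add: nxl nxs rxy rN r x_def[symmetric] y_def[symmetric] algebra_simps)
    have ab: "0 \<le> a + b" using abcd by simp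
    note m = meets_properlyD[OF mp[of "L" f] ab abcd(2-4) e, unfolded nxl nxs[OF f]]
    have b: "b = 0" using m(1,2) f abcd N by auto
    have c: "c = 0"
    proof (rule ccontr)
      assume "c \<noteq> 0"
      then have "f = 0" "a = 0" "d = 0" using m(1,3,4) f N b by auto
      with e b nz[of 0] N \<open>c \<noteq> 0\<close> show False by auto
    qed
    show "(a = 0 \<or> L = nx (Suc N) f) \<and> (b = 0 \<or> f = nx (Suc N) L) \<and>
        (c = 0 \<or> f = nx (Suc N) L) \<and> (d = 0 \<or> L = nx (Suc N) f)"
      using b c m f N by (auto simp: nxs)
  qed
  have eN: "meets_properly (Suc N) r N f" if f: "f < L" for f
    unfolding meets_properly_def
  proof (intro allI impI)
    fix a b c d :: real assume abcd: "0 \<le> a" "0 \<le> b" "0 \<le> c" "0 \<le> d"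
      and e0: "a *\<^sub>R r N + b *\<^sub>R r (nx (Suc N) N) = c *\<^sub>R r f + d *\<^sub>R r (nx (Suc N) f)"
    have e: "a *\<^sub>R p L + (a + b) *\<^sub>R p (nx N L) = c *\<^sub>R p f + d *\<^sub>R p (nx N f)"
      using e0 f by (simp add: nxl nxs rxy rN r x_def[symmetric] y_def[symmetric] algebra_simps)
    have ab: "0 \<le> a + b" using abcd by simp
    note m = meets_properlyD[OF mp[of "L" f] abcd(1) ab abcd(3-4) e, unfolded nxl nxs[OF f]]
    have a: "a = 0" using m(1,2) f abcd N by auto
    have d: "d = 0"
    proof (rule ccontr)
      assume "d \<noteq> 0"
      then have "L = Suc f" "b = 0" "c = 0" using m(2,3,4) f N a by auto
      with e a nz[of "Suc f"] N \<open>d \<noteq> 0\<close> nxs[OF f] show False by auto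
    qed
    show "(a = 0 \<or> N = nx (Suc N) f) \<and> (b = 0 \<or> f = nx (Suc N) N) \<and>
        (c = 0 \<or> f = nx (Suc N) N) \<and> (d = 0 \<or> N = nx (Suc N) f)"
      using a d m f N by (auto simp: nxs nxl)
  qed
  have eNN: "meets_properly (Suc N) r L N"
    unfolding meets_properly_def
  proof (intro allI impI)
    fix a b c d :: real assume abcd: "0 \<le> a" "0 \<le> b" "0 \<le> c" "0 \<le> d"
      and e0: "a *\<^sub>R r L + b *\<^sub>R r (nx (Suc N) L) = c *\<^sub>R r N + d *\<^sub>R r (nx (Suc N) N)"
    have "(a + b) *\<^sub>R x + b *\<^sub>R y = c *\<^sub>R x + (c + d) *\<^sub>R y"
      using e0 by (simp add: nxl rxy rN algebra_simps)
    from cross3_nonzero_independent[OF xy this] abcd have "a = 0" "d = 0" by linarith+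
    then show "(a = 0 \<or> L = nx (Suc N) N) \<and> (b = 0 \<or> N = nx (Suc N) L) \<and>
        (c = 0 \<or> N = nx (Suc N) L) \<and> (d = 0 \<or> L = nx (Suc N) N)"
      by (simp add: nxl)
  qed
  have ee: "meets_properly (Suc N) r e f" if ef: "e < L" "f < L" "e \<noteq> f" for e f
    using mp[of e f] ef unfolding meets_properly_def by (simp add: nxs r)
  have "meets_properly (Suc N) r e f" if "e < Suc N" "f < Suc N" "e \<noteq> f" for e f
  proof -
    have "e < L \<or> e = L \<or> e = N" "f < L \<or> f = L \<or> f = N" using that L_def by linarith+
    then show ?thesis
      using that ee eN1 eN eNN meets_properly_sym[OF eN1] meets_properly_sym[OF eN] meets_properly_sym[OF eNN]
      by (elim disjE) simp_all
  qed
  then show ?thesis unfolding cone_polygon_def r_def[symmetric] using cross N by simp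
qed

text \<open>A point of the merged edge lies on the half belonging to its larger coefficient; the
  smaller one becomes the coefficient of the middle vector.\<close>

lemma cone_polygon_delete_last:
  assumes "cone_polygon (Suc N) p" "3 \<le> N" and pN0: "p N = p (N - 1) + p 0"
  shows "cone_polygon N p"
proof -
  define L where "L = N - 1"
  have N: "3 \<le> N" "L < N" "2 \<le> L" using assms(2) by (simp_all add: L_def)
  have lt [simp]: "e < N" "Suc e < N" if "e < L" for e using that L_def by linarith+
  have pN: "p N = p L + p 0" using pN0 by (simp add: L_def)
  have cr: "\<And>i. i < Suc N \<Longrightarrow> cross3 (p i) (p (nx (Suc N) i)) \<noteq> 0"
    and mp: "\<And>e f. e < Suc N \<Longrightarrow> f < Suc N \<Longrightarrow> e \<noteq> f \<Longrightarrow> meets_properly (Suc N) p e f"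
    using assms(1) unfolding cone_polygon_def by blast+
  have nxs: "nx (Suc N) e = Suc e" "nx N e = Suc e" if "e < L" for e using that by (simp_all add: nx_def L_def)
  have nxl: "nx (Suc N) L = N" "nx (Suc N) N = 0" "nx N L = 0" using N by (simp_all add: nx_def L_def)
  have cross: "cross3 (p i) (p (nx N i)) \<noteq> 0" if "i < N" for i
  proof (cases "i = L")
    case True
    have "cross3 (p L) (p N) \<noteq> 0" using cr[of "L"] N by (simp add: nxl)
    then show ?thesis by (simp add: True nxl pN cross_add_right)
  next
    case False
    then have "i < L" using that L_def by simp
    then show ?thesis using cr[of i] that by (simp add: nxs)
  qed
  have eN1: "meets_properly N p L f" if f: "f < L" for f
    unfolding meets_properly_def
  proof (intro allI impI)
    fix a b c d :: real assume abcd: "0 \<le> a" "0 \<le> b" "0 \<le> c" "0 \<le> d"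
      and e0: "a *\<^sub>R p L + b *\<^sub>R p (nx N L) = c *\<^sub>R p f + d *\<^sub>R p (nx N f)"
    show "(a = 0 \<or> L = nx N f) \<and> (b = 0 \<or> f = nx N L) \<and>
        (c = 0 \<or> f = nx N L) \<and> (d = 0 \<or> L = nx N f)"
    proof (cases "b \<le> a")
      case True
      have e: "(a - b) *\<^sub>R p L + b *\<^sub>R p (nx (Suc N) L) = c *\<^sub>R p f + d *\<^sub>R p (nx (Suc N) f)"
        using e0 by (simp add: nxl nxs[OF f] pN algebra_simps)
      have ab: "0 \<le> a - b" using True by simp
      note m = meets_properlyD[OF mp[of L f] ab abcd(2-4) e, unfolded nxl nxs[OF f]]
      show ?thesis using m f N lt[OF f] by (auto simp: nxs nxl)
    next
      case False
      have e: "a *\<^sub>R p N + (b - a) *\<^sub>R p (nx (Suc N) N) = c *\<^sub>R p f + d *\<^sub>R p (nx (Suc N) f)"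
        using e0 by (simp add: nxl nxs[OF f] pN algebra_simps)
      have ab: "0 \<le> b - a" using False by simp
      note m = meets_properlyD[OF mp[of N f] abcd(1) ab abcd(3-4) e, unfolded nxl nxs[OF f]]
      show ?thesis using m f N lt[OF f] by (auto simp: nxs nxl)
    qed
  qed
  have ee: "meets_properly N p e f" if ef: "e < L" "f < L" "e \<noteq> f" for e f
    using mp[of e f] ef lt[OF ef(1)] lt[OF ef(2)] unfolding meets_properly_def by (simp add: nxs)
  have "meets_properly N p e f" if "e < N" "f < N" "e \<noteq> f" for e f
  proof -
    have "e < L \<or> e = L" "f < L \<or> f = L" using that L_def by linarith+
    then show ?thesis
      using that ee eN1 meets_properly_sym[OF eN1] by (elim disjE) simp_all
  qed
  then show ?thesis unfolding cone_polygon_def using cross N by simp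
qed

lemma isotopic_subdivide_last:
  assumes "isotopic N p q"
  shows "isotopic (Suc N) (subdivide_last N p) (subdivide_last N q)"
proof (rule isotopic_image[OF assms _ cone_polygon_subdivide_last])
  have "continuous_on UNIV (\<lambda>p :: nat \<Rightarrow> real^3. subdivide_last N p i)" for i
    unfolding subdivide_last_def fun_upd_def
    by (cases "i = N") (auto intro!: continuous_intros continuous_on_product_coordinates)
  then show "continuous_on UNIV (subdivide_last N)"
    by (intro continuous_on_coordinatewise_then_product)
qed

text \<open>Whatever the sign of \<open>\<xi>\<close> at the middle vector, an upward sign change of
  the old edge occurs on exactly one half, and an edge without one gets none.\<close>

lemma flat_polygon_subdivide_last:
  assumes "flat_polygon N p"
  shows "flat_polygon (Suc N) (subdivide_last N p)"
proof -
  define L where "L = N - 1"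
  define r where "r = subdivide_last N p"
  have cp: "cone_polygon N p" and count: "\<And>\<xi>. (\<forall>i<N. \<xi> \<bullet> p i \<noteq> 0) \<Longrightarrow> card {i. i < N \<and> \<xi> \<bullet> p i < 0 \<and> 0 < \<xi> \<bullet> p (nx N i)} = 1"
    using assms unfolding flat_polygon_def by blast+
  have N0: "3 \<le> N" using cp by (simp add: cone_polygon_def)
  from assms obtain n where n: "n \<noteq> 0" "\<And>i. i < N \<Longrightarrow> \<exists>c>0. cross3 (p i) (p (nx N i)) = c *\<^sub>R n"
    "\<And>x. n \<bullet> x = 0 \<Longrightarrow> \<exists>i<N. \<exists>a\<ge>0. \<exists>b\<ge>0. x = a *\<^sub>R p i + b *\<^sub>R p (nx N i)"
    unfolding flat_polygon_def by blast
  have N: "3 \<le> N" "L < N" "2 \<le> L" using N0 by (simp_all add: L_def)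
  have lt [simp]: "e < N" "Suc e < N" if "e < L" for e using that L_def by linarith+
  define x y where "x = p L" and "y = p 0"
  have r: "r i = p i" if "i < N" for i using that by (simp add: r_def subdivide_last_def)
  have rN: "r N = x + y" by (simp add: r_def subdivide_last_def x_def y_def L_def)
  have rxy: "r L = x" "r 0 = y" using N by (simp_all add: r x_def y_def)
  have nxs: "nx (Suc N) e = Suc e" "nx N e = Suc e" if "e < L" for e using that by (simp_all add: nx_def L_def)
  have nxl: "nx (Suc N) L = N" "nx (Suc N) N = 0" "nx N L = 0" using N by (simp_all add: nx_def L_def)
  have cross: "\<exists>c>0. cross3 (r i) (r (nx (Suc N) i)) = c *\<^sub>R n" if "i < Suc N" for i
  proof -
    have l: "\<exists>c>0. cross3 x y = c *\<^sub>R n" using n(2)[of "L"] N by (simp add: nxl x_def y_def)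
    consider "i < L" | "i = L" | "i = N" using \<open>i < Suc N\<close> L_def by linarith
    then show ?thesis
    proof cases
      case 1 then show ?thesis using n(2)[of i] by (simp add: nxs r)
    next
      case 2 then show ?thesis using l by (simp add: nxl rxy rN cross_add_right)
    next
      case 3 then show ?thesis using l by (simp add: nxl rxy rN cross_add_left)
    qed
  qed
  have cover: "\<exists>i<Suc N. \<exists>a\<ge>0. \<exists>b\<ge>0. z = a *\<^sub>R r i + b *\<^sub>R r (nx (Suc N) i)" if "n \<bullet> z = 0" for z
  proof -
    from n(3)[OF that] obtain i a b where i: "i < N" "0 \<le> a" "0 \<le> b" "z = a *\<^sub>R p i + b *\<^sub>R p (nx N i)" by blast
    have I: ?thesis if "j < Suc N" "0 \<le> c" "0 \<le> d" "z = c *\<^sub>R r j + d *\<^sub>R r (nx (Suc N) j)" for j c d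
      using that by blast
    show ?thesis
    proof (cases "i < L")
      case True
      then show ?thesis using i lt[OF True] by (intro I[of i a b]) (simp_all add: r nxs less_SucI)
    next
      case False
      then have "i = L" using i L_def by simp
      then have z: "z = a *\<^sub>R x + b *\<^sub>R y" using i by (simp add: nxl x_def y_def)
      show ?thesis
      proof (cases "b \<le> a")
        case True
        then show ?thesis using i N
          by (intro I[of L "a - b" b]) (simp_all add: z nxl rxy rN algebra_simps)
      next
        case False
        then show ?thesis using i N
          by (intro I[of N a "b - a"]) (simp_all add: z nxl rxy rN algebra_simps)
      qed
    qed
  qed
  have "card {i. i < Suc N \<and> \<xi> \<bullet> r i < 0 \<and> 0 < \<xi> \<bullet> r (nx (Suc N) i)} = 1"
    if \<xi>: "\<forall>i<Suc N. \<xi> \<bullet> r i \<noteq> 0" for \<xi>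
  proof -
    let ?s = "\<lambda>i. \<xi> \<bullet> p i < 0 \<and> 0 < \<xi> \<bullet> p (nx N i)"
    define A where "A = {i. i < N \<and> ?s i}"
    let ?A' = "{i. i < Suc N \<and> \<xi> \<bullet> r i < 0 \<and> 0 < \<xi> \<bullet> r (nx (Suc N) i)}"
    have "\<xi> \<bullet> p i \<noteq> 0" if "i < N" for i using \<xi>[rule_format, of i] that by (simp add: r)
    then have cA: "card A = 1" using count unfolding A_def by blast
    define B where "B = {i. i < L \<and> ?s i}"
    have B: "finite B" "L \<notin> B" "N \<notin> B" using N by (auto simp: B_def)
    have "A = B \<union> (if ?s L then {L} else {})"
    proof -
      have "i < N \<longleftrightarrow> i < L \<or> i = L" for i using N L_def by linarith
      then show ?thesis unfolding A_def B_def by auto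
    qed
    then have AB: "A = B \<union> (if \<xi> \<bullet> x < 0 \<and> 0 < \<xi> \<bullet> y then {L} else {})"
      by (simp only: nxl x_def y_def)
    have "?A' = B \<union> (if \<xi> \<bullet> x < 0 \<and> 0 < \<xi> \<bullet> (x + y) then {L} else {})
       \<union> (if \<xi> \<bullet> (x + y) < 0 \<and> 0 < \<xi> \<bullet> y then {N} else {})"
    proof (intro set_eqI)
      fix i
      consider "i < L" | "i = L" | "i = N" | "N < i" using L_def N by linarith
      then show "i \<in> ?A' \<longleftrightarrow> i \<in> B \<union> (if \<xi> \<bullet> x < 0 \<and> 0 < \<xi> \<bullet> (x + y) then {L} else {})
       \<union> (if \<xi> \<bullet> (x + y) < 0 \<and> 0 < \<xi> \<bullet> y then {N} else {})"
      proof cases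
        case 1
        have "i < Suc N" "i \<noteq> N" "i \<noteq> L" using lt[OF 1] 1 L_def by linarith+
        then show ?thesis using 1 by (simp add: B_def nxs r)
      next
        case 2
        then show ?thesis using B N by (simp add: nxl rxy rN less_SucI)
      next
        case 3
        then show ?thesis using B N by (simp add: nxl rxy rN less_SucI)
      next
        case 4
        have "\<not> i < Suc N" "i \<noteq> N" "i \<noteq> L" "\<not> i < L" using N 4 by linarith+
        then show ?thesis by (simp add: B_def)
      qed
    qed
    moreover have "\<xi> \<bullet> (x + y) \<noteq> 0" using \<xi>[rule_format, of N] by (simp add: rN)
    ultimately show ?thesis
      using cA B unfolding AB by (auto simp: inner_add_right split: if_splits)
  qed
  then show ?thesis unfolding flat_polygon_def r_def[symmetric]
    using cone_polygon_subdivide_last[OF cp, folded r_def] cross cover n(1) by blast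
qed

section \<open>Triangles, the base of the induction\<close>

lemma nx_3 [simp]: "nx 3 0 = Suc 0" "nx 3 (Suc 0) = 2" "nx 3 2 = 0"
  by (simp_all add: nx_def)

lemma less_3_cases: "(i::nat) < 3 \<longleftrightarrow> i = 0 \<or> i = Suc 0 \<or> i = 2"
  by auto

lemma cone_polygon_3I:
  assumes "\<And>i. i < 3 \<Longrightarrow> cross3 (p i) (p (nx 3 i)) \<noteq> 0" "\<And>i. i < 3 \<Longrightarrow> meets_properly 3 p i (nx 3 i)"
  shows "cone_polygon 3 p"
proof -
  have "meets_properly 3 p e f" if "e < 3" "f < 3" "e \<noteq> f" for e f
  proof -
    have "f = nx 3 e \<or> e = nx 3 f" using that unfolding less_3_cases by auto
    then show ?thesis using assms(2)[of e] meets_properly_sym[OF assms(2)[of f]] that by auto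
  qed
  then show ?thesis using assms(1) by (simp add: cone_polygon_def)
qed

lemma cone_polygon_3_independent:
  assumes "det3 (p 0) (p (Suc 0)) (p 2) \<noteq> 0"
  shows "cone_polygon 3 p"
proof (rule cone_polygon_3I)
  have det: "det3 (p i) (p (nx 3 i)) (p (nx 3 (nx 3 i))) \<noteq> 0" if "i < 3" for i
    using that assms det3_cyclic(1)[of "p (Suc 0)" "p 2" "p 0"] det3_cyclic(2)[of "p 2" "p 0" "p (Suc 0)"]
    unfolding less_3_cases by auto
  fix i :: nat assume i: "i < 3"
  show "cross3 (p i) (p (nx 3 i)) \<noteq> 0"
    using det[OF i] det3_cyclic(2)[of "p (nx 3 (nx 3 i))" "p i" "p (nx 3 i)"] by (auto simp: det3_def)
  show "meets_properly 3 p i (nx 3 i)"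
    unfolding meets_properly_def
  proof (intro allI impI)
    fix a b c d :: real
    assume "a *\<^sub>R p i + b *\<^sub>R p (nx 3 i) = c *\<^sub>R p (nx 3 i) + d *\<^sub>R p (nx 3 (nx 3 i))"
    then have "a *\<^sub>R p i + b *\<^sub>R p (nx 3 i) + 0 *\<^sub>R p (nx 3 (nx 3 i))
       = 0 *\<^sub>R p i + c *\<^sub>R p (nx 3 i) + d *\<^sub>R p (nx 3 (nx 3 i))" by simp
    from det3_unique[OF det[OF i] this]
    show "(a = 0 \<or> i = nx 3 (nx 3 i)) \<and> (b = 0 \<or> nx 3 i = nx 3 i) \<and> (c = 0 \<or> nx 3 i = nx 3 i) \<and> (d = 0 \<or> i = nx 3 (nx 3 i))"
      by simp
  qed
qed

text \<open>Vectors with sum zero have equal consecutive cross products, and these give the common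
  normal \<open>N\<close>.\<close>

lemma flat_polygon_3:
  assumes sum: "p 0 + p (Suc 0) + p 2 = 0" and cr: "cross3 (p 0) (p (Suc 0)) \<noteq> 0"
  shows "flat_polygon 3 p"
proof -
  define N where "N = cross3 (p 0) (p (Suc 0))"
  have p2: "p 2 = - p 0 - p (Suc 0)" using sum by (simp add: algebra_simps eq_neg_iff_add_eq_0)
  have cN: "cross3 (p i) (p (nx 3 i)) = N" if "i < 3" for i
  proof -
    have "cross3 (p (Suc 0)) (p 0) = - N" unfolding N_def by (rule cross_skew)
    then show ?thesis using that unfolding less_3_cases
      by (auto simp: N_def p2 Cross3.right_diff_distrib Cross3.left_diff_distrib)
  qed
  have N: "N \<noteq> 0" using cr by (simp add: N_def)
  have cp: "cone_polygon 3 p"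
  proof (rule cone_polygon_3I)
    fix i :: nat assume i: "i < 3"
    show c: "cross3 (p i) (p (nx 3 i)) \<noteq> 0" using cN[OF i] N by simp
    have i': "nx 3 i < 3" using i by simp
    have "0 < norm N * norm N + N \<bullet> N" using N by (intro add_pos_pos) simp_all
    with meets_properly_adjacent_iff[OF i order_refl refl cN[OF i, symmetric] N cN[OF i', symmetric] N]
    show "meets_properly 3 p i (nx 3 i)" by blast
  qed
  have cover: "\<exists>i<3. \<exists>a\<ge>0. \<exists>b\<ge>0. x = a *\<^sub>R p i + b *\<^sub>R p (nx 3 i)" if x: "N \<bullet> x = 0" for x
  proof -
    have I: ?thesis if "i < 3" "0 \<le> c" "0 \<le> d" "x = c *\<^sub>R p i + d *\<^sub>R p (nx 3 i)" for i c d
      using that by blast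
    have "det3 (p 0) (p (Suc 0)) N = N \<bullet> N"
      using det3_cyclic(2)[of N "p 0" "p (Suc 0)"] by (simp add: det3_def N_def)
    then have "det3 (p 0) (p (Suc 0)) N \<noteq> 0" using N by simp
    then obtain a b c where abc: "x = a *\<^sub>R p 0 + b *\<^sub>R p (Suc 0) + c *\<^sub>R N" using det3_basis by blast
    have "N \<bullet> p 0 = 0" "N \<bullet> p (Suc 0) = 0" by (simp_all add: N_def dot_cross_self inner_commute)
    then have "c = 0" using x N unfolding abc by (simp add: inner_add_right)
    then have x: "x = a *\<^sub>R p 0 + b *\<^sub>R p (Suc 0)" using abc by simp
    \<comment> \<open>The cases determine the least of \<open>0\<close>, \<open>a\<close> and
      \<open>b\<close>; subtracting this multiple of the zero sum leaves nonnegative coefficients at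
      two consecutive vectors.\<close>
    consider "0 \<le> a" "0 \<le> b" | "a < 0" "a \<le> b" | "b < 0" "b < a" by linarith
    then show ?thesis
    proof cases
      case 1
      then show ?thesis by (intro I[of 0 a b]) (simp_all add: x)
    next
      case 2
      then show ?thesis by (intro I[of "Suc 0" "b - a" "- a"]) (simp_all add: x p2 algebra_simps)
    next
      case 3
      then show ?thesis by (intro I[of 2 "- b" "a - b"]) (simp_all add: x p2 algebra_simps)
    qed
  qed
  have count: "card {i. i < 3 \<and> \<xi> \<bullet> p i < 0 \<and> 0 < \<xi> \<bullet> p (nx 3 i)} = 1"
    if \<xi>: "\<forall>i<3. \<xi> \<bullet> p i \<noteq> 0" for \<xi>
  proof -
    define s0 s1 s2 where "s0 = \<xi> \<bullet> p 0" and "s1 = \<xi> \<bullet> p (Suc 0)" and "s2 = \<xi> \<bullet> p 2"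
    have s: "s0 \<noteq> 0" "s1 \<noteq> 0" "s2 \<noteq> 0" using \<xi> by (simp_all add: s0_def s1_def s2_def)
    have "s0 + s1 + s2 = \<xi> \<bullet> (p 0 + p (Suc 0) + p 2)" by (simp add: s0_def s1_def s2_def inner_add_right)
    then have s': "s2 = - s0 - s1" unfolding sum by simp
    have set3: "{i. i < 3 \<and> R i} = (if R 0 then {0} else {}) \<union> (if R (Suc 0) then {Suc 0} else {})
      \<union> (if R 2 then {2} else {})" for R :: "nat \<Rightarrow> bool"
    proof (intro set_eqI)
      fix i :: nat
      show "i \<in> {i. i < 3 \<and> R i} \<longleftrightarrow> i \<in> (if R 0 then {0} else {}) \<union> (if R (Suc 0) then {Suc 0} else {})
        \<union> (if R 2 then {2} else {})"
        unfolding mem_Collect_eq less_3_cases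
        by (cases "i = 0"; cases "i = Suc 0"; cases "i = 2"; simp)
    qed
    have "{i. i < 3 \<and> \<xi> \<bullet> p i < 0 \<and> 0 < \<xi> \<bullet> p (nx 3 i)}
      = (if s0 < 0 \<and> 0 < s1 then {0} else {}) \<union> (if s1 < 0 \<and> 0 < s2 then {Suc 0} else {})
        \<union> (if s2 < 0 \<and> 0 < s0 then {2} else {})"
      unfolding set3 s0_def s1_def s2_def by simp
    also have "card \<dots> = 1" using s unfolding s' by auto
    finally show ?thesis .
  qed
  have "\<exists>c>0. cross3 (p i) (p (nx 3 i)) = c *\<^sub>R N" if "i < 3" for i
    using cN[OF that] by (intro exI[of _ 1]) simp
  then show ?thesis unfolding flat_polygon_def using cp N cover count by blast
qed

lemma det3_translate:
  assumes "m = x + y + z"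
  shows "det3 (x + s *\<^sub>R m) (y + s *\<^sub>R m) (z + s *\<^sub>R m) = (1 + 3 * s) * det3 x y z"
    "det3 z (x + s *\<^sub>R m) (y + s *\<^sub>R m) = (1 + 2 * s) * det3 x y z"
  unfolding assms det3_def cross3_def inner_vec_def sum_3 by (simp_all add: vector_3) (algebra+)

text \<open>Subtracting \<open>t\<close> times the centroid multiplies the determinant by
  \<open>1 - t\<close>. So the vectors stay independent until \<open>t = 1\<close>, where their sum
  is zero and \<open>flat_polygon_3\<close> takes over.\<close>

lemma isotopic_flat_3:
  assumes "generic_points 3 p"
  shows "\<exists>q. isotopic 3 p q \<and> flat_polygon 3 q"
proof -
  interpret generic_points 3 p by fact
  have d: "det3 (p 0) (p (Suc 0)) (p 2) \<noteq> 0" by (rule gen) simp_all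
  define m where "m = (1 / 3) *\<^sub>R (p 0 + p (Suc 0) + p 2)"
  define P where "P t i = p i - t *\<^sub>R m" for t :: real and i :: nat
  have det: "det3 (P t 0) (P t (Suc 0)) (P t 2) = (1 - t) * det3 (p 0) (p (Suc 0)) (p 2)" for t
  proof -
    have P: "P t i = p i + (- t / 3) *\<^sub>R (p 0 + p (Suc 0) + p 2)" for i by (simp add: P_def m_def)
    show ?thesis unfolding P det3_translate(1)[OF refl] by simp
  qed
  have sum: "P 1 0 + P 1 (Suc 0) + P 1 2 = 0"
  proof -
    have "(1 / 3) *\<^sub>R S + (1 / 3) *\<^sub>R S + (1 / 3) *\<^sub>R S = S" for S :: "real^3"
      unfolding scaleR_add_left[symmetric] by simp
    then have "m + m + m = p 0 + p (Suc 0) + p 2" unfolding m_def by blast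
    then show ?thesis by (simp add: P_def algebra_simps)
  qed
  have "cross3 (P 1 0) (P 1 (Suc 0)) \<noteq> 0"
  proof
    assume "cross3 (P 1 0) (P 1 (Suc 0)) = 0"
    then have "det3 (p 2) (P 1 0) (P 1 (Suc 0)) = 0" by (simp add: det3_def)
    moreover have "det3 (p 2) (P 1 0) (P 1 (Suc 0)) = (1 / 3) * det3 (p 0) (p (Suc 0)) (p 2)"
    proof -
      have P: "P 1 i = p i + (- 1 / 3) *\<^sub>R (p 0 + p (Suc 0) + p 2)" for i by (simp add: P_def m_def)
      show ?thesis unfolding P det3_translate(2)[OF refl] by simp
    qed
    ultimately show False using d by simp
  qed
  then have flat: "flat_polygon 3 (P 1)" by (rule flat_polygon_3[OF sum])
  have "isotopic 3 (P 0) (P 1)"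
  proof (rule isotopicI)
    show "continuous_on {0..1} (\<lambda>t. P t i)" for i unfolding P_def by (intro continuous_intros)
    show "cone_polygon 3 (P t)" if "0 \<le> t" "t \<le> 1" for t
    proof (cases "t = 1")
      case True
      then show ?thesis using flat by (simp add: flat_polygon_def)
    next
      case False
      then show ?thesis using det d by (intro cone_polygon_3_independent) simp
    qed
  qed
  moreover have "P 0 = p" by (rule ext) (simp add: P_def)
  ultimately show ?thesis using flat by auto
qed

theorem isotopic_flat:
  assumes "cone_polygon n p"
  shows "\<exists>q. isotopic n p q \<and> flat_polygon n q"
  using assms
proof (induction n arbitrary: p rule: less_induct)
  case (less n)
  have n3: "3 \<le> n" using less.prems by (simp add: cone_polygon_def)
  obtain P where P: "P 0 = p" "\<And>i. continuous_on {0..1} (\<lambda>t::real. P t i)"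
    "\<And>t. 0 \<le> t \<Longrightarrow> t \<le> 1 \<Longrightarrow> cone_polygon n (P t)" "generic_points n (P 1)"
    by (rule isotopic_generic[OF less.prems finite.emptyI]) auto
  define p1 where "p1 = P 1"
  have iso1: "isotopic n p p1" using isotopicI[of P, OF P(2,3)] P(1) by (simp add: p1_def)
  have cp1: "cone_polygon n p1" using P(3)[of 1] by (simp add: p1_def)
  interpret generic_points n p1 using P(4) by (simp add: p1_def)
  show ?case
  proof (cases "n = 3")
    case True
    then have "\<exists>q. isotopic 3 p1 q \<and> flat_polygon 3 q"
      using isotopic_flat_3 generic_points_axioms by simp
    then show ?thesis using path_component_trans[OF iso1] True by blast
  next
    case False
    then have n: "4 \<le> n" using n3 by simp
    have "generic_polygon n p1"
    proof unfold_locales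
      fix i j assume ij: "i < n" "j < n"
      show "\<not> crossing i (nx n i) j (nx n j)"
      proof
        assume "crossing i (nx n i) j (nx n j)"
        then obtain a b c d where disj: "{i, nx n i} \<inter> {j, nx n j} = {}" and pos: "0 < a" "0 < b" "0 < c" "0 < d"
          and eq: "a *\<^sub>R p1 i + b *\<^sub>R p1 (nx n i) = c *\<^sub>R p1 j + d *\<^sub>R p1 (nx n j)"
          unfolding crossing_def by blast
        have "i \<noteq> j" using disj by auto
        then have "meets_properly n p1 i j" using cp1 ij by (simp add: cone_polygon_def)
        from meets_properlyD(1)[OF this _ _ _ _ eq] pos disj show False by auto
      qed
    qed (rule n)
    from generic_polygon.ex_ear[OF this] obtain i where i: "i < n"
      and e: "\<forall>k<n. k \<notin> {i, nx n i, nx n (nx n i)} \<longrightarrow> \<not> in_cone (p1 k) (p1 i) (p1 (nx n i)) (p1 (nx n (nx n i)))"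
      by blast
    define j k where "j = nx n i" and "k = nx n j"
    interpret ear n p1 i j k
      by unfold_locales (use cp1 n i e in \<open>auto simp: j_def k_def\<close>)
    \<comment> \<open>At \<open>t = 1\<close> the tip is \<open>p1 i + p1 k\<close>, precisely the
      value that \<open>subdivide_last\<close> inserts.\<close>
    define Q where "Q t = p1(j := t *\<^sub>R p1 i + (1 - t) *\<^sub>R p1 j + t *\<^sub>R p1 k)" for t :: real
    have "isotopic n (Q 0) (Q 1)"
    proof (rule isotopicI)
      show "continuous_on {0..1} (\<lambda>t. Q t m)" for m
        unfolding Q_def fun_upd_def by (cases "m = j") (auto intro!: continuous_intros)
      show "cone_polygon n (Q t)" if "0 \<le> t" "t \<le> 1" for t
        unfolding Q_def by (rule cone_polygon_move[OF _ _ _ _ refl]) (use that in auto)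
    qed
    moreover have "Q 0 = p1" by (simp add: Q_def)
    moreover define p2 where "p2 = Q 1"
    ultimately have iso2: "isotopic n p1 p2" by simp
    have cp2: "cone_polygon n p2" using path_component_mem(2)[OF iso2] by simp
    have p2: "p2 j = p2 i + p2 k" using index by (simp add: p2_def Q_def)
    obtain N where N: "n = Suc N" using n by (cases n) auto
    \<comment> \<open>This rotation makes the flattened tip \<open>j\<close> the last vertex, with
      \<open>k\<close> at index \<open>0\<close> and \<open>i\<close> just before the tip.\<close>
    define p3 where "p3 m = p2 ((m + Suc j) mod n)" for m
    have cp3: "cone_polygon n p3" unfolding p3_def by (rule cone_polygon_rotate[OF cp2])
    have "N + Suc j = j + n" using N by simp
    then have jn: "(N + Suc j) mod n = j" using index(1) by (simp only: mod_add_self2 mod_less)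
    have "nx n ((N - 1 + Suc j) mod n) = (N + Suc j) mod n"
      using nx_rotate[of n "N - 1" "Suc j"] n N by (simp add: nx_def)
    then have "nx n ((N - 1 + Suc j) mod n) = nx n i" using jn by (simp add: j_def)
    then have "(N - 1 + Suc j) mod n = i" using nx_inj[of "(N - 1 + Suc j) mod n" n i] i n by simp
    then have "p3 N = p3 (N - 1) + p3 0"
      using jn p2 by (simp add: p3_def k_def nx_def)
    moreover have "3 \<le> N" using n N by simp
    ultimately have cpN: "cone_polygon N p3" using cp3 N cone_polygon_delete_last by blast
    from less.IH[OF _ this] N obtain q where q: "isotopic N p3 q" "flat_polygon N q" by auto
    have "subdivide_last N p3 = p3"
      unfolding subdivide_last_def using \<open>p3 N = p3 (N - 1) + p3 0\<close> by (metis fun_upd_triv)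
    then have iso3: "isotopic n p3 (subdivide_last N q)"
      using isotopic_subdivide_last[OF q(1)] N by simp
    \<comment> \<open>The shift that completes \<open>Suc j\<close> to a full turn.\<close>
    define r where "r = n - Suc j"
    have iso4: "isotopic n (\<lambda>m. p3 ((m + r) mod n)) (\<lambda>m. subdivide_last N q ((m + r) mod n))"
      by (rule isotopic_rotate[OF iso3])
    have "p2 m = p3 ((m + r) mod n)" if "m < n" for m
    proof -
      have "((m + r) mod n + Suc j) mod n = (m + (r + Suc j)) mod n" by (simp only: mod_add_left_eq add.assoc)
      also have "r + Suc j = n" using index(1) by (simp add: r_def)
      finally have "((m + r) mod n + Suc j) mod n = m" using that by simp
      then show ?thesis by (simp only: p3_def)
    qed
    then have iso3': "isotopic n p2 (\<lambda>m. p3 ((m + r) mod n))" by (rule isotopic_cong[OF cp2])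
    have "isotopic n p (\<lambda>m. subdivide_last N q ((m + r) mod n))"
      using iso1 iso2 iso3' iso4 path_component_trans by blast
    moreover have "flat_polygon n (\<lambda>m. subdivide_last N q ((m + r) mod n))"
      using flat_polygon_rotate flat_polygon_subdivide_last[OF q(2)] N by simp
    ultimately show ?thesis by blast
  qed
qed

section \<open>Vertex stars as cone polygons\<close>

lemma convex_hull_corner:
  fixes v a b :: "'a::real_vector"
  shows "x \<in> convex hull {v, a, b} \<longleftrightarrow>
    (\<exists>s\<ge>0. \<exists>t\<ge>0. s + t \<le> 1 \<and> x = v + s *\<^sub>R (a - v) + t *\<^sub>R (b - v))"
  unfolding convex_hull_3_alt by blast

lemma convex_hull_corner_2:
  fixes v a :: "'a::real_vector"
  shows "x \<in> convex hull {v, a} \<longleftrightarrow> (\<exists>s\<ge>0. s \<le> 1 \<and> x = v + s *\<^sub>R (a - v))"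
  unfolding convex_hull_2_alt by blast

lemma affine_independent_corner:
  "card {v, a, b} = 3 \<and> \<not> affine_dependent {v, a, b} \<longleftrightarrow> cross3 (a - v) (b - v) \<noteq> 0"
proof -
  have "card {v, a, b} = 3 \<longleftrightarrow> v \<noteq> a \<and> v \<noteq> b \<and> a \<noteq> b" by (auto simp: card_insert_if)
  moreover have "collinear {a, v, b} \<longleftrightarrow> cross3 (a - v) (b - v) = 0"
    unfolding cross_eq_0 using collinear_3[of a v b] by (simp add: NO_MATCH_def)
  moreover have "{a, v, b} = {v, a, b}" by blast
  ultimately show ?thesis using collinear_3_eq_affine_dependent[of v a b] by metis
qed

lemma star_face_eq: "star_face v ps i = {v, ps ! i, ps ! nx (length ps) i}"
  by (simp add: star_face_def cyc_next_def nx_def)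

text \<open>A common vector of two cones, scaled down far enough, lies in both triangles, and the
  embedding condition confines it to the hull of their common vertices.\<close>

lemma cone_polygon_if_embedded_star:
  assumes "embedded_star v ps"
  shows "cone_polygon (length ps) (\<lambda>i. ps ! i - v)"
proof -
  define n p where "n = length ps" and "p i = ps ! i - v" for i
  have n: "3 \<le> n" and dist: "distinct ps" and emb: "embedded_triangles (star_faces v ps)"
    using assms by (auto simp: embedded_star_def n_def)
  have F: "star_face v ps i \<in> star_faces v ps" if "i < n" for i
    using that by (simp add: star_faces_def n_def)
  have cr: "cross3 (p i) (p (nx n i)) \<noteq> 0" if "i < n" for i
    using emb F[OF that] affine_independent_corner[of v "ps ! i" "ps ! nx n i"]
    unfolding embedded_triangles_def star_face_eq p_def n_def[symmetric] by blast
  have eqi: "ps ! i = ps ! j \<longleftrightarrow> i = j" if "i < n" "j < n" for i j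
    using that dist by (simp add: nth_eq_iff_index_eq n_def)
  have nv: "ps ! i \<noteq> v" if "i < n" for i using cr[OF that] by (auto simp: p_def)
  have half: "meets_properly n p e f" if e: "e < n" "f < n" "e \<noteq> f" "f \<noteq> nx n e" for e f
    unfolding meets_properly_def
  proof (intro allI impI)
    fix a b c d :: real assume nn: "0 \<le> a" "0 \<le> b" "0 \<le> c" "0 \<le> d"
      and eq: "a *\<^sub>R p e + b *\<^sub>R p (nx n e) = c *\<^sub>R p f + d *\<^sub>R p (nx n f)"
    \<comment> \<open>One factor for both sides keeps the two expressions for \<open>x\<close>
      equal; the summand \<open>1\<close> prevents division by zero.\<close>
    define k where "k = 1 / (a + b + c + d + 1)"
    have k: "0 < k" using nn by (simp add: k_def)
    have le: "k * a + k * b \<le> 1" "k * c + k * d \<le> 1"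
      unfolding k_def distrib_left[symmetric] using nn by (simp_all add: field_simps)
    define x where "x = v + (k * a) *\<^sub>R p e + (k * b) *\<^sub>R p (nx n e)"
    have x2: "x = v + (k * c) *\<^sub>R p f + (k * d) *\<^sub>R p (nx n f)"
      unfolding x_def using arg_cong[OF eq, of "\<lambda>y. v + k *\<^sub>R y"] by (simp add: algebra_simps)
    have "x \<in> convex hull (star_face v ps e)"
      unfolding star_face_eq convex_hull_corner n_def[symmetric] p_def[symmetric]
      using nn k le x_def by (intro exI[of _ "k * a"] conjI exI[of _ "k * b"]) simp_all
    moreover have "x \<in> convex hull (star_face v ps f)"
      unfolding star_face_eq convex_hull_corner n_def[symmetric] p_def[symmetric]
      using nn k le x2 by (intro exI[of _ "k * c"] conjI exI[of _ "k * d"]) simp_all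
    ultimately have x: "x \<in> convex hull (star_face v ps e \<inter> star_face v ps f)"
      using emb F e unfolding embedded_triangles_def by blast
    have nef: "nx n e < n" "nx n f < n" "nx n e \<noteq> nx n f" using e nx_inj by simp_all
    show "(a = 0 \<or> e = nx n f) \<and> (b = 0 \<or> f = nx n e) \<and> (c = 0 \<or> f = nx n e) \<and> (d = 0 \<or> e = nx n f)"
    proof (cases "e = nx n f")
      case True
      have "star_face v ps e \<inter> star_face v ps f = {v, ps ! e}"
        unfolding star_face_eq n_def[symmetric] using eqi nv e nef True by auto
      with x obtain s where "x = v + s *\<^sub>R p e" unfolding p_def by (auto simp: convex_hull_corner_2)
      then have "(k * a) *\<^sub>R p e + (k * b) *\<^sub>R p (nx n e) = s *\<^sub>R p e + 0 *\<^sub>R p (nx n e)"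
        and "(k * c) *\<^sub>R p f + (k * d) *\<^sub>R p (nx n f) = 0 *\<^sub>R p f + s *\<^sub>R p (nx n f)"
        using x_def x2 True by simp_all
      from cross3_nonzero_independent(2)[OF cr[OF e(1)] this(1)] cross3_nonzero_independent(1)[OF cr[OF e(2)] this(2)]
      have "b = 0" "c = 0" using k by simp_all
      then show ?thesis using True by simp
    next
      case False
      have "star_face v ps e \<inter> star_face v ps f = {v}"
        unfolding star_face_eq n_def[symmetric] using eqi nv e nef False by auto
      with x have "x = v" by simp
      then have "(k * a) *\<^sub>R p e + (k * b) *\<^sub>R p (nx n e) = 0 *\<^sub>R p e + 0 *\<^sub>R p (nx n e)"
        and "(k * c) *\<^sub>R p f + (k * d) *\<^sub>R p (nx n f) = 0 *\<^sub>R p f + 0 *\<^sub>R p (nx n f)"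
        using x_def x2 by simp_all
      from cross3_nonzero_independent[OF cr[OF e(1)] this(1)] cross3_nonzero_independent[OF cr[OF e(2)] this(2)]
      show ?thesis using k by simp
    qed
  qed
  have "meets_properly n p e f" if "e < n" "f < n" "e \<noteq> f" for e f
  proof (cases "f = nx n e")
    case True
    then have "e \<noteq> nx n f" using that n by simp
    then show ?thesis using half[of f e] that meets_properly_sym by simp
  qed (use half that in simp)
  then show ?thesis unfolding cone_polygon_def n_def[symmetric] p_def[symmetric] using n cr by simp
qed

text \<open>Used for the intermediate polygons of a deformation, to which the properties of
  \<open>w\<close> are applied.\<close>

lemma embedded_star_if_cone_polygon:
  assumes "cone_polygon (length ps) (\<lambda>i. ps ! i - v)"
  shows "embedded_star v ps"
proof -
  define n p where "n = length ps" and "p = (\<lambda>i. ps ! i - v)"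
  have cp: "cone_polygon n p" unfolding n_def p_def by (rule assms)
  have pi: "ps ! i - v = p i" for i by (simp add: p_def)
  have n: "3 \<le> n" and cr: "\<And>i. i < n \<Longrightarrow> cross3 (p i) (p (nx n i)) \<noteq> 0"
    and mp: "\<And>e f. e < n \<Longrightarrow> f < n \<Longrightarrow> e \<noteq> f \<Longrightarrow> meets_properly n p e f"
    using cp unfolding cone_polygon_def by blast+
  have dist: "distinct ps"
    unfolding distinct_conv_nth
  proof (intro allI impI notI)
    fix i j assume ij: "i < length ps" "j < length ps" "i \<noteq> j" "ps ! i = ps ! j"
    then have "1 *\<^sub>R p i + 0 *\<^sub>R p (nx n i) = 1 *\<^sub>R p j + 0 *\<^sub>R p (nx n j)" by (simp add: p_def)
    from meets_properlyD(1,3)[OF mp _ _ _ _ this] ij have h: "i = nx n j" "j = nx n i" by (simp_all add: n_def)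
    have "nx n (nx n i) = i" by (simp only: h(2)[symmetric] h(1)[symmetric])
    moreover have "i < n" using ij by (simp add: n_def)
    ultimately show False using n by simp
  qed
  have hull: "convex hull (star_face v ps e) \<inter> convex hull (star_face v ps f)
      = convex hull (star_face v ps e \<inter> star_face v ps f)" if e: "e < n" "f < n" for e f
  proof (cases "e = f")
    case False
    show ?thesis
    proof (intro equalityI subsetI)
      fix x assume "x \<in> convex hull (star_face v ps e) \<inter> convex hull (star_face v ps f)"
      then obtain a b c d where nn: "0 \<le> a" "0 \<le> b" "a + b \<le> 1" "0 \<le> c" "0 \<le> d" "c + d \<le> 1"
        and x: "x = v + a *\<^sub>R p e + b *\<^sub>R p (nx n e)" "x = v + c *\<^sub>R p f + d *\<^sub>R p (nx n f)"
        unfolding star_face_eq Int_iff convex_hull_corner n_def[symmetric] pi by blast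
      have "a *\<^sub>R p e + b *\<^sub>R p (nx n e) = c *\<^sub>R p f + d *\<^sub>R p (nx n f)" using x by simp
      note m = meets_properlyD[OF mp[OF e False] nn(1,2,4,5) this]
      have en: "e = nx n f \<Longrightarrow> f \<noteq> nx n e" using e n by auto
      consider "e = nx n f" "b = 0" | "f = nx n e" "a = 0" | "a = 0" "b = 0" using m en by blast
      then show "x \<in> convex hull (star_face v ps e \<inter> star_face v ps f)"
      proof cases
        case 1
        then have "x \<in> convex hull {v, ps ! e}"
          unfolding convex_hull_corner_2 using nn x(1) by (auto simp: pi)
        moreover have "{v, ps ! e} \<subseteq> star_face v ps e \<inter> star_face v ps f"
          unfolding star_face_eq n_def[symmetric] using 1 by auto
        ultimately show ?thesis using hull_mono by blast
      next
        case 2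
        then have "x \<in> convex hull {v, ps ! f}"
          unfolding convex_hull_corner_2 using nn x(1) by (auto simp: pi)
        moreover have "{v, ps ! f} \<subseteq> star_face v ps e \<inter> star_face v ps f"
          unfolding star_face_eq n_def[symmetric] using 2 by auto
        ultimately show ?thesis using hull_mono by blast
      next
        case 3
        then show ?thesis using x(1) by (auto intro: hull_inc simp: star_face_eq)
      qed
    next
      fix x assume "x \<in> convex hull (star_face v ps e \<inter> star_face v ps f)"
      then show "x \<in> convex hull (star_face v ps e) \<inter> convex hull (star_face v ps f)"
        using hull_mono[of "star_face v ps e \<inter> star_face v ps f"] by blast
    qed
  qed simp
  have face: "card (star_face v ps i) = 3 \<and> \<not> affine_dependent (star_face v ps i)" if "i < n" for i
    unfolding star_face_eq affine_independent_corner using cr[OF that] by (simp add: p_def n_def)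
  have "embedded_triangles (star_faces v ps)"
    unfolding embedded_triangles_def
  proof (intro conjI ballI)
    show "finite (star_faces v ps)" by (simp add: star_faces_def)
    show "card f = 3" "\<not> affine_dependent f" if "f \<in> star_faces v ps" for f
      using that face unfolding star_faces_def n_def[symmetric] by auto
    show "convex hull f \<inter> convex hull g = convex hull (f \<inter> g)" if "f \<in> star_faces v ps" "g \<in> star_faces v ps" for f g
      using that hull unfolding star_faces_def n_def[symmetric] by auto
  qed
  then show ?thesis using n dist by (simp add: embedded_star_def n_def)
qed

definition star_list :: "real^3 \<Rightarrow> nat \<Rightarrow> (nat \<Rightarrow> real^3) \<Rightarrow> (real^3) list" where
  "star_list v n p = map (\<lambda>i. v + p i) [0..<n]"

lemma length_star_list [simp]: "length (star_list v n p) = n"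
  by (simp add: star_list_def)

lemma nth_star_list [simp]: "i < n \<Longrightarrow> star_list v n p ! i = v + p i"
  by (simp add: star_list_def)

lemma star_list_nth: "star_list v (length ps) (\<lambda>i. ps ! i - v) = ps"
  by (rule nth_equalityI) simp_all

lemma embedded_star_list:
  assumes "cone_polygon n p"
  shows "embedded_star v (star_list v n p)"
  by (rule embedded_star_if_cone_polygon) (simp, rule cone_polygon_cong[OF assms], simp)

lemma star_normal_list:
  "i < n \<Longrightarrow> star_normal v (star_list v n p) i = sgn (cross3 (p i) (p (nx n i)))"
  by (simp add: star_normal_def cyc_next_def nx_def)

section \<open>Winding numbers and wall crossing\<close>

text \<open>The normalizing factors of \<open>sgn\<close> are absorbed into \<open>s\<close> and
  \<open>t\<close>, which makes later computations linear.\<close>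

lemma gauss_image_dest:
  assumes "y \<noteq> 0" "3 \<le> n" "sgn y \<in> gauss_image v (star_list v n p)"
  obtains i s t where "i < n" "0 \<le> s" "0 \<le> t"
    "y = s *\<^sub>R cross3 (p i) (p (nx n i)) + t *\<^sub>R cross3 (p (nx n i)) (p (nx n (nx n i)))"
proof -
  from assms(3) obtain i where i: "i < n" "sgn y \<in> gauss_arc v (star_list v n p) i"
    by (auto simp: gauss_image_def)
  then obtain s t where st: "0 \<le> s" "0 \<le> t"
    "sgn y = s *\<^sub>R sgn (cross3 (p i) (p (nx n i))) + t *\<^sub>R sgn (cross3 (p (nx n i)) (p (nx n (nx n i))))"
    unfolding gauss_arc_def great_arc_def length_star_list nx_def[symmetric]
    by (auto simp: star_normal_list)
  let ?u = "cross3 (p i) (p (nx n i))" and ?v = "cross3 (p (nx n i)) (p (nx n (nx n i)))"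
  have "y = norm y *\<^sub>R sgn y" using assms(1) by (simp add: sgn_div_norm)
  also have "\<dots> = (norm y * s * inverse (norm ?u)) *\<^sub>R ?u + (norm y * t * inverse (norm ?v)) *\<^sub>R ?v"
    unfolding st(3) by (simp add: sgn_div_norm scaleR_right_distrib mult.assoc)
  finally show thesis using st(1,2) i(1) by (intro that[of i]) simp_all
qed

text \<open>Both normals are orthogonal to the common edge \<open>b\<close>, so the pole of the arc
  joining them is a multiple of \<open>b\<close>; the triple product gives its direction.\<close>

lemma cross3_pole: "cross3 (cross3 a b) (cross3 b c) = det3 a b c *\<^sub>R b"
  by (simp add: det3_def cross3_simps vec_eq_iff forall_3)

lemma det3_inner_cross3: "cross3 a b \<bullet> c = det3 a b c" "cross3 b c \<bullet> a = det3 a b c"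
  by (simp_all add: det3_def cross3_simps)

lemma orthogonal_to_basis:
  assumes "det3 a b c \<noteq> 0" "z \<bullet> a = 0" "z \<bullet> b = 0" "z \<bullet> c = 0"
  shows "z = 0"
proof -
  obtain r s t where "z = r *\<^sub>R a + s *\<^sub>R b + t *\<^sub>R c" using det3_basis[OF assms(1)] by blast
  then have "z \<bullet> z = z \<bullet> (r *\<^sub>R a + s *\<^sub>R b + t *\<^sub>R c)" by simp
  also have "\<dots> = 0" using assms by (simp add: inner_add_right)
  finally show ?thesis by simp
qed

definition sign_changes :: "nat \<Rightarrow> (nat \<Rightarrow> real^3) \<Rightarrow> real^3 \<Rightarrow> int" where
  "sign_changes n p y = (\<Sum>m<n. if y \<bullet> p m < 0 \<and> 0 < y \<bullet> p (nx n m) then 1 else 0)"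

lemma sign_changes_cong:
  assumes "\<And>m. m < n \<Longrightarrow> 0 < (y \<bullet> p m) * (z \<bullet> q m)"
  shows "sign_changes n p y = sign_changes n q z"
proof -
  have "y \<bullet> p m < 0 \<longleftrightarrow> z \<bullet> q m < 0" "0 < y \<bullet> p m \<longleftrightarrow> 0 < z \<bullet> q m" if "m < n" for m
    using assms[OF that] by (auto simp: zero_less_mult_iff)
  then show ?thesis unfolding sign_changes_def by (intro sum.cong) auto
qed

lemma convex_sign_cone: "convex {y. \<forall>m\<in>M. 0 < (y \<bullet> p m) * c m}"
proof -
  have "{y. \<forall>m\<in>M. 0 < (y \<bullet> p m) * c m} = (\<Inter>m\<in>M. {y. 0 < (c m *\<^sub>R p m) \<bullet> y})"
    by (auto simp: inner_commute mult.commute)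
  then show ?thesis by (simp only:) (intro convex_INT convex_halfspace_gt)
qed

locale winding_number =
  fixes w :: "real^3 \<Rightarrow> (real^3) list \<Rightarrow> real^3 \<Rightarrow> int" and v :: "real^3"
  assumes winding: "gauss_winding_number w"
begin

text \<open>Passing through \<open>sgn\<close> extends the winding number to nonzero vectors, so
  that connected sets on the sphere arise as images of convex sets.\<close>

definition wind :: "nat \<Rightarrow> (nat \<Rightarrow> real^3) \<Rightarrow> real^3 \<Rightarrow> int" where
  "wind n p y = w v (star_list v n p) (sgn y)"

definition excess :: "nat \<Rightarrow> (nat \<Rightarrow> real^3) \<Rightarrow> real^3 \<Rightarrow> int" where
  "excess n p y = 1 - sign_changes n p y - wind n p y - wind n p (- y)"

text \<open>Every arc of the Gauss image lies in the plane orthogonal to an edge vector of the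
  star.\<close>

lemma off_gauss_image:
  assumes "3 \<le> n" "\<And>m. m < n \<Longrightarrow> y \<bullet> p m \<noteq> 0"
  shows "sgn y \<notin> gauss_image v (star_list v n p)"
proof
  assume g: "sgn y \<in> gauss_image v (star_list v n p)"
  have "y \<noteq> 0" using assms(2)[of 0] assms(1) by auto
  from gauss_image_dest[OF this assms(1) g] obtain i s t where i: "i < n"
    and y: "y = s *\<^sub>R cross3 (p i) (p (nx n i)) + t *\<^sub>R cross3 (p (nx n i)) (p (nx n (nx n i)))" by blast
  have "y \<bullet> p (nx n i) = 0" unfolding y by (simp add: inner_add_left dot_cross_self)
  then show False using assms(2)[of "nx n i"] i by simp
qed

lemma wind_const:
  assumes cp: "cone_polygon n p" and C: "convex C" "0 \<notin> C"
    and off: "\<And>y. y \<in> C \<Longrightarrow> sgn y \<notin> gauss_image v (star_list v n p)" and yz: "y \<in> C" "z \<in> C"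
  shows "wind n p y = wind n p z"
proof -
  have "connected (sgn ` C)"
    using C by (intro connected_continuous_image convex_connected continuous_on_sgn continuous_on_id) auto
  moreover have "sgn ` C \<subseteq> sphere 0 1 - gauss_image v (star_list v n p)"
    using off C(2) by (auto simp: norm_sgn)
  ultimately have "connected_component (sphere 0 1 - gauss_image v (star_list v n p)) (sgn y) (sgn z)"
    unfolding connected_component_def using yz by blast
  then show ?thesis
    using winding embedded_star_list[OF cp] unfolding wind_def gauss_winding_number_def constant_on_components_def by blast
qed

text \<open>The directions with prescribed signs at all edge vectors form a convex cone that avoids
  the Gauss image.\<close>

lemma wind_cong:
  assumes cp: "cone_polygon n p" and yz: "\<And>m. m < n \<Longrightarrow> 0 < (y \<bullet> p m) * (z \<bullet> p m)"
  shows "wind n p y = wind n p z"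
proof (rule wind_const[OF cp convex_sign_cone])
  have n: "3 \<le> n" using cp by (simp add: cone_polygon_def)
  let ?C = "{u. \<forall>m\<in>{..<n}. 0 < (u \<bullet> p m) * (z \<bullet> p m)}"
  show "0 \<notin> ?C" using n by (auto intro: exI[of _ 0])
  show "y \<in> ?C" using yz by simp
  have "z \<bullet> p m \<noteq> 0" if "m < n" for m using yz[OF that] by auto
  then show "z \<in> ?C" by (auto simp: zero_less_mult_iff linorder_neq_iff)
  show "sgn u \<notin> gauss_image v (star_list v n p)" if "u \<in> ?C" for u
  proof (rule off_gauss_image[OF n])
    fix m assume "m < n"
    then have "0 < (u \<bullet> p m) * (z \<bullet> p m)" using that by simp
    then show "u \<bullet> p m \<noteq> 0" by auto
  qed
qed

lemma excess_cong:
  assumes cp: "cone_polygon n p" and yz: "\<And>m. m < n \<Longrightarrow> 0 < (y \<bullet> p m) * (z \<bullet> p m)"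
  shows "excess n p y = excess n p z"
proof -
  have "wind n p (- y) = wind n p (- z)" by (rule wind_cong[OF cp]) (use yz in simp)
  then show ?thesis unfolding excess_def
    using wind_cong[OF cp yz] sign_changes_cong[of n y p z p] yz by simp
qed

lemma wind_deformation:
  assumes P: "\<And>i. i < n \<Longrightarrow> continuous_on {0..1} (\<lambda>t::real. P t i)"
    and cp: "\<And>t. 0 \<le> t \<Longrightarrow> t \<le> 1 \<Longrightarrow> cone_polygon n (P t)"
    and y: "\<And>t i. 0 \<le> t \<Longrightarrow> t \<le> 1 \<Longrightarrow> i < n \<Longrightarrow> y \<bullet> P t i \<noteq> 0"
  shows "wind n (P 0) y = wind n (P 1) y"
proof -
  let ?Q = "\<lambda>t. star_list v n (P t)"
  have n: "3 \<le> n" using cp[of 0] by (simp add: cone_polygon_def)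
  have "star_deformation (\<lambda>t. v) ?Q"
    unfolding star_deformation_def
  proof (intro conjI ballI allI impI)
    show "continuous_on {0..1} (\<lambda>t. ?Q t ! i)" if "i < length (?Q 0)" for i
      using that by (simp add: continuous_on_add P)
    show "embedded_star v (?Q t)" if "t \<in> {0..1}" for t
      using that cp by (intro embedded_star_list) simp
  qed simp_all
  moreover have "sgn y \<in> sphere 0 1"
  proof -
    have "y \<noteq> 0" using y[of 0 0] n by auto
    then show ?thesis by (simp add: norm_sgn)
  qed
  moreover have "\<forall>t\<in>{0..1}. sgn y \<notin> gauss_image v (?Q t)"
    using off_gauss_image[OF n] y by simp
  ultimately show ?thesis
    using winding unfolding wind_def gauss_winding_number_def deformation_invariant_def by blast
qed

lemma excess_deformation:
  assumes P: "\<And>i. i < n \<Longrightarrow> continuous_on {0..1} (\<lambda>t::real. P t i)"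
    and cp: "\<And>t. 0 \<le> t \<Longrightarrow> t \<le> 1 \<Longrightarrow> cone_polygon n (P t)"
    and y: "\<And>t i. 0 \<le> t \<Longrightarrow> t \<le> 1 \<Longrightarrow> i < n \<Longrightarrow> 0 < (y \<bullet> P t i) * (y \<bullet> P 0 i)"
  shows "excess n (P 0) y = excess n (P 1) y"
proof -
  have y': "y \<bullet> P t i \<noteq> 0" if "0 \<le> t" "t \<le> 1" "i < n" for t i using y[OF that] by auto
  have "wind n (P 0) y = wind n (P 1) y" by (rule wind_deformation[OF P cp]) (use y' in auto)
  moreover have "wind n (P 0) (- y) = wind n (P 1) (- y)" by (rule wind_deformation[OF P cp]) (use y' in auto)
  moreover have "sign_changes n (P 1) y = sign_changes n (P 0) y"
    by (rule sign_changes_cong) (use y[of 1] in simp)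
  ultimately show ?thesis by (simp add: excess_def)
qed

end

text \<open>The wall is the plane orthogonal to \<open>p j\<close>; the sign of \<open>D\<close>
  tells which side of it is to the left of the Gauss arc in this plane.\<close>

locale wall = winding_number w v + generic_points n p for w v n p +
  fixes i j k :: nat and D :: real
  assumes polygon: "cone_polygon n p" and i: "i < n" and j: "j = nx n i" and k: "k = nx n j"
    and D: "D = det3 (p i) (p j) (p k)"
begin

lemma index: "j < n" "k < n" "i \<noteq> j" "i \<noteq> k" "j \<noteq> k"
  using i j k three by simp_all

lemma D_nonzero: "D \<noteq> 0"
  unfolding D using gen i index by simp

text \<open>The sign at \<open>p j\<close> is left free: for \<open>x\<close> on this wall and on no
  other, these are the two open sign cones next to \<open>x\<close> joined by the part of the wall
  between them.\<close>

definition chamber :: "real^3 \<Rightarrow> (real^3) set" where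
  "chamber x = {y. \<forall>m\<in>{..<n} - {j}. 0 < (y \<bullet> p m) * (x \<bullet> p m)}"

text \<open>On the Gauss arc in this wall, \<open>D * (u \<bullet> p i)\<close> and
  \<open>D * (u \<bullet> p k)\<close> are both nonnegative. If one of them is negative on the
  chamber, the chamber misses the arc and can be crossed freely.\<close>

lemma wind_no_jump:
  assumes "D * (x \<bullet> p i) < 0 \<or> D * (x \<bullet> p k) < 0" "y \<in> chamber x" "z \<in> chamber x"
  shows "wind n p y = wind n p z"
proof (rule wind_const[OF polygon _ _ _ assms(2,3)])
  show "convex (chamber x)" unfolding chamber_def by (rule convex_sign_cone)
  show "0 \<notin> chamber x" unfolding chamber_def using i index by (auto intro: bexI[of _ i])
  fix u assume u: "u \<in> chamber x"
  then have "u \<noteq> 0" using \<open>0 \<notin> chamber x\<close> by auto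
  show "sgn u \<notin> gauss_image v (star_list v n p)"
  proof
    assume "sgn u \<in> gauss_image v (star_list v n p)"
    from gauss_image_dest[OF \<open>u \<noteq> 0\<close> three this] obtain m s t where m: "m < n" "0 \<le> s" "0 \<le> t"
      and ueq: "u = s *\<^sub>R cross3 (p m) (p (nx n m)) + t *\<^sub>R cross3 (p (nx n m)) (p (nx n (nx n m)))" .
    have "u \<bullet> p (nx n m) = 0" unfolding ueq by (simp add: inner_add_left dot_cross_self)
    then have "nx n m = j" using u m(1) unfolding chamber_def by (force dest: bspec[of _ _ "nx n m"])
    then have "m = i" using nx_inj m i j by simp
    then have ueq: "u = s *\<^sub>R cross3 (p i) (p j) + t *\<^sub>R cross3 (p j) (p k)" using ueq j k by simp
    have "u \<bullet> p i = t * D" "u \<bullet> p k = s * D"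
      unfolding ueq D using det3_inner_cross3(1)[of "p i" "p j" "p k"] det3_inner_cross3(2)[of "p j" "p k" "p i"]
      by (simp_all add: inner_add_left dot_cross_self)
    then have "D * (u \<bullet> p i) = t * (D * D)" "D * (u \<bullet> p k) = s * (D * D)" by (simp_all add: algebra_simps)
    moreover have "0 \<le> t * (D * D)" "0 \<le> s * (D * D)" using m by simp_all
    ultimately have "0 \<le> D * (u \<bullet> p i)" "0 \<le> D * (u \<bullet> p k)" by (simp_all only:)
    moreover have "0 < (u \<bullet> p i) * (x \<bullet> p i)" "0 < (u \<bullet> p k) * (x \<bullet> p k)"
      using u i index unfolding chamber_def by simp_all
    ultimately show False using assms(1) D_nonzero
      by (auto simp: zero_less_mult_iff zero_le_mult_iff mult_less_0_iff)
  qed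
qed

text \<open>With both signs positive, \<open>x\<close> is a positive combination of the two normals;
  every other arc lies in a plane orthogonal to some \<open>p m\<close> with
  \<open>m \<noteq> j\<close>, which does not contain \<open>x\<close>.\<close>

lemma simple_gauss_point_wall:
  assumes x: "x \<bullet> p j = 0" "\<And>m. m < n \<Longrightarrow> m \<noteq> j \<Longrightarrow> x \<bullet> p m \<noteq> 0"
    and pos: "0 < D * (x \<bullet> p i)" "0 < D * (x \<bullet> p k)"
  shows "simple_gauss_point v (star_list v n p) i (sgn x)"
proof -
  let ?u = "cross3 (p i) (p j)" and ?v = "cross3 (p j) (p k)"
  have x0: "x \<noteq> 0" using pos by auto
  have u: "?u \<bullet> p k = D" unfolding D by (rule det3_inner_cross3(1))
  have v: "?v \<bullet> p i = D" unfolding D by (rule det3_inner_cross3(2))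
  have uv0: "?u \<noteq> 0" "?v \<noteq> 0"
  proof -
    show "?u \<noteq> 0" using u D_nonzero by (metis inner_zero_left)
    show "?v \<noteq> 0" using v D_nonzero by (metis inner_zero_left)
  qed
  \<comment> \<open>Pairing with \<open>p k\<close> annihilates the second normal and gives
    \<open>D\<close> on the first, and conversely for \<open>p i\<close>; this determines the
    coefficients.\<close>
  define s t where "s = (x \<bullet> p k) / D" and "t = (x \<bullet> p i) / D"
  have st: "0 < s" "0 < t" using pos D_nonzero by (auto simp: s_def t_def zero_less_divide_iff zero_less_mult_iff)
  have "x - s *\<^sub>R ?u - t *\<^sub>R ?v = 0"
  proof (rule orthogonal_to_basis)
    show "det3 (p i) (p j) (p k) \<noteq> 0" using D_nonzero D by simp
    show "(x - s *\<^sub>R ?u - t *\<^sub>R ?v) \<bullet> p i = 0"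
      using D_nonzero v by (simp add: inner_diff_left t_def dot_cross_self)
    show "(x - s *\<^sub>R ?u - t *\<^sub>R ?v) \<bullet> p j = 0"
      by (simp add: inner_diff_left dot_cross_self x)
    show "(x - s *\<^sub>R ?u - t *\<^sub>R ?v) \<bullet> p k = 0"
      using D_nonzero u by (simp add: inner_diff_left s_def dot_cross_self)
  qed
  then have xeq: "x = s *\<^sub>R ?u + t *\<^sub>R ?v" by (simp add: algebra_simps)
  have "sgn x = (inverse (norm x) * s * norm ?u) *\<^sub>R sgn ?u + (inverse (norm x) * t * norm ?v) *\<^sub>R sgn ?v"
  proof -
    have "sgn x = inverse (norm x) *\<^sub>R (s *\<^sub>R ?u + t *\<^sub>R ?v)" using xeq by (simp add: sgn_div_norm)
    then show ?thesis using uv0 by (simp add: sgn_div_norm scaleR_right_distrib mult.assoc)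
  qed
  moreover have "0 < inverse (norm x) * s * norm ?u" "0 < inverse (norm x) * t * norm ?v"
    using st x0 uv0 by simp_all
  moreover have "sgn x \<in> sphere 0 1" using x0 by (simp add: norm_sgn)
  ultimately have op: "sgn x \<in> open_great_arc (sgn ?u) (sgn ?v)"
    unfolding open_great_arc_def by blast
  have ne: "sgn ?u \<noteq> sgn ?v"
  proof
    assume "sgn ?u = sgn ?v"
    then have "sgn ?u \<bullet> p k = sgn ?v \<bullet> p k" by simp
    then have "?u \<bullet> p k = 0" using uv0
      by (simp add: sgn_div_norm dot_cross_self)
    then show False using u D_nonzero by simp
  qed
  have off: "sgn x \<notin> gauss_arc v (star_list v n p) m" if m: "m < n" "m \<noteq> i" for m
  proof
    assume "sgn x \<in> gauss_arc v (star_list v n p) m"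
    then obtain s t where "sgn x = s *\<^sub>R sgn (cross3 (p m) (p (nx n m))) + t *\<^sub>R sgn (cross3 (p (nx n m)) (p (nx n (nx n m))))"
      unfolding gauss_arc_def great_arc_def length_star_list nx_def[symmetric]
      using m by (auto simp: star_normal_list)
    then have "sgn x \<bullet> p (nx n m) = 0"
      by (simp add: inner_add_left sgn_div_norm dot_cross_self)
    then have "x \<bullet> p (nx n m) = 0" using x0 by (simp add: sgn_div_norm)
    moreover have "nx n m \<noteq> j" using nx_inj m i j by simp
    ultimately show False using x(2) m by simp
  qed
  show ?thesis
    unfolding simple_gauss_point_def length_star_list nx_def[symmetric]
    using i ne op off by (simp add: star_normal_list j[symmetric] k[symmetric] index)
qed

end

context wall
begin

lemma chamber_same_side:
  assumes "y \<in> chamber x" "z \<in> chamber x" "0 < (y \<bullet> p j) * (z \<bullet> p j)" "m < n"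
  shows "0 < (y \<bullet> p m) * (z \<bullet> p m)"
proof (cases "m = j")
  case False
  then have "0 < (y \<bullet> p m) * (x \<bullet> p m)" "0 < (z \<bullet> p m) * (x \<bullet> p m)"
    using assms unfolding chamber_def by simp_all
  then show ?thesis by (auto simp: zero_less_mult_iff)
qed (use assms in simp)

text \<open>\<open>decreases_left_to_right\<close> speaks of points near \<open>sgn x\<close> only;
  \<open>wind_cong\<close> carries the jump from two such points to the whole chamber. The pole of
  the arc is a positive multiple of \<open>D *\<^sub>R p j\<close>, so the side where
  \<open>D * (y \<bullet> p j)\<close> is positive is the left one.\<close>

lemma wind_jump:
  assumes x: "x \<bullet> p j = 0" "\<And>m. m < n \<Longrightarrow> m \<noteq> j \<Longrightarrow> x \<bullet> p m \<noteq> 0"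
    and pos: "0 < D * (x \<bullet> p i)" "0 < D * (x \<bullet> p k)"
    and yz: "y \<in> chamber x" "z \<in> chamber x" "0 < D * (y \<bullet> p j)" "D * (z \<bullet> p j) < 0"
  shows "wind n p z = wind n p y - 1"
proof -
  have x0: "x \<noteq> 0" using pos by auto
  \<comment> \<open>The factor \<open>D\<close> makes positive \<open>\<delta>\<close> lead to the
    left of the arc, whatever the sign of \<open>D\<close>.\<close>
  define f where "f \<delta> = x + (\<delta> * D) *\<^sub>R p j" for \<delta>
  have lim: "(f \<longlongrightarrow> x) (at 0)" unfolding f_def by (rule tendsto_eq_intros refl | simp)+
  obtain \<epsilon> where \<epsilon>: "0 < \<epsilon>" and jump: "\<And>\<xi> \<eta>. \<lbrakk>\<xi> \<in> sphere 0 1 \<inter> ball (sgn x) \<epsilon>; \<eta> \<in> sphere 0 1 \<inter> ball (sgn x) \<epsilon>;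
      gauss_pole v (star_list v n p) i \<bullet> \<xi> > 0; gauss_pole v (star_list v n p) i \<bullet> \<eta> < 0\<rbrakk>
      \<Longrightarrow> w v (star_list v n p) \<eta> = w v (star_list v n p) \<xi> - 1"
    using winding embedded_star_list[OF polygon] simple_gauss_point_wall[OF x pos]
    unfolding gauss_winding_number_def decreases_left_to_right_def by metis
  have "((\<lambda>\<delta>. sgn (f \<delta>)) \<longlongrightarrow> sgn x) (at 0)" by (rule tendsto_sgn[OF lim x0])
  then have e1: "\<forall>\<^sub>F \<delta> in at 0. dist (sgn (f \<delta>)) (sgn x) < \<epsilon>" using \<epsilon> by (rule tendstoD)
  have "\<forall>\<^sub>F \<delta> in at 0. 0 < (f \<delta> \<bullet> p m) * (x \<bullet> p m)" if "m < n" "m \<noteq> j" for m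
  proof (rule order_tendstoD(1))
    show "((\<lambda>\<delta>. (f \<delta> \<bullet> p m) * (x \<bullet> p m)) \<longlongrightarrow> (x \<bullet> p m) * (x \<bullet> p m)) (at 0)"
      by (intro tendsto_intros lim)
    show "0 < (x \<bullet> p m) * (x \<bullet> p m)" using x(2)[OF that] by (auto simp: zero_less_mult_iff linorder_neq_iff)
  qed
  then have "\<forall>\<^sub>F \<delta> in at 0. \<forall>m\<in>{..<n} - {j}. 0 < (f \<delta> \<bullet> p m) * (x \<bullet> p m)"
    by (intro eventually_ball_finite) auto
  with e1 have "\<forall>\<^sub>F \<delta> in at 0. dist (sgn (f \<delta>)) (sgn x) < \<epsilon> \<and> f \<delta> \<in> chamber x"
    by eventually_elim (simp add: chamber_def)
  then obtain d where d: "0 < d" "\<And>\<delta>. \<delta> \<noteq> 0 \<Longrightarrow> dist \<delta> 0 < d \<Longrightarrow> dist (sgn (f \<delta>)) (sgn x) < \<epsilon> \<and> f \<delta> \<in> chamber x"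
    unfolding eventually_at by auto
  have pj: "p j \<noteq> 0"
  proof
    assume "p j = 0"
    then have "D = 0" unfolding D by simp
    then show False using D_nonzero by simp
  qed
  have fj: "D * (f \<delta> \<bullet> p j) = \<delta> * ((D * D) * (p j \<bullet> p j))" for \<delta>
    unfolding f_def by (simp add: inner_add_left x(1))
  have f0: "f \<delta> \<noteq> 0" if "\<delta> \<noteq> 0" for \<delta>
  proof
    assume "f \<delta> = 0"
    then have "\<delta> * ((D * D) * (p j \<bullet> p j)) = 0" using fj[of \<delta>] by simp
    then show False using that D_nonzero pj by simp
  qed
  let ?u = "cross3 (p i) (p j)" and ?v = "cross3 (p j) (p k)"
  define c where "c = inverse (norm ?u) * inverse (norm ?v)"
  have uv0: "?u \<noteq> 0" "?v \<noteq> 0" using polygon i index unfolding cone_polygon_def j k by auto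
  then have c: "0 < c" by (simp add: c_def)
  have pole: "gauss_pole v (star_list v n p) i = (c * D) *\<^sub>R p j"
    unfolding gauss_pole_def length_star_list nx_def[symmetric] j[symmetric]
    by (simp add: star_normal_list i index j[symmetric] k[symmetric] sgn_div_norm cross_mult_left cross_mult_right
        cross3_pole D c_def)
  have pf: "gauss_pole v (star_list v n p) i \<bullet> sgn (f \<delta>) = c * inverse (norm (f \<delta>)) * (D * (f \<delta> \<bullet> p j))" for \<delta>
    unfolding pole by (simp add: sgn_div_norm inner_commute algebra_simps)
  define s where "s = d / 2"
  have s: "s \<noteq> 0" "- s \<noteq> 0" "dist s 0 < d" "dist (- s) 0 < d" "0 < s" using d(1) by (simp_all add: s_def)
  have DD: "0 < (D * D) * (p j \<bullet> p j)" using D_nonzero pj by (auto simp: zero_less_mult_iff linorder_neq_iff)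
  have f1: "0 < D * (f s \<bullet> p j)" "D * (f (- s) \<bullet> p j) < 0"
    unfolding fj using s DD by (auto intro: mult_pos_pos mult_neg_pos simp del: mult_minus_left)
  have cn: "0 < c * inverse (norm (f s))" "0 < c * inverse (norm (f (- s)))"
    using c f0[OF s(1)] f0[OF s(2)] by simp_all
  have pp: "0 < gauss_pole v (star_list v n p) i \<bullet> sgn (f s)"
    unfolding pf by (rule mult_pos_pos[OF cn(1) f1(1)])
  have pn: "gauss_pole v (star_list v n p) i \<bullet> sgn (f (- s)) < 0"
    unfolding pf by (rule mult_pos_neg[OF cn(2) f1(2)])
  have "wind n p (f (- s)) = wind n p (f s) - 1"
    unfolding wind_def using d(2)[OF s(1,3)] d(2)[OF s(2,4)] f0[OF s(1)] f0[OF s(2)]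
    by (intro jump pp pn) (auto simp: norm_sgn dist_commute)
  moreover have "wind n p y = wind n p (f s)"
  proof (rule wind_cong[OF polygon chamber_same_side[OF yz(1)]])
    show "f s \<in> chamber x" using d(2) s by blast
    show "0 < (y \<bullet> p j) * (f s \<bullet> p j)" using yz f1 by (auto simp: zero_less_mult_iff)
  qed
  moreover have "wind n p z = wind n p (f (- s))"
  proof (rule wind_cong[OF polygon chamber_same_side[OF yz(2)]])
    show "f (- s) \<in> chamber x" using d(2) s by blast
    show "0 < (z \<bullet> p j) * (f (- s) \<bullet> p j)" using yz f1 by (auto simp: zero_less_mult_iff mult_less_0_iff)
  qed
  ultimately show ?thesis by simp
qed

text \<open>Only the edges \<open>i j\<close> and \<open>j k\<close> are affected. When
  \<open>j\<close> turns from positive to negative, an upward change on \<open>i j\<close>, present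
  if \<open>i\<close> is negative, is exchanged for one on \<open>j k\<close>, present if
  \<open>k\<close> is positive.\<close>

lemma sign_changes_wall:
  assumes yz: "y \<in> chamber x" "z \<in> chamber x" "0 < y \<bullet> p j" "z \<bullet> p j < 0"
  shows "sign_changes n p z - sign_changes n p y
    = (if 0 < x \<bullet> p i \<and> 0 < x \<bullet> p k then 1 else if x \<bullet> p i < 0 \<and> x \<bullet> p k < 0 then -1 else 0)"
proof -
  define f where "f u m = (if u \<bullet> p m < 0 \<and> 0 < u \<bullet> p (nx n m) then 1 else 0 :: int)" for u m
  have s: "(u \<bullet> p m < 0 \<longleftrightarrow> x \<bullet> p m < 0) \<and> (0 < u \<bullet> p m \<longleftrightarrow> 0 < x \<bullet> p m)"
    if "u \<in> chamber x" "m < n" "m \<noteq> j" for u m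
    using that unfolding chamber_def by (auto simp: zero_less_mult_iff dest!: bspec[of _ _ m])
  have split: "sign_changes n p u = f u i + f u j + sum (f u) ({..<n} - {i, j})" for u
  proof -
    have "sign_changes n p u = f u i + sum (f u) ({..<n} - {i})"
      unfolding sign_changes_def f_def using i by (simp add: sum.remove)
    also have "sum (f u) ({..<n} - {i}) = f u j + sum (f u) ({..<n} - {i} - {j})"
      using index by (simp add: sum.remove)
    also have "{..<n} - {i} - {j} = {..<n} - {i, j}" by blast
    finally show ?thesis by simp
  qed
  have "sum (f z) ({..<n} - {i, j}) = sum (f y) ({..<n} - {i, j})"
  proof (rule sum.cong)
    fix m assume m: "m \<in> {..<n} - {i, j}"
    then have "nx n m \<noteq> j" "nx n m < n" using nx_inj[of m n i] i j by auto
    then show "f z m = f y m" using s[OF yz(1)] s[OF yz(2)] m by (simp add: f_def)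
  qed simp
  moreover have "f z i = 0" "f y i = (if x \<bullet> p i < 0 then 1 else 0)"
    "f z j = (if 0 < x \<bullet> p k then 1 else 0)" "f y j = 0"
    using s[OF yz(1)] s[OF yz(2)] yz i index unfolding f_def j[symmetric] k[symmetric] by auto
  moreover have "x \<bullet> p i \<noteq> 0" "x \<bullet> p k \<noteq> 0"
    using bspec[OF yz(1)[unfolded chamber_def mem_Collect_eq], of i]
      bspec[OF yz(1)[unfolded chamber_def mem_Collect_eq], of k] i index by auto
  ultimately show ?thesis unfolding split by auto
qed

text \<open>The sign of \<open>D\<close> decides which of the two opposite directions crosses the
  arc and also from which side. The two effects cancel, so the total jump of the winding numbers
  depends only on the signs at \<open>i\<close> and \<open>k\<close>, as the jump of
  \<open>sign_changes\<close> does.\<close>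

lemma excess_wall:
  assumes x: "x \<bullet> p j = 0" "\<And>m. m < n \<Longrightarrow> m \<noteq> j \<Longrightarrow> x \<bullet> p m \<noteq> 0"
    and yz: "y \<in> chamber x" "z \<in> chamber x" "0 < y \<bullet> p j" "z \<bullet> p j < 0"
  shows "excess n p y = excess n p z"
proof -
  have yz': "- y \<in> chamber (- x)" "- z \<in> chamber (- x)" using yz(1,2) by (simp_all add: chamber_def)
  have x': "- x \<bullet> p j = 0" "\<And>m. m < n \<Longrightarrow> m \<noteq> j \<Longrightarrow> - x \<bullet> p m \<noteq> 0" using x by simp_all
  have nz: "x \<bullet> p i \<noteq> 0" "x \<bullet> p k \<noteq> 0" using x(2) i index by auto
  note sc = sign_changes_wall[OF yz]
  consider "0 < D * (x \<bullet> p i)" "0 < D * (x \<bullet> p k)" | "D * (x \<bullet> p i) < 0" "D * (x \<bullet> p k) < 0"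
    | "D * (x \<bullet> p i) < 0" "0 < D * (x \<bullet> p k)" | "0 < D * (x \<bullet> p i)" "D * (x \<bullet> p k) < 0"
    using nz D_nonzero by (metis linorder_neqE_linordered_idom mult_eq_0_iff)
  then show ?thesis
  proof cases
    case 1
    have "wind n p (- y) = wind n p (- z)" by (rule wind_no_jump[OF _ yz']) (use 1 in simp)
    moreover have "if 0 < D then wind n p z = wind n p y - 1 else wind n p y = wind n p z - 1"
      using wind_jump[OF x 1 yz(1,2)] wind_jump[OF x 1 yz(2,1)] yz(3,4) D_nonzero
      by (auto simp: zero_less_mult_iff mult_less_0_iff)
    ultimately show ?thesis using sc 1 D_nonzero
      by (auto simp: excess_def zero_less_mult_iff split: if_splits)
  next
    case 2
    have "wind n p y = wind n p z" by (rule wind_no_jump[OF _ yz(1,2)]) (use 2 in simp)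
    moreover have pos: "0 < D * (- x \<bullet> p i)" "0 < D * (- x \<bullet> p k)" using 2 by simp_all
    from wind_jump[OF x' pos yz'] wind_jump[OF x' pos yz'(2,1)]
    have "if 0 < D then wind n p (- y) = wind n p (- z) - 1 else wind n p (- z) = wind n p (- y) - 1"
      using yz(3,4) D_nonzero by (auto simp: zero_less_mult_iff mult_less_0_iff)
    ultimately show ?thesis using sc 2 D_nonzero
      by (auto simp: excess_def mult_less_0_iff split: if_splits)
  next
    case 3
    have "wind n p y = wind n p z" by (rule wind_no_jump[OF _ yz(1,2)]) (use 3 in simp)
    moreover have "wind n p (- y) = wind n p (- z)" by (rule wind_no_jump[OF _ yz']) (use 3 in simp)
    ultimately show ?thesis using sc 3
      by (auto simp: excess_def zero_less_mult_iff mult_less_0_iff split: if_splits)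
  next
    case 4
    have "wind n p y = wind n p z" by (rule wind_no_jump[OF _ yz(1,2)]) (use 4 in simp)
    moreover have "wind n p (- y) = wind n p (- z)" by (rule wind_no_jump[OF _ yz']) (use 4 in simp)
    ultimately show ?thesis using sc 4
      by (auto simp: excess_def zero_less_mult_iff mult_less_0_iff split: if_splits)
  qed
qed

end

context winding_number
begin

text \<open>The last hypothesis keeps the segment from \<open>y\<close> to \<open>z\<close> away
  from the intersection of any two walls, so walls are crossed one at a time.\<close>

lemma excess_segment:
  assumes gen: "generic_points n p" and cp: "cone_polygon n p"
    and y: "\<And>m. m < n \<Longrightarrow> y \<bullet> p m \<noteq> 0" and z: "\<And>m. m < n \<Longrightarrow> z \<bullet> p m \<noteq> 0"
    and yz: "\<And>j k. j < n \<Longrightarrow> k < n \<Longrightarrow> j \<noteq> k \<Longrightarrow> cross3 y (cross3 (p j) (p k)) \<bullet> z \<noteq> 0"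
  shows "excess n p y = excess n p z"
proof -
  have n: "3 \<le> n" using cp by (simp add: cone_polygon_def)
  define u where "u t = (1 - t) *\<^sub>R y + t *\<^sub>R z" for t :: real
  have ut: "u t \<bullet> p m = (1 - t) * (y \<bullet> p m) + t * (z \<bullet> p m)" for t m
    by (simp add: u_def inner_add_left)
  have cont: "continuous_on UNIV (\<lambda>t. u t \<bullet> p m)" for m unfolding u_def by (intro continuous_intros)
  \<comment> \<open>A vector orthogonal to \<open>p j\<close> and \<open>p k\<close> is parallel to
    \<open>?q\<close>, which would put \<open>z\<close> into the plane spanned by \<open>y\<close>
    and \<open>?q\<close>, unless \<open>t = 0\<close>.\<close>
  have one: "u t \<bullet> p k \<noteq> 0" if t: "u t \<bullet> p j = 0" "j < n" "k < n" "j \<noteq> k" for t j k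
  proof
    assume "u t \<bullet> p k = 0"
    let ?q = "cross3 (p j) (p k)"
    have "cross3 (u t) ?q = 0" using t(1) \<open>u t \<bullet> p k = 0\<close> by (simp add: Lagrange)
    then have "det3 y (u t) ?q = 0" by (simp add: det3_def)
    moreover have "det3 y (u t) ?q = - t * (cross3 y ?q \<bullet> z)"
      unfolding u_def by (simp add: det3_inner_cross3(1) det3_swap(3)[of y z ?q])
    ultimately have "t = 0" using yz t by simp
    then show False using t y by (simp add: u_def)
  qed
  have finite_zeros: "finite {t. u t \<bullet> p m = 0}" if "m < n" for m
  proof (rule finite_subset)
    show "{t. u t \<bullet> p m = 0} \<subseteq> {(y \<bullet> p m) / (y \<bullet> p m - z \<bullet> p m)}"
    proof
      fix t assume "t \<in> {t. u t \<bullet> p m = 0}"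
      then have t: "y \<bullet> p m = t * (y \<bullet> p m - z \<bullet> p m)" by (simp add: ut algebra_simps)
      then have "y \<bullet> p m - z \<bullet> p m \<noteq> 0" using y[OF that] by auto
      then show "t \<in> {(y \<bullet> p m) / (y \<bullet> p m - z \<bullet> p m)}" using t by (simp add: field_simps)
    qed
  qed simp
  define S where "S = {0..1 :: real}"
  define good where "good t \<longleftrightarrow> (\<forall>m<n. u t \<bullet> p m \<noteq> 0)" for t
  have "excess n p (u 0) = excess n p (u 1)"
  \<comment> \<open>On a connected interval it suffices to compare nearby good parameters, which are
    dense; near a parameter on a wall, those on different sides are compared by
    \<open>excess_wall\<close>.\<close>
  proof (rule connected_equivalence_relation_gen[where S = S and P = good and R = "\<lambda>s t. excess n p (u s) = excess n p (u t)"])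
    show "connected S" by (simp add: S_def)
    show "0 \<in> S" "1 \<in> S" by (simp_all add: S_def)
    show "good 0" "good 1" using y z by (simp_all add: good_def u_def)
    show "\<exists>t. t \<in> T \<and> good t" if T: "openin (top_of_set S) T" "a \<in> T" for T a
    proof -
      from T obtain V where V: "open V" "T = S \<inter> V" by (auto simp: openin_open)
      have "a islimpt S"
      proof (rule connected_imp_perfect)
        show "connected S" by (simp add: S_def)
        show "a \<in> S" using T V by blast
        have "0 \<in> S" "1 \<in> S" by (simp_all add: S_def)
        then show "S \<noteq> {x}" for x by auto
      qed
      moreover have "a \<in> V" using V T by blast
      ultimately have "infinite (V \<inter> S)" using V(1) unfolding islimpt_eq_acc_point by blast
      moreover have "finite (\<Union>m\<in>{..<n}. {t. u t \<bullet> p m = 0})" using finite_zeros by simp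
      ultimately obtain t where "t \<in> V \<inter> S" "t \<notin> (\<Union>m\<in>{..<n}. {t. u t \<bullet> p m = 0})"
        by (meson finite_subset subsetI)
      then show ?thesis using V by (auto simp: good_def)
    qed
    show "\<exists>T. openin (top_of_set S) T \<and> a \<in> T \<and>
       (\<forall>s\<in>T. \<forall>t\<in>T. good s \<and> good t \<longrightarrow> excess n p (u s) = excess n p (u t))" if a: "a \<in> S" for a
    proof -
      define M where "M = {m. m < n \<and> u a \<bullet> p m \<noteq> 0}"
      define T where "T = (\<Inter>m\<in>M. {t. 0 < (u t \<bullet> p m) * (u a \<bullet> p m)})"
      have "open T" unfolding T_def M_def
        by (intro open_INT ballI open_Collect_less continuous_on_mult cont continuous_on_const) simp
      moreover have "a \<in> T" unfolding T_def M_def by (auto simp: zero_less_mult_iff linorder_neq_iff)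
      moreover have "excess n p (u s) = excess n p (u t)" if st: "s \<in> T" "t \<in> T" "good s" "good t" for s t
      proof (cases "\<forall>m<n. 0 < (u s \<bullet> p m) * (u t \<bullet> p m)")
        case True
        then show ?thesis by (intro excess_cong[OF cp]) auto
      next
        case False
        then obtain j where jn: "j < n" "\<not> 0 < (u s \<bullet> p j) * (u t \<bullet> p j)" by blast
        have TM: "0 < (u r \<bullet> p m) * (u a \<bullet> p m)" if "r \<in> T" "m \<in> M" for r m
          using that unfolding T_def by blast
        have "j \<notin> M"
        proof
          assume "j \<in> M"
          with TM st(1,2) have "0 < (u s \<bullet> p j) * (u a \<bullet> p j)" "0 < (u t \<bullet> p j) * (u a \<bullet> p j)" by blast+
          then show False using jn(2) by (auto simp: zero_less_mult_iff)
        qed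
        then have a0: "u a \<bullet> p j = 0" using jn(1) by (simp add: M_def)
        have nz: "u a \<bullet> p m \<noteq> 0" if "m < n" "m \<noteq> j" for m using one[OF a0 jn(1) that(1)] that(2) by blast
        from nx_surj[OF jn(1)] obtain i where i: "i < n" "nx n i = j" by blast
        interpret wall w v n p i j "nx n j" "det3 (p i) (p j) (p (nx n j))"
          using gen by (intro wall.intro wall_axioms.intro winding_number_axioms) (simp_all add: cp i)
        have "m \<in> M" if "m \<in> {..<n} - {j}" for m using that nz by (simp add: M_def)
        then have c: "u s \<in> chamber (u a)" "u t \<in> chamber (u a)"
          unfolding chamber_def using TM st(1,2) by blast+
        have nz': "u s \<bullet> p j \<noteq> 0" "u t \<bullet> p j \<noteq> 0" using st(3,4) jn(1) unfolding good_def by blast+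
        then consider "0 < u s \<bullet> p j" "u t \<bullet> p j < 0" | "u s \<bullet> p j < 0" "0 < u t \<bullet> p j"
          using jn(2) unfolding zero_less_mult_iff by linarith
        then show ?thesis
        proof cases
          case 1
          show ?thesis by (rule excess_wall[OF a0 nz c 1])
        next
          case 2
          show ?thesis by (rule excess_wall[OF a0 nz c(2,1) 2(2,1), symmetric])
        qed
      qed
      ultimately show ?thesis using a by (intro exI[of _ "S \<inter> T"]) (auto simp: openin_open)
    qed
  qed auto
  then show ?thesis by (simp add: u_def)
qed


text \<open>The end \<open>z\<close> is moved within its sign cone, where the excess is constant, to
  a position for which the segment from \<open>y\<close> is admissible; only finitely many planes
  have to be avoided.\<close>

lemma excess_generic:
  assumes gp: "generic_points n p" and cp: "cone_polygon n p"
    and y: "\<And>m. m < n \<Longrightarrow> y \<bullet> p m \<noteq> 0" and z: "\<And>m. m < n \<Longrightarrow> z \<bullet> p m \<noteq> 0"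
  shows "excess n p y = excess n p z"
proof -
  interpret generic_points n p by (rule gp)
  define Z where "Z = (\<lambda>(j, k). cross3 y (cross3 (p j) (p k))) ` {(j, k). j < n \<and> k < n \<and> j \<noteq> k}"
  have "finite {(j, k). j < n \<and> k < n \<and> j \<noteq> k}"
    by (rule finite_subset[of _ "{..<n} \<times> {..<n}"]) auto
  then have finZ: "finite Z" by (simp add: Z_def)
  have Z0: "0 \<notin> Z"
  proof
    assume "0 \<in> Z"
    then obtain j k where jk: "j < n" "k < n" "j \<noteq> k" "cross3 y (cross3 (p j) (p k)) = 0"
      unfolding Z_def by auto
    then have "(y \<bullet> p k) *\<^sub>R p j + (- (y \<bullet> p j)) *\<^sub>R p k = 0" by (simp add: Lagrange)
    from pair_not_dependent(1)[OF jk(1-3) this] y jk show False by blast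
  qed
  define U where "U = (\<Inter>m\<in>{..<n}. {u. 0 < (u \<bullet> p m) * (z \<bullet> p m)})"
  have "open U" unfolding U_def by (intro open_INT ballI open_Collect_less continuous_intros) auto
  moreover have "z \<in> U" unfolding U_def using z by (auto simp: zero_less_mult_iff linorder_neq_iff)
  ultimately obtain z' where z': "z' \<in> U" "\<forall>x\<in>Z. x \<bullet> z' \<noteq> 0"
    using avoid_hyperplanes[OF finZ Z0] by blast
  have sg: "0 < (z' \<bullet> p m) * (z \<bullet> p m)" if "m < n" for m using z'(1) that by (simp add: U_def)
  have "excess n p y = excess n p z'"
  proof (rule excess_segment[OF gp cp y])
    show "z' \<bullet> p m \<noteq> 0" if "m < n" for m using sg[OF that] by auto
    show "cross3 y (cross3 (p j) (p k)) \<bullet> z' \<noteq> 0" if "j < n" "k < n" "j \<noteq> k" for j k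
      using z'(2) that unfolding Z_def by auto
  qed
  also have "excess n p z' = excess n p z" by (rule excess_cong[OF cp sg])
  finally show ?thesis .
qed

text \<open>General position is reached by a perturbation that changes no sign of \<open>y\<close>
  or \<open>z\<close> at a vertex, so neither of the two values changes on the way.\<close>

lemma excess_unique:
  assumes cp: "cone_polygon n p"
    and y: "\<And>m. m < n \<Longrightarrow> y \<bullet> p m \<noteq> 0" and z: "\<And>m. m < n \<Longrightarrow> z \<bullet> p m \<noteq> 0"
  shows "excess n p y = excess n p z"
proof -
  have nz: "x \<bullet> p i \<noteq> 0" if "x \<in> {y, z}" "i < n" for x i using that y z by auto
  have fin: "finite {y, z}" by simp
  show ?thesis
  proof (rule isotopic_generic[OF cp fin])
    show "x \<bullet> p i \<noteq> 0" if "x \<in> {y, z}" "i < n" for x i by (rule nz[OF that])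
    fix P assume P: "P 0 = p" "\<And>i. continuous_on {0..1} (\<lambda>t::real. P t i)"
      "\<And>t. 0 \<le> t \<Longrightarrow> t \<le> 1 \<Longrightarrow> cone_polygon n (P t)" "generic_points n (P 1)"
      "\<And>t x i. 0 \<le> t \<Longrightarrow> t \<le> 1 \<Longrightarrow> x \<in> {y, z} \<Longrightarrow> i < n \<Longrightarrow> 0 < (x \<bullet> P t i) * (x \<bullet> p i)"
    have e: "excess n (P 0) x = excess n (P 1) x" if "x \<in> {y, z}" for x
    proof (rule excess_deformation)
      show "0 < (x \<bullet> P t i) * (x \<bullet> P 0 i)" if "0 \<le> t" "t \<le> 1" "i < n" for t i
        using P(5)[OF that(1,2) \<open>x \<in> {y, z}\<close> that(3)] P(1) by simp
    qed (use P(2,3) in auto)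
    have nz: "x \<bullet> P 1 m \<noteq> 0" if "x \<in> {y, z}" "m < n" for x m
      using P(5)[OF _ _ that, of 1] by auto
    have "excess n (P 1) y = excess n (P 1) z"
      by (rule excess_generic[OF P(4) P(3)]) (use nz in auto)
    then show ?thesis using e P(1) by simp
  qed
qed

lemma ex_general_direction:
  assumes "cone_polygon n p"
  shows "\<exists>y. \<forall>m<n. y \<bullet> p m \<noteq> 0"
proof -
  have "0 \<notin> p ` {..<n}"
  proof
    assume "0 \<in> p ` {..<n}"
    then obtain m where "m < n" "p m = 0" by auto
    then have "cross3 (p m) (p (nx n m)) = 0" by simp
    then show False using assms \<open>m < n\<close> unfolding cone_polygon_def by blast
  qed
  from avoid_hyperplanes[OF _ this, of UNIV] show ?thesis by (auto simp: inner_commute)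
qed

text \<open>As the excess is independent of the direction, it is a function of time along the path.
  Near any time a single direction stays general, which makes this function locally
  constant.\<close>

lemma excess_isotopic:
  assumes "isotopic n p q"
    and y: "\<And>m. m < n \<Longrightarrow> y \<bullet> p m \<noteq> 0" and z: "\<And>m. m < n \<Longrightarrow> z \<bullet> q m \<noteq> 0"
  shows "excess n p y = excess n q z"
proof -
  from assms(1) obtain g where g: "path g" "path_image g \<subseteq> Collect (cone_polygon n)"
    "pathstart g = p" "pathfinish g = q" unfolding path_component_def by blast
  define S where "S = {0..1 :: real}"
  have cont: "continuous_on S (\<lambda>t. g t i)" for i
    using g(1) unfolding path_def S_def by (rule continuous_on_product_then_coordinatewise)
  have cp: "cone_polygon n (g t)" if "t \<in> S" for t
    using g(2) that unfolding path_image_def S_def by blast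
  \<comment> \<open>The chosen directions need not vary continuously; the next fact shows that any
    general direction gives the same value.\<close>
  define e where "e t = excess n (g t) (SOME y. \<forall>m<n. y \<bullet> g t m \<noteq> 0)" for t
  have e: "e t = excess n (g t) y" if "t \<in> S" "\<And>m. m < n \<Longrightarrow> y \<bullet> g t m \<noteq> 0" for t y
    unfolding e_def
    by (rule excess_unique[OF cp[OF that(1)]])
      (use someI_ex[OF ex_general_direction[OF cp[OF that(1)]]] that in auto)
  have "e 0 = e 1"
  proof (rule connected_equivalence_relation_gen[where S = S and P = "\<lambda>_. True" and R = "\<lambda>s t. e s = e t"])
    show "connected S" by (simp add: S_def)
    show "0 \<in> S" "1 \<in> S" by (simp_all add: S_def)
    show "\<exists>T. openin (top_of_set S) T \<and> a \<in> T \<and> (\<forall>s\<in>T. \<forall>t\<in>T. True \<and> True \<longrightarrow> e s = e t)" if a: "a \<in> S" for a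
    proof -
      obtain y where y: "\<And>m. m < n \<Longrightarrow> y \<bullet> g a m \<noteq> 0" using ex_general_direction[OF cp[OF a]] by blast
      have "\<forall>\<^sub>F t in at a within S. 0 < (y \<bullet> g t m) * (y \<bullet> g a m)" if m: "m < n" for m
      proof (rule order_tendstoD(1))
        have "((\<lambda>t. g t m) \<longlongrightarrow> g a m) (at a within S)" using cont a by (simp add: continuous_on_def)
        then show "((\<lambda>t. (y \<bullet> g t m) * (y \<bullet> g a m)) \<longlongrightarrow> (y \<bullet> g a m) * (y \<bullet> g a m)) (at a within S)"
          by (intro tendsto_intros)
        show "0 < (y \<bullet> g a m) * (y \<bullet> g a m)" using y[OF m] by (auto simp: zero_less_mult_iff linorder_neq_iff)
      qed
      then have "\<forall>\<^sub>F t in at a within S. \<forall>m\<in>{..<n}. 0 < (y \<bullet> g t m) * (y \<bullet> g a m)"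
        by (intro eventually_ball_finite) auto
      then obtain d where d: "0 < d" and
        "\<And>t. t \<in> S \<Longrightarrow> t \<noteq> a \<Longrightarrow> dist t a < d \<Longrightarrow> \<forall>m\<in>{..<n}. 0 < (y \<bullet> g t m) * (y \<bullet> g a m)"
        unfolding eventually_at by blast
      then have sg: "0 < (y \<bullet> g t m) * (y \<bullet> g a m)" if "t \<in> S" "dist t a < d" "m < n" for t m
        using that y[of m] by (cases "t = a") (auto simp: zero_less_mult_iff linorder_neq_iff)
      have "e t = e a" if t: "t \<in> S \<inter> ball a d" for t
      proof -
        define P where "P s = g ((1 - s) * a + s * t)" for s
        have seg: "(1 - s) * a + s * t \<in> S \<inter> ball a d" if "0 \<le> s" "s \<le> 1" for s
        proof -
          have "convex (S \<inter> ball a d)" by (intro convex_Int) (simp_all add: S_def)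
          moreover have "a \<in> S \<inter> ball a d" using a d by simp
          ultimately show ?thesis using convexD_alt[of "S \<inter> ball a d" a t s] t that by simp
        qed
        have "excess n (P 0) y = excess n (P 1) y"
        proof (rule excess_deformation)
          have "continuous_on {0..1} ((\<lambda>r. g r i) \<circ> (\<lambda>s. (1 - s) * a + s * t))" for i
            using seg by (intro continuous_on_compose continuous_intros continuous_on_subset[OF cont]) auto
          then show "continuous_on {0..1} (\<lambda>s. P s i)" for i by (simp add: P_def o_def)
          show "cone_polygon n (P s)" if "0 \<le> s" "s \<le> 1" for s using cp seg[OF that] by (simp add: P_def)
          show "0 < (y \<bullet> P s i) * (y \<bullet> P 0 i)" if "0 \<le> s" "s \<le> 1" "i < n" for s i
            using sg[of "(1 - s) * a + s * t" i] seg[OF that(1,2)] that by (simp add: P_def dist_commute)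
        qed
        moreover have "e a = excess n (P 0) y" using e[OF a y] by (simp add: P_def)
        moreover have "e t = excess n (P 1) y"
        proof -
          have "y \<bullet> g t m \<noteq> 0" if "m < n" for m using sg[of t m] t that by (auto simp: dist_commute)
          then show ?thesis using e[of t y] t by (simp add: P_def)
        qed
        ultimately show ?thesis by simp
      qed
      then have "\<forall>s\<in>S \<inter> ball a d. \<forall>t\<in>S \<inter> ball a d. True \<and> True \<longrightarrow> e s = e t" by metis
      moreover have "openin (top_of_set S) (S \<inter> ball a d)" by (rule openin_open_Int) simp
      moreover have "a \<in> S \<inter> ball a d" using a d(1) by simp
      ultimately show ?thesis by blast
    qed
  qed auto
  moreover have "e 0 = excess n p y" "e 1 = excess n q z"
    using e[of 0 y] e[of 1 z] y z g(3,4) by (auto simp: S_def pathstart_def pathfinish_def)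
  ultimately show ?thesis by simp
qed

end

section \<open>Flat stars and the conclusion\<close>

lemma connected_punctured_sphere:
  fixes u :: "real^3"
  assumes "u \<in> sphere 0 1"
  shows "connected (sphere 0 1 - {u})"
proof -
  have "u \<noteq> 0" using assms by auto
  have "(sphere 0 1 - {u}) homeomorphic {x. u \<bullet> x = 0}"
    by (rule homeomorphic_punctured_sphere_hyperplane) (use assms \<open>u \<noteq> 0\<close> in auto)
  then show ?thesis using homeomorphic_connectedness convex_connected[OF convex_hyperplane] by blast
qed

text \<open>The cone over the punctured sphere misses at most one radius of the unit ball, which
  lies in a plane and is therefore negligible.\<close>

lemma spherical_area_punctured_sphere:
  fixes u :: "real^3"
  shows "spherical_area (sphere 0 1 - {u}) = 4 * pi"
proof -
  let ?A = "{r *\<^sub>R x | r x. 0 \<le> r \<and> r \<le> 1 \<and> x \<in> sphere 0 1 - {u}}"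
  obtain c where c: "c \<noteq> 0" "orthogonal u c"
    using orthogonal_to_vector_exists[of u] by auto
  have sub: "?A \<subseteq> cball 0 1" by (auto simp: mult_le_one)
  have "cball 0 1 - ?A \<subseteq> {x. c \<bullet> x = 0}"
  proof
    fix x assume x: "x \<in> cball 0 1 - ?A"
    show "x \<in> {x. c \<bullet> x = 0}"
    proof (cases "sgn x = u")
      case True
      then have "x = norm x *\<^sub>R u" by (cases "x = 0") (auto simp: sgn_div_norm)
      then have "c \<bullet> x = norm x * (c \<bullet> u)" by (metis inner_scaleR_right)
      then show ?thesis using c(2) by (simp add: orthogonal_def inner_commute)
    next
      case False
      have "x = 0"
      proof (rule ccontr)
        assume "x \<noteq> 0"
        then have "x = norm x *\<^sub>R sgn x" "sgn x \<in> sphere 0 1 - {u}" "0 \<le> norm x" "norm x \<le> 1"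
          using x False by (auto simp: sgn_div_norm norm_sgn)
        then have "x \<in> ?A" by blast
        then show False using x by blast
      qed
      then show ?thesis by simp
    qed
  qed
  then have "negligible (cball 0 1 - ?A)"
    using c(1) by (intro negligible_subset[OF negligible_hyperplane[of c 0]]) auto
  moreover have "?A - cball 0 1 = {}" using sub by blast
  ultimately have neg: "negligible (cball 0 1 - ?A \<union> (?A - cball 0 1))" by simp
  have "measure lebesgue ?A = measure lebesgue (cball 0 1 :: (real^3) set)"
    by (rule measure_negligible_symdiff[OF lmeasurable_cball neg])
  also have "\<dots> = measure lborel (cball 0 1 :: (real^3) set)" by simp
  also have "\<dots> = 4 / 3 * pi" by (simp add: content_cball unit_ball_vol_3)
  finally show ?thesis by (simp add: spherical_area_def)
qed

lemma great_arc_self: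
  assumes "norm u = 1"
  shows "great_arc u u = {u}"
proof (intro equalityI subsetI)
  fix x assume "x \<in> great_arc u u"
  then obtain s t where st: "0 \<le> s" "0 \<le> t" "x = (s + t) *\<^sub>R u" "norm x = 1"
    unfolding great_arc_def by (auto simp: scaleR_add_left)
  then have "s + t = 1" using assms by simp
  then show "x \<in> {u}" using st by simp
next
  fix x assume "x \<in> {u}"
  then have "x = 1 *\<^sub>R u + 0 *\<^sub>R u" by simp
  then show "x \<in> great_arc u u" using assms \<open>x \<in> {u}\<close> unfolding great_arc_def
    by (metis (mono_tags, lifting) dist_0_norm mem_Collect_eq mem_sphere order_refl singletonD zero_le_one)
qed

context winding_number
begin

text \<open>The half-space on one side of the plane is the cone required by
  \<open>convex_corner\<close>. The complement of the Gauss image is connected and has area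
  \<open>4 * pi\<close>, so every admissible direction falls under the large-area clause of the
  normalization.\<close>

lemma wind_flat:
  assumes flat: "flat_polygon n p" and y: "\<And>m. m < n \<Longrightarrow> y \<bullet> p m \<noteq> 0"
  shows "wind n p y = 0"
proof -
  define L where "L = star_list v n p"
  have cp: "cone_polygon n p" using flat by (simp add: flat_polygon_def)
  have n: "3 \<le> n" using cp by (simp add: cone_polygon_def)
  from flat obtain N where N: "N \<noteq> 0" and cr: "\<And>i. i < n \<Longrightarrow> \<exists>c>0. cross3 (p i) (p (nx n i)) = c *\<^sub>R N"
    and cover: "\<And>x. N \<bullet> x = 0 \<Longrightarrow> \<exists>i<n. \<exists>a\<ge>0. \<exists>b\<ge>0. x = a *\<^sub>R p i + b *\<^sub>R p (nx n i)"
    unfolding flat_polygon_def by blast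
  have Np: "N \<bullet> p i = 0" if i: "i < n" for i
  proof -
    obtain c where c: "0 < c" "cross3 (p i) (p (nx n i)) = c *\<^sub>R N" using cr[OF i] by blast
    have "c * (N \<bullet> p i) = cross3 (p i) (p (nx n i)) \<bullet> p i" unfolding c(2) by simp
    then show ?thesis using c(1) by (simp add: dot_cross_self)
  qed
  have normal: "star_normal v L i = sgn N" if i: "i < n" for i
  proof -
    obtain c where "0 < c" "cross3 (p i) (p (nx n i)) = c *\<^sub>R N" using cr[OF i] by blast
    then show ?thesis using i by (simp add: L_def star_normal_list sgn_scaleR)
  qed
  have "gauss_arc v L i = {sgn N}" if i: "i < n" for i
    using i N normal[OF i] normal[of "nx n i"]
    by (simp add: gauss_arc_def L_def nx_def[symmetric] great_arc_self norm_sgn)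
  then have g: "gauss_image v L = {sgn N}"
    using n unfolding gauss_image_def L_def length_star_list by (auto simp: lessThan_empty_iff)
  have emb: "embedded_star v L" unfolding L_def by (rule embedded_star_list[OF cp])
  have face: "star_face v L i = {v, v + p i, v + p (nx n i)}" if "i < n" for i
    using that by (simp add: star_face_eq L_def)
  have "conic hull ((\<lambda>x. x - v) ` surface_points (star_faces v L)) = {x. N \<bullet> x = 0}"
  proof (intro equalityI subsetI)
    fix x assume "x \<in> conic hull ((\<lambda>x. x - v) ` surface_points (star_faces v L))"
    then obtain c z i where i: "i < n" and z: "z \<in> convex hull star_face v L i" and x: "x = c *\<^sub>R (z - v)"
      unfolding conic_hull_explicit surface_points_def star_faces_def by (auto simp: L_def)
    from z obtain s t where "z = v + s *\<^sub>R p i + t *\<^sub>R p (nx n i)"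
      unfolding face[OF i] convex_hull_corner by auto
    then show "x \<in> {x. N \<bullet> x = 0}" using Np[OF i] Np[of "nx n i"] i by (simp add: x inner_add_right)
  next
    fix x assume "x \<in> {x. N \<bullet> x = 0}"
    then obtain i a b where i: "i < n" "0 \<le> a" "0 \<le> b" "x = a *\<^sub>R p i + b *\<^sub>R p (nx n i)"
      using cover by blast
    \<comment> \<open>Division by \<open>k\<close> brings the point of the sector into the triangle;
      the summand \<open>1\<close> keeps \<open>k\<close> positive.\<close>
    define k where "k = a + b + 1"
    have k: "0 < k" using i by (simp add: k_def)
    define z where "z = v + (a / k) *\<^sub>R p i + (b / k) *\<^sub>R p (nx n i)"
    have "z \<in> convex hull star_face v L i"
      unfolding face[OF i(1)] convex_hull_corner
    proof (rule exI[of _ "a / k"], intro conjI, simp_all)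
      show "0 \<le> a / k" using i k by simp
      show "\<exists>t\<ge>0. a / k + t \<le> 1 \<and> z = v + (a / k) *\<^sub>R p i + t *\<^sub>R p (nx n i)"
      proof (intro exI[of _ "b / k"] conjI)
        have "a / k + b / k = (a + b) / k" by (simp add: add_divide_distrib)
        also have "\<dots> \<le> 1" using k by (simp add: divide_le_eq k_def)
        finally show "a / k + b / k \<le> 1" .
      qed (use i k in \<open>simp_all add: z_def\<close>)
    qed
    then have "z \<in> surface_points (star_faces v L)"
      unfolding surface_points_def star_faces_def using i(1) by (auto simp: L_def)
    moreover have "x = k *\<^sub>R (z - v)" using k by (simp add: z_def i(4) algebra_simps)
    ultimately show "x \<in> conic hull ((\<lambda>x. x - v) ` surface_points (star_faces v L))"
      unfolding conic_hull_explicit using k by force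
  qed
  also have "\<dots> = frontier {x. N \<bullet> x \<le> 0}" using N by (simp add: frontier_halfspace_le)
  finally have "convex_corner v L"
    unfolding convex_corner_def
    by (intro conjI emb exI[of _ "{x. N \<bullet> x \<le> 0}"] convex_cone_halfspace_le polyhedron_halfspace_le) simp
  moreover have ys: "sgn y \<in> sphere 0 1 - gauss_image v L"
  proof -
    have "y \<noteq> 0" using y[of 0] n by auto
    then show ?thesis using off_gauss_image[OF n y] by (simp add: L_def norm_sgn)
  qed
  moreover have "spherical_area (connected_component_set (sphere 0 1 - gauss_image v L) (sgn y)) > 2 * pi"
  proof -
    have u: "sgn N \<in> sphere 0 1" using N by (simp add: norm_sgn)
    have "connected_component_set (sphere 0 1 - {sgn N}) (sgn y) = sphere 0 1 - {sgn N}"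
      using connected_punctured_sphere[OF u] ys unfolding g by (simp add: connected_component_eq_self)
    then show ?thesis unfolding g using spherical_area_punctured_sphere[of "sgn N"] by simp
  qed
  ultimately have "w v L (sgn y) = 0"
    using winding unfolding gauss_winding_number_def normalized_at_convex_corners_def Let_def by blast
  then show ?thesis by (simp add: wind_def L_def)
qed

lemma excess_flat:
  assumes flat: "flat_polygon n p" and y: "\<And>m. m < n \<Longrightarrow> y \<bullet> p m \<noteq> 0"
  shows "excess n p y = 0"
proof -
  have "sign_changes n p y = (\<Sum>m\<in>{m. m < n \<and> y \<bullet> p m < 0 \<and> 0 < y \<bullet> p (nx n m)}. 1)"
    unfolding sign_changes_def by (intro sum.mono_neutral_cong_right) auto
  also have "\<dots> = 1" using flat y unfolding flat_polygon_def by simp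
  finally show ?thesis
    using wind_flat[OF flat y] wind_flat[OF flat, of "- y"] y by (simp add: excess_def)
qed

end

text \<open>An edge at \<open>v\<close> counts if its other end is lower than \<open>v\<close>, a
  face if both other corners are. Each low neighbour is followed by a low one, giving a face, or by
  a high one, giving an upward sign change; so edges minus faces count the changes.\<close>

lemma critical_index_eq:
  assumes emb: "embedded_triangles F" and star: "star F v = star_faces v ps" and n: "n = length ps"
    and p: "p = (\<lambda>i. ps ! i - v)" and cp: "cone_polygon n p" and dist: "distinct ps"
    and y: "\<And>m. m < n \<Longrightarrow> \<xi> \<bullet> p m \<noteq> 0"
  shows "critical_index F v \<xi> = 1 - sign_changes n p \<xi>"
proof -
  have n3: "3 \<le> n" and cr: "\<And>i. i < n \<Longrightarrow> cross3 (p i) (p (nx n i)) \<noteq> 0"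
    using cp unfolding cone_polygon_def by blast+
  have vn: "ps ! i \<noteq> v" if "i < n" for i using cr[OF that] by (auto simp: p)
  have inj: "ps ! i = ps ! j \<longleftrightarrow> i = j" if "i < n" "j < n" for i j
    using that dist by (simp add: nth_eq_iff_index_eq n)
  have face: "star_face v ps i = {v, ps ! i, ps ! nx n i}" for i by (simp add: star_face_eq n)
  have le: "\<xi> \<bullet> ps ! i \<le> \<xi> \<bullet> v \<longleftrightarrow> \<xi> \<bullet> p i < 0" if "i < n" for i
    using y[OF that] by (auto simp: p inner_diff_right)
  have inF: "star_face v ps i \<in> F" if "i < n" for i
    using that star by (auto simp: star_def star_faces_def n)
  have fin: "finite F" using emb by (simp add: embedded_triangles_def)
  have finE: "finite (surface_edges F)"
  proof (rule finite_subset)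
    show "surface_edges F \<subseteq> Pow (\<Union>F)" by (auto simp: surface_edges_def)
    have "finite f" if "f \<in> F" for f
      using emb that unfolding embedded_triangles_def by (metis card.infinite zero_neq_numeral)
    then show "finite (Pow (\<Union>F))" using fin by blast
  qed
  have E: "{e \<in> surface_edges F. v \<in> e} = (\<lambda>i. {v, ps ! i}) ` {..<n}"
  proof (intro equalityI subsetI)
    fix e assume "e \<in> {e \<in> surface_edges F. v \<in> e}"
    then obtain f where e: "card e = 2" "v \<in> e" "f \<in> F" "e \<subseteq> f" by (auto simp: surface_edges_def)
    then have "f \<in> star F v" by (auto simp: star_def)
    then obtain i where i: "i < n" "f = {v, ps ! i, ps ! nx n i}"
      unfolding star star_faces_def face using n by auto
    obtain z where "e = {v, z}" "z \<noteq> v" using e(1,2) by (auto simp: card_2_iff)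
    then have "e = {v, ps ! i} \<or> e = {v, ps ! nx n i}" using e(4) i by auto
    then show "e \<in> (\<lambda>i. {v, ps ! i}) ` {..<n}" using i by auto
  next
    fix e assume "e \<in> (\<lambda>i. {v, ps ! i}) ` {..<n}"
    then obtain i where i: "i < n" "e = {v, ps ! i}" by auto
    then have "card e = 2" using vn[OF i(1)] by auto
    moreover have "e \<subseteq> star_face v ps i" unfolding face i by blast
    ultimately show "e \<in> {e \<in> surface_edges F. v \<in> e}" using inF[OF i(1)] i by (auto simp: surface_edges_def)
  qed
  have injE: "inj_on (\<lambda>i. {v, ps ! i}) {..<n}"
    using inj vn by (intro inj_onI) (auto simp: doubleton_eq_iff)
  \<comment> \<open>If two faces were equal as sets, \<open>i\<close> and \<open>j\<close> would be
    successors of each other, which is impossible in a cycle of length at least three.\<close>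
  have injF: "inj_on (star_face v ps) {..<n}"
  proof (rule inj_onI)
    fix i j assume ij: "i \<in> {..<n}" "j \<in> {..<n}" "star_face v ps i = star_face v ps j"
    then have i: "i < n" "j < n" "nx n i < n" "nx n j < n" by simp_all
    have "ps ! i \<in> {v, ps ! j, ps ! nx n j}" "ps ! j \<in> {v, ps ! i, ps ! nx n i}"
      using ij(3) unfolding face by blast+
    then have "(i = j \<or> i = nx n j) \<and> (j = i \<or> j = nx n i)" using vn i inj by auto
    then show "i = j" using nx_nx_neq(1)[OF i(1) n3] by auto
  qed
  have "(\<Sum>e\<in>surface_edges F. top_indicator e v \<xi>) = (\<Sum>e\<in>{e \<in> surface_edges F. v \<in> e}. top_indicator e v \<xi>)"
    using finE by (intro sum.mono_neutral_right) (auto simp: top_indicator_def)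
  also have "\<dots> = (\<Sum>i<n. top_indicator {v, ps ! i} v \<xi>)"
    unfolding E using injE by (simp add: sum.reindex)
  also have "\<dots> = (\<Sum>i<n. if \<xi> \<bullet> p i < 0 then 1 else 0)"
    by (intro sum.cong) (auto simp: top_indicator_def le)
  finally have sumE: "(\<Sum>e\<in>surface_edges F. top_indicator e v \<xi>) = (\<Sum>i<n. if \<xi> \<bullet> p i < 0 then 1 else 0)" .
  have "(\<Sum>f\<in>F. top_indicator f v \<xi>) = (\<Sum>f\<in>star F v. top_indicator f v \<xi>)"
    using fin by (intro sum.mono_neutral_right) (auto simp: top_indicator_def star_def)
  also have "\<dots> = (\<Sum>i<n. top_indicator (star_face v ps i) v \<xi>)"
    unfolding star star_faces_def n[symmetric] using injF by (simp add: sum.reindex)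
  also have "\<dots> = (\<Sum>i<n. if \<xi> \<bullet> p i < 0 \<and> \<xi> \<bullet> p (nx n i) < 0 then 1 else 0)"
    by (intro sum.cong) (auto simp: top_indicator_def face le)
  finally have sumF: "(\<Sum>f\<in>F. top_indicator f v \<xi>)
      = (\<Sum>i<n. if \<xi> \<bullet> p i < 0 \<and> \<xi> \<bullet> p (nx n i) < 0 then 1 else 0)" .
  have "sign_changes n p \<xi> = (\<Sum>i<n. (if \<xi> \<bullet> p i < 0 then 1 else 0)
      - (if \<xi> \<bullet> p i < 0 \<and> \<xi> \<bullet> p (nx n i) < 0 then 1 else 0))"
    unfolding sign_changes_def
  proof (rule sum.cong)
    fix i assume "i \<in> {..<n}"
    then have "\<xi> \<bullet> p (nx n i) \<noteq> 0" using y by simp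
    then show "(if \<xi> \<bullet> p i < 0 \<and> 0 < \<xi> \<bullet> p (nx n i) then 1 else 0)
      = (if \<xi> \<bullet> p i < 0 then 1 else 0) - (if \<xi> \<bullet> p i < 0 \<and> \<xi> \<bullet> p (nx n i) < 0 then 1 else 0 :: int)"
      by auto
  qed simp
  then show ?thesis unfolding critical_index_def sumE sumF by (simp add: sum_subtractf)
qed

theorem proposition10:
  fixes F :: "(real^3) set set" and v \<xi> :: "real^3" and ps :: "(real^3) list"
    and w :: "real^3 \<Rightarrow> (real^3) list \<Rightarrow> real^3 \<Rightarrow> int"
  assumes "closed_polyhedral_surface F"
    and "no_coplanar_neighbours F"
    and "v \<in> surface_vertices F"
    and "general_for F v \<xi>"
    and "ccw_star F v ps"
    and "gauss_winding_number w"
  shows "critical_index F v \<xi> = w v ps \<xi> + w v ps (- \<xi>)"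
proof -
  define n p where "n = length ps" and "p = (\<lambda>i. ps ! i - v)"
  have emb: "embedded_triangles F" using assms(1) by (simp add: closed_polyhedral_surface_def)
  have ccw: "3 \<le> length ps" "distinct ps" and star: "star F v = star_faces v ps"
    using assms(5) by (auto simp: ccw_star_def)
  have sub: "star_faces v ps \<subseteq> F" using star by (auto simp: star_def)
  then have "embedded_triangles (star_faces v ps)"
    using emb finite_subset[OF sub] unfolding embedded_triangles_def by blast
  then have "embedded_star v ps" using ccw by (simp add: embedded_star_def)
  then have cp: "cone_polygon n p" unfolding n_def p_def by (rule cone_polygon_if_embedded_star)
  have list: "star_list v n p = ps" unfolding n_def p_def by (rule star_list_nth)
  have \<xi>: "norm \<xi> = 1" using assms(4) by (simp add: general_for_def)
  have general: "\<xi> \<bullet> p m \<noteq> 0" if m: "m < n" for m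
  proof -
    have "cross3 (p m) (p (nx n m)) \<noteq> 0" using cp m by (simp add: cone_polygon_def)
    then have "ps ! m \<noteq> v" by (auto simp: p_def)
    then have "card {v, ps ! m} = 2" by auto
    moreover have "star_face v ps m \<in> F" using sub m by (auto simp: star_faces_def n_def)
    moreover have "{v, ps ! m} \<subseteq> star_face v ps m" unfolding star_face_eq by blast
    ultimately have "{v, ps ! m} \<in> surface_edges F" unfolding surface_edges_def by blast
    then have "\<xi> \<bullet> v \<noteq> \<xi> \<bullet> ps ! m" using assms(4) by (simp add: general_for_def)
    then show ?thesis by (simp add: p_def inner_diff_right)
  qed
  interpret winding_number w v by unfold_locales (rule assms(6))
  obtain q where q: "isotopic n p q" "flat_polygon n q" using isotopic_flat[OF cp] by blast
  then have "cone_polygon n q" by (simp add: flat_polygon_def)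
  from ex_general_direction[OF this] obtain z where z: "\<And>m. m < n \<Longrightarrow> z \<bullet> q m \<noteq> 0" by blast
  have "excess n p \<xi> = excess n q z" by (rule excess_isotopic[OF q(1) general z])
  also have "\<dots> = 0" by (rule excess_flat[OF q(2) z])
  finally have "1 - sign_changes n p \<xi> = wind n p \<xi> + wind n p (- \<xi>)" by (simp add: excess_def)
  moreover have "sgn \<xi> = \<xi>" "sgn (- \<xi>) = - \<xi>" using \<xi> by (simp_all add: sgn_div_norm)
  ultimately show ?thesis
    using critical_index_eq[OF emb star n_def p_def cp ccw(2) general] by (simp add: wind_def list)
qed

end
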